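(* Let $\varepsilon,\lambda>0$. A function $u\in H^2(M)$ is a weak solution of $$\varepsilon^2\Delta^2u-\Delta u=-\varepsilon\lambda\left[f''(e^{\sigma+u})e^{\sigma+u}+f'(e^{\sigma+u})\right]e^{\sigma+u}|\nabla(\sigma+u)|^2+2\varepsilon\lambda\,\Delta f(e^{\sigma+u})+\lambda^2f'(e^{\sigma+u})e^{\sigma+u}\bigl(s-f(e^{\sigma+u})\bigr)+A\quad\text{on }M$$ if and only if it is a critical point of the $C^1$ functional $I_\varepsilon$ defined on $H^2(M)$ by $$I_\varepsilon(u)=\frac{\varepsilon^2}{2}\int_M(\Delta u)^2+\frac12\int_M|\nabla u|^2+\varepsilon\lambda\int_Mf'(e^{\sigma+u})e^{\sigma+u}|\nabla(\sigma+u)|^2+\frac{\lambda^2}{2}\int_M\bigl(f(e^{\sigma+u})-s\bigr)^2-A\int_Mu.$$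
   Context: $M=\mathbb{R}^2/\mathbb{Z}^2$ is the flat 2-torus ($|M|=1$); $m>n$; $p_1,\dots,p_m,q_1,\dots,q_n\in M$ are fixed points; $A=4\pi(m-n)>0$; $\sigma$ is the unique distributional solution of $-\Delta\sigma=4\pi\sum_{j=1}^m\delta_{p_j}-4\pi\sum_{k=1}^n\delta_{q_k}-A$, $\int_M\sigma=0$. The function $f:[0,+\infty)\to\mathbb{R}$ and the constant $s\in\mathbb{R}$ satisfy: (f0) $f$ smooth and $f'(t)>0$ for all $t>0$; (f1) $f(0)<s<\sup_{t>0}f(t)<+\infty$; (f2) $\sup_{t>0}t^4|f'''(t)|<+\infty$. A weak solution $u\in H^2(M)$ of the fourth order equation is a function satisfying, for all $\phi\in H^2(M)$, the identity obtained by multiplying by $\phi$ and integrating over $M$, with $\int\Delta u\,\Delta\phi$ and $\int\nabla u\cdot\nabla\phi$ replacing $\int\phi\,\Delta^2u$ and $-\int\phi\,\Delta u$, and with $\Delta f(e^{\sigma+u})$ understood in the sense of distributions, i.e. $\int\phi\,\Delta f(e^{\sigma+u})=-\int\nabla f(e^{\sigma+u})\cdot\nabla\phi$. *)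

theory Defs
  imports "HOL-Analysis.Analysis"
begin

section \<open>Functions on the flat torus\<close>

text \<open>
  A function on the flat torus is a function on the plane that is periodic with respect to the
  integer lattice; integrals over the torus are Lebesgue integrals over the unit cell.
\<close>

definition periodic :: "(real^2 \<Rightarrow> 'b) \<Rightarrow> bool" where
  "periodic u \<longleftrightarrow> (\<forall>x i. u (x + axis i 1) = u x)"

abbreviation torus :: "(real^2) measure" where
  "torus \<equiv> lebesgue_on (cbox 0 1)"

definition L1 :: "(real^2 \<Rightarrow> real) set" where
  "L1 = {u. periodic u \<and> integrable torus u}"

definition L2 :: "(real^2 \<Rightarrow> real) set" where
  "L2 = {u. periodic u \<and> u \<in> borel_measurable torus \<and> integrable torus (\<lambda>x. (u x)\<^sup>2)}"

definition aeq :: "(real^2 \<Rightarrow> real) \<Rightarrow> (real^2 \<Rightarrow> real) \<Rightarrow> bool" where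
  "aeq u v \<longleftrightarrow> (AE x in torus. u x = v x)"


section \<open>Test functions, weak derivatives and distributions\<close>

definition pd :: "2 \<Rightarrow> (real^2 \<Rightarrow> real) \<Rightarrow> real^2 \<Rightarrow> real" where
  "pd i \<phi> x = frechet_derivative \<phi> (at x) (axis i 1)"

primrec Ck :: "nat \<Rightarrow> (real^2 \<Rightarrow> real) \<Rightarrow> bool" where
  "Ck 0 \<phi> \<longleftrightarrow> continuous_on UNIV \<phi>"
| "Ck (Suc k) \<phi> \<longleftrightarrow> \<phi> differentiable_on UNIV \<and> (\<forall>i. Ck k (pd i \<phi>))"

definition test_functions :: "(real^2 \<Rightarrow> real) set" where
  "test_functions = {\<phi>. periodic \<phi> \<and> (\<forall>k. Ck k \<phi>)}"

definition is_weak_pd :: "2 \<Rightarrow> (real^2 \<Rightarrow> real) \<Rightarrow> (real^2 \<Rightarrow> real) \<Rightarrow> bool" where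
  "is_weak_pd i u v \<longleftrightarrow> u \<in> L1 \<and> v \<in> L1 \<and>
     (\<forall>\<phi>\<in>test_functions. (LINT x|torus. u x * pd i \<phi> x) = - (LINT x|torus. v x * \<phi> x))"

definition weakly_differentiable :: "(real^2 \<Rightarrow> real) \<Rightarrow> bool" where
  "weakly_differentiable u \<longleftrightarrow> (\<forall>i. \<exists>v. is_weak_pd i u v)"

text \<open>Weak derivatives are only determined almost everywhere (see \<open>is_weak_pd_unique\<close> below);
  \<open>wpd i u\<close> is an arbitrary representative.\<close>

definition wpd :: "2 \<Rightarrow> (real^2 \<Rightarrow> real) \<Rightarrow> real^2 \<Rightarrow> real" where
  "wpd i u = (SOME v. is_weak_pd i u v)"

definition wgrad :: "(real^2 \<Rightarrow> real) \<Rightarrow> real^2 \<Rightarrow> real^2" where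
  "wgrad u x = (\<chi> i. wpd i u x)"

definition wlaplace :: "(real^2 \<Rightarrow> real) \<Rightarrow> real^2 \<Rightarrow> real" where
  "wlaplace u x = (\<Sum>i\<in>UNIV. wpd i (wpd i u) x)"

text \<open>
  The distributional equation
  \<open>- \<Delta>\<sigma> = 4\<pi> \<Sum>\<^sub>j \<delta>\<^bsub>p j\<^esub> - 4\<pi> \<Sum>\<^sub>k \<delta>\<^bsub>q k\<^esub> - A\<close> with \<open>\<integral> \<sigma> = 0\<close>.
  Points of the torus are given by representatives in the plane and need not be distinct.
\<close>

definition vortex_potential ::
    "nat \<Rightarrow> nat \<Rightarrow> (nat \<Rightarrow> real^2) \<Rightarrow> (nat \<Rightarrow> real^2) \<Rightarrow> real \<Rightarrow> (real^2 \<Rightarrow> real) \<Rightarrow> bool" where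
  "vortex_potential m n p q A \<sigma> \<longleftrightarrow>
     \<sigma> \<in> L1 \<and> (LINT x|torus. \<sigma> x) = 0 \<and>
     (\<forall>\<phi>\<in>test_functions.
        - (LINT x|torus. \<sigma> x * (\<Sum>i\<in>UNIV. pd i (pd i \<phi>) x)) =
          4 * pi * (\<Sum>j=1..m. \<phi> (p j)) - 4 * pi * (\<Sum>k=1..n. \<phi> (q k)) - A * (LINT x|torus. \<phi> x))"


section \<open>Hypotheses on the nonlinearity\<close>

text \<open>At \<open>t = 0\<close> the derivatives are one-sided; at \<open>t > 0\<close> they agree with those given by
  \<^const>\<open>deriv\<close>, which is never used at other points below.\<close>

definition smooth_on_halfline :: "(real \<Rightarrow> real) \<Rightarrow> bool" where
  "smooth_on_halfline f \<longleftrightarrow>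
     (\<exists>F :: nat \<Rightarrow> real \<Rightarrow> real. F 0 = f \<and>
        (\<forall>k. \<forall>t\<ge>0. (F k has_real_derivative F (Suc k) t) (at t within {0..})))"

definition hyp_f0 :: "(real \<Rightarrow> real) \<Rightarrow> bool" where
  "hyp_f0 f \<longleftrightarrow> smooth_on_halfline f \<and> (\<forall>t>0. deriv f t > 0)"

definition hyp_f1 :: "(real \<Rightarrow> real) \<Rightarrow> real \<Rightarrow> bool" where
  "hyp_f1 f s \<longleftrightarrow> bdd_above (f ` {0<..}) \<and> f 0 < s \<and> s < (SUP t\<in>{0<..}. f t)"

definition hyp_f2 :: "(real \<Rightarrow> real) \<Rightarrow> bool" where
  "hyp_f2 f \<longleftrightarrow> bdd_above ((\<lambda>t. t ^ 4 * \<bar>(deriv ^^ 3) f t\<bar>) ` {0<..})"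


section \<open>The Sobolev space of order two\<close>

definition H2_fun :: "(real^2 \<Rightarrow> real) set" where
  "H2_fun = {u\<in>L2. \<forall>i. \<exists>v\<in>L2. is_weak_pd i u v \<and> (\<forall>j. \<exists>w\<in>L2. is_weak_pd j v w)}"

definition H2_inner :: "(real^2 \<Rightarrow> real) \<Rightarrow> (real^2 \<Rightarrow> real) \<Rightarrow> real" where
  "H2_inner u v = (LINT x|torus. u x * v x)
     + (\<Sum>i\<in>UNIV. LINT x|torus. wpd i u x * wpd i v x)
     + (\<Sum>i\<in>UNIV. \<Sum>j\<in>UNIV. LINT x|torus. wpd j (wpd i u) x * wpd j (wpd i v) x)"


subsection \<open>Uniqueness of weak derivatives\<close>

inductive trig :: "(real^2 \<Rightarrow> real) \<Rightarrow> bool" where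
  trig_const: "trig (\<lambda>x. c)"
| trig_cos: "trig (\<lambda>x. cos (2 * pi * x $ i))"
| trig_sin: "trig (\<lambda>x. sin (2 * pi * x $ i))"
| trig_add: "trig u \<Longrightarrow> trig v \<Longrightarrow> trig (\<lambda>x. u x + v x)"
| trig_mult: "trig u \<Longrightarrow> trig v \<Longrightarrow> trig (\<lambda>x. u x * v x)"

lemma has_derivative_nth: "((\<lambda>x::real^2. x $ i) has_derivative (\<lambda>h. h $ i)) (at x)"
  by (rule bounded_linear.has_derivative[OF bounded_linear_vec_nth]) (rule has_derivative_ident)

lemma pd_eqI: "(\<And>x. (u has_derivative D x) (at x)) \<Longrightarrow> pd i u = (\<lambda>x. D x (axis i 1))"
  unfolding pd_def by (intro ext) (metis frechet_derivative_at)

lemma trig_pd: "trig u \<Longrightarrow> u differentiable_on UNIV \<and> (\<forall>i. trig (pd i u))"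
proof (induction rule: trig.induct)
  case (trig_const c)
  have "pd i (\<lambda>x. c) = (\<lambda>x. 0)" for i
    by (rule pd_eqI) (rule has_derivative_const)
  then show ?case by (simp add: trig.trig_const)
next
  case (trig_cos j)
  have D: "((\<lambda>x::real^2. cos (2 * pi * x $ j)) has_derivative
      (\<lambda>h. - (2 * pi * h $ j) * sin (2 * pi * x $ j))) (at x)" for x
    by (auto intro!: derivative_eq_intros has_derivative_nth)
  have "trig (pd i (\<lambda>x. cos (2 * pi * x $ j)))" for i
    unfolding pd_eqI[OF D] by (intro trig.intros)
  then show ?case using D by (auto simp: differentiable_on_def differentiable_def)
next
  case (trig_sin j)
  have D: "((\<lambda>x::real^2. sin (2 * pi * x $ j)) has_derivative
      (\<lambda>h. (2 * pi * h $ j) * cos (2 * pi * x $ j))) (at x)" for x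
    by (auto intro!: derivative_eq_intros has_derivative_nth)
  have "trig (pd i (\<lambda>x. sin (2 * pi * x $ j)))" for i
    unfolding pd_eqI[OF D] by (intro trig.intros)
  then show ?case using D by (auto simp: differentiable_on_def differentiable_def)
next
  case (trig_add u v)
  have u: "(u has_derivative frechet_derivative u (at x)) (at x)" for x
    using trig_add by (simp add: differentiable_on_def frechet_derivative_works)
  have v: "(v has_derivative frechet_derivative v (at x)) (at x)" for x
    using trig_add by (simp add: differentiable_on_def frechet_derivative_works)
  have "pd i (\<lambda>x. u x + v x) = (\<lambda>x. pd i u x + pd i v x)" for i
    by (subst pd_eqI[OF has_derivative_add[OF u v]]) (simp add: pd_def)
  then show ?case using trig_add
    by (auto intro: trig.intros differentiable_on_add)
next
  case (trig_mult u v)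
  have u: "(u has_derivative frechet_derivative u (at x)) (at x)" for x
    using trig_mult by (simp add: differentiable_on_def frechet_derivative_works)
  have v: "(v has_derivative frechet_derivative v (at x)) (at x)" for x
    using trig_mult by (simp add: differentiable_on_def frechet_derivative_works)
  have "pd i (\<lambda>x. u x * v x) = (\<lambda>x. u x * pd i v x + pd i u x * v x)" for i
    by (subst pd_eqI[OF has_derivative_mult[OF u v]]) (simp add: pd_def)
  moreover have "trig (\<lambda>x. u x * pd i v x + pd i u x * v x)" for i
    using trig_mult by (intro trig.trig_add trig.trig_mult) auto
  ultimately show ?case using trig_mult by (simp add: differentiable_on_mult)
qed

lemma trig_Ck: "trig u \<Longrightarrow> Ck k u"
  by (induction k arbitrary: u) (auto dest: trig_pd intro: differentiable_imp_continuous_on)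

lemma trig_periodic: "trig u \<Longrightarrow> periodic u"
proof (induction rule: trig.induct)
  case (trig_cos i)
  have "cos (2 * pi * (x + axis j 1) $ i) = cos (2 * pi * x $ i)" for x :: "real^2" and j
    by (cases "i = j") (simp_all add: axis_def distrib_left)
  then show ?case by (simp add: periodic_def)
next
  case (trig_sin i)
  have "sin (2 * pi * (x + axis j 1) $ i) = sin (2 * pi * x $ i)" for x :: "real^2" and j
    by (cases "i = j") (simp_all add: axis_def distrib_left)
  then show ?case by (simp add: periodic_def)
qed (simp_all add: periodic_def)

lemma trig_test: "trig u \<Longrightarrow> u \<in> test_functions"
  by (simp add: test_functions_def trig_Ck trig_periodic)

text \<open>The standard embedding of the torus; trigonometric polynomials are the polynomials in it.\<close>

definition emb :: "real^2 \<Rightarrow> (real^2) \<times> (real^2)" where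
  "emb x = ((\<chi> i. cos (2 * pi * x $ i)), (\<chi> i. sin (2 * pi * x $ i)))"

lemma continuous_on_emb: "continuous_on S emb"
  unfolding emb_def by (intro continuous_intros)

lemma trig_sum: "finite I \<Longrightarrow> (\<And>i. i \<in> I \<Longrightarrow> trig (u i)) \<Longrightarrow> trig (\<lambda>x. \<Sum>i\<in>I. u i x)"
  by (induction rule: finite_induct) (auto intro: trig.intros)

lemma trig_polynomial: "real_polynomial_function g \<Longrightarrow> trig (\<lambda>x. g (emb x))"
proof (induction rule: real_polynomial_function.induct)
  case (linear l)
  interpret l: bounded_linear l by fact
  have "l (emb x) = (\<Sum>i\<in>UNIV. cos (2 * pi * x $ i) * l (axis i 1, 0)) +
                    (\<Sum>i\<in>UNIV. sin (2 * pi * x $ i) * l (0, axis i 1))" for x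
  proof -
    have "emb x = (\<Sum>i\<in>UNIV. cos (2 * pi * x $ i) *\<^sub>R (axis i 1, 0)) +
                  (\<Sum>i\<in>UNIV. sin (2 * pi * x $ i) *\<^sub>R (0, axis i 1))"
      by (simp add: emb_def prod_eq_iff fst_sum snd_sum vec_eq_iff axis_def
            if_distrib[of "\<lambda>y. _ * y"] cong: if_cong)
    then show ?thesis by (simp only: l.add l.sum l.scaleR real_scaleR_def)
  qed
  then show ?case by (auto intro!: trig.intros trig_sum)
qed (auto intro: trig.intros)

lemma emb_inj:
  assumes x: "x \<in> box 0 1" and y: "y \<in> cbox 0 1" and eq: "emb x = emb y"
  shows "x = y"
proof -
  have "x $ i = y $ i" for i
  proof -
    have xi: "0 < x $ i" "x $ i < 1" using x by (auto simp: mem_box_cart)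
    have yi: "0 \<le> y $ i" "y $ i \<le> 1" using y by (auto simp: mem_box_cart)
    have "cos (2 * pi * x $ i) = cos (2 * pi * y $ i)" "sin (2 * pi * x $ i) = sin (2 * pi * y $ i)"
      using eq by (auto simp: emb_def vec_eq_iff)
    then obtain k :: int where k: "2 * pi * x $ i = 2 * pi * y $ i + 2 * pi * k"
      using sin_cos_eq_iff[of "2 * pi * x $ i" "2 * pi * y $ i"] by auto
    have "2 * pi * x $ i = 2 * pi * (y $ i + k)" using k by (simp add: distrib_left)
    then have "x $ i = y $ i + k" by simp
    then have "real_of_int k < 1" "real_of_int k > -1" using xi yi by linarith+
    then have "k = 0" by linarith
    then show ?thesis using \<open>x $ i = y $ i + k\<close> by simp
  qed
  then show ?thesis by (simp add: vec_eq_iff)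
qed

lemma finite_measure_torus: "finite_measure torus"
  by (rule finite_measure_lebesgue_on) (simp add: lmeasurable_cbox)

lemma integrable_mult_bounded:
  fixes v g :: "real^2 \<Rightarrow> real"
  assumes "integrable torus v" "g \<in> borel_measurable torus" "\<And>x. x \<in> cbox 0 1 \<Longrightarrow> \<bar>g x\<bar> \<le> B"
  shows "integrable torus (\<lambda>x. v x * g x)"
proof (rule Bochner_Integration.integrable_bound)
  show "integrable torus (\<lambda>x. B * v x)" using assms by simp
  show "(\<lambda>x. v x * g x) \<in> borel_measurable torus" using assms by measurable
  show "AE x in torus. norm (v x * g x) \<le> norm (B * v x)"
  proof (rule AE_I2)
    fix x assume "x \<in> space torus"
    then have "\<bar>g x\<bar> \<le> B" using assms(3) by simp
    then have "\<bar>v x\<bar> * \<bar>g x\<bar> \<le> \<bar>v x\<bar> * \<bar>B\<bar>" by (intro mult_left_mono) auto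
    then show "norm (v x * g x) \<le> norm (B * v x)" by (simp add: abs_mult mult.commute)
  qed
qed

lemma continuous_measurable_torus:
  "continuous_on UNIV (g :: real^2 \<Rightarrow> real) \<Longrightarrow> g \<in> borel_measurable torus"
  by (rule continuous_imp_measurable_on_sets_lebesgue)
     (auto intro: continuous_on_subset)

lemma continuous_bounded_torus:
  assumes "continuous_on UNIV (g :: real^2 \<Rightarrow> real)"
  obtains B where "\<And>x. x \<in> cbox 0 1 \<Longrightarrow> \<bar>g x\<bar> \<le> B"
proof -
  have "compact (g ` cbox 0 1)"
    by (intro compact_continuous_image compact_cbox continuous_on_subset[OF assms]) simp
  then have "bounded (g ` cbox 0 1)" by (rule compact_imp_bounded)
  then obtain B where "\<forall>y\<in>g ` cbox 0 1. norm y \<le> B" unfolding bounded_iff ..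
  then show ?thesis by (intro that[of B]) simp
qed

lemma integrable_mult_continuous:
  fixes v g :: "real^2 \<Rightarrow> real"
  assumes "integrable torus v" "continuous_on UNIV g"
  shows "integrable torus (\<lambda>x. v x * g x)"
proof -
  obtain B where "\<And>x. x \<in> cbox 0 1 \<Longrightarrow> \<bar>g x\<bar> \<le> B"
    using continuous_bounded_torus[OF assms(2)] by blast
  then show ?thesis
    by (rule integrable_mult_bounded[OF assms(1) continuous_measurable_torus[OF assms(2)]])
qed

context
  fixes v :: "real^2 \<Rightarrow> real"
  assumes v: "integrable torus v"
    and orth: "\<And>\<phi>. \<phi> \<in> test_functions \<Longrightarrow> (LINT x|torus. v x * \<phi> x) = 0"
begin

lemma measurable_times_indicator:
  assumes "X \<in> sets lebesgue"
  shows "(\<lambda>x. v x * indicator X x) \<in> borel_measurable torus"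
proof -
  have "{x \<in> space torus. x \<in> X} = X \<inter> cbox 0 1" by auto
  moreover have "X \<inter> cbox 0 1 \<in> sets torus"
    using assms by (auto simp: sets_restrict_space_iff)
  ultimately show ?thesis
    using v by (intro borel_measurable_times borel_measurable_indicator') auto
qed

lemma orth_continuous:
  assumes H: "continuous_on UNIV (H :: (real^2) \<times> (real^2) \<Rightarrow> real)"
  shows "(LINT x|torus. v x * H (emb x)) = 0"
proof -
  have bd: "\<bar>LINT x|torus. v x * H (emb x)\<bar> \<le> e * (LINT x|torus. \<bar>v x\<bar>)" if e: "e > 0" for e
  proof -
    have "compact (emb ` cbox 0 1)"
      by (intro compact_continuous_image compact_cbox continuous_on_emb)
    then obtain g where g: "real_polynomial_function g"
        "\<And>z. z \<in> emb ` cbox 0 1 \<Longrightarrow> \<bar>H z - g z\<bar> < e"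
      using Stone_Weierstrass_real_polynomial_function[of "emb ` cbox 0 1" H e]
        continuous_on_subset[OF H] e by blast
    have trig: "trig (\<lambda>x. g (emb x))" using g(1) by (rule trig_polynomial)
    have cg: "continuous_on UNIV (\<lambda>x. g (emb x))" using trig_Ck[OF trig, of 0] by simp
    have cH: "continuous_on UNIV (\<lambda>x. H (emb x))"
      by (intro continuous_on_compose2[OF H] continuous_on_emb) auto
    have i1: "integrable torus (\<lambda>x. v x * H (emb x))"
      by (rule integrable_mult_continuous[OF v cH])
    have i2: "integrable torus (\<lambda>x. v x * g (emb x))"
      by (rule integrable_mult_continuous[OF v cg])
    have "(LINT x|torus. v x * H (emb x)) =
        (LINT x|torus. v x * H (emb x)) - (LINT x|torus. v x * g (emb x))"
      using orth[OF trig_test[OF trig]] by simp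
    also have "\<dots> = (LINT x|torus. v x * H (emb x) - v x * g (emb x))"
      using i1 i2 by simp
    finally have "\<bar>LINT x|torus. v x * H (emb x)\<bar> \<le>
        (LINT x|torus. \<bar>v x * H (emb x) - v x * g (emb x)\<bar>)"
      using integral_abs_bound[of torus "\<lambda>x. v x * H (emb x) - v x * g (emb x)"] by simp
    also have "\<dots> \<le> (LINT x|torus. e * \<bar>v x\<bar>)"
    proof (rule integral_mono)
      show "integrable torus (\<lambda>x. \<bar>v x * H (emb x) - v x * g (emb x)\<bar>)" using i1 i2 by simp
      show "integrable torus (\<lambda>x. e * \<bar>v x\<bar>)" using v by simp
      fix x assume "x \<in> space torus"
      then have "\<bar>H (emb x) - g (emb x)\<bar> \<le> e" using g(2)[of "emb x"] by force
      then have "\<bar>v x\<bar> * \<bar>H (emb x) - g (emb x)\<bar> \<le> \<bar>v x\<bar> * e" by (intro mult_left_mono) auto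
      then show "\<bar>v x * H (emb x) - v x * g (emb x)\<bar> \<le> e * \<bar>v x\<bar>"
        by (simp add: abs_mult[symmetric] right_diff_distrib mult.commute)
    qed
    finally show ?thesis by simp
  qed
  define C where "C = (LINT x|torus. \<bar>v x\<bar>)"
  have C: "C \<ge> 0" unfolding C_def by simp
  have "\<bar>LINT x|torus. v x * H (emb x)\<bar> \<le> 0 + e" if "e > 0" for e
  proof -
    have "\<bar>LINT x|torus. v x * H (emb x)\<bar> \<le> e / (C + 1) * C"
      using bd[of "e / (C + 1)"] that C unfolding C_def[symmetric] by simp
    also have "\<dots> \<le> e" using that C by (simp add: field_simps)
    finally show ?thesis by simp
  qed
  then have "\<bar>LINT x|torus. v x * H (emb x)\<bar> \<le> 0" by (rule field_le_epsilon)
  then show ?thesis by simp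
qed

lemma integral_open_zero:
  assumes W: "open W" "W \<subseteq> box 0 1"
  shows "(LINT x|torus. v x * indicator W x) = 0"
proof -
  define K where "K = emb ` (cbox 0 1 - W)"
  have "compact (cbox 0 1 - W)" using W by (intro compact_diff) auto
  then have K: "closed K" unfolding K_def
    by (intro compact_imp_closed compact_continuous_image continuous_on_emb)
  have KW: "emb x \<in> K \<longleftrightarrow> x \<notin> W" if "x \<in> cbox 0 1" for x
  proof
    assume "emb x \<in> K"
    then obtain y where y: "y \<in> cbox 0 1" "y \<notin> W" "emb x = emb y" by (auto simp: K_def)
    show "x \<notin> W"
    proof
      assume "x \<in> W"
      then have "x = y" using W y by (intro emb_inj) auto
      then show False using y \<open>x \<in> W\<close> by simp
    qed
  qed (use that in \<open>auto simp: K_def\<close>)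
  have Kne: "K \<noteq> {}"
  proof -
    have "(0::real^2) \<in> cbox 0 1" "(0::real^2) \<notin> box 0 1" by (auto simp: mem_box_cart)
    then show ?thesis using W unfolding K_def by blast
  qed
  define H where "H k z = min 1 (real k * infdist z K)" for k z
  have cont: "continuous_on UNIV (H k)" for k
    unfolding H_def by (intro continuous_intros)
  have "(\<lambda>k. LINT x|torus. v x * H k (emb x)) \<longlonglongrightarrow> (LINT x|torus. v x * indicator W x)"
  proof (rule integral_dominated_convergence[where w="\<lambda>x. \<bar>v x\<bar>"])
    show "(\<lambda>x. v x * indicator W x) \<in> borel_measurable torus"
      using W by (intro measurable_times_indicator) (auto intro: borel_open)
    fix k
    have cH: "continuous_on UNIV (\<lambda>x. H k (emb x))"
      by (intro continuous_on_compose2[OF cont] continuous_on_emb) auto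
    show "(\<lambda>x. v x * H k (emb x)) \<in> borel_measurable torus"
      using integrable_mult_continuous[OF v cH] by simp
    have H1: "\<bar>H k z\<bar> \<le> 1" for z unfolding H_def using infdist_nonneg[of z K] by auto
    show "AE x in torus. norm (v x * H k (emb x)) \<le> \<bar>v x\<bar>"
      by (rule AE_I2) (use H1 in \<open>simp add: abs_mult mult_left_le\<close>)
  next
    show "integrable torus (\<lambda>x. \<bar>v x\<bar>)" using v by simp
    show "AE x in torus. (\<lambda>k. v x * H k (emb x)) \<longlonglongrightarrow> v x * indicator W x"
    proof (rule AE_I2)
      fix x assume "x \<in> space torus"
      then have x: "x \<in> cbox 0 1" by simp
      have "(\<lambda>k. H k (emb x)) \<longlonglongrightarrow> indicator W x"
      proof (cases "x \<in> W")
        case True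
        then have "emb x \<notin> K" using KW[OF x] by simp
        then have pos: "infdist (emb x) K > 0"
          using K Kne infdist_pos_not_in_closed by blast
        obtain N where N: "1 < real N * infdist (emb x) K"
          using reals_Archimedean3[OF pos] by blast
        have "H k (emb x) = 1" if "k \<ge> N" for k
        proof -
          have "real N * infdist (emb x) K \<le> real k * infdist (emb x) K"
            using that pos by (intro mult_right_mono) auto
          then show ?thesis using N unfolding H_def by simp
        qed
        then have "\<forall>\<^sub>F k in sequentially. H k (emb x) = 1"
          unfolding eventually_sequentially by blast
        then show ?thesis using True by (simp add: tendsto_eventually)
      next
        case False
        then have "emb x \<in> K" using KW[OF x] by simp
        then show ?thesis using False by (simp add: H_def)
      qed
      then show "(\<lambda>k. v x * H k (emb x)) \<longlonglongrightarrow> v x * indicator W x"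
        by (intro tendsto_intros)
    qed
  qed
  then show ?thesis using orth_continuous[OF cont] by (simp add: LIMSEQ_const_iff)
qed

lemma integral_set_zero:
  assumes S: "S \<in> sets torus"
  shows "(LINT x:S|torus. v x) = 0"
proof -
  have S': "S \<in> sets lebesgue" "S \<subseteq> cbox 0 1"
    using S by (auto simp: sets_restrict_space_iff)
  obtain C T where C: "gdelta C" "T \<in> null_sets lebesgue" "S \<union> T = C" "disjnt S T"
    using lebesgue_set_almost_gdelta[OF S'(1)] .
  obtain U :: "nat \<Rightarrow> (real^2) set" where U: "\<And>n. open (U n)" "C = (\<Inter>n. U n)"
    using C(1) by (auto elim!: gdelta.cases)
  define W where "W n = box 0 1 \<inter> (\<Inter>k\<in>{..n}. U k)" for n
  have W: "open (W n)" "W n \<subseteq> box 0 1" for n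
    unfolding W_def using U(1) by auto
  note meas = measurable_times_indicator
  have Cm: "C \<in> sets lebesgue" using C S' by auto
  have lim: "(\<lambda>n. LINT x|torus. v x * indicator (W n) x) \<longlonglongrightarrow>
      (LINT x|torus. v x * indicator (box 0 1 \<inter> C) x)"
  proof (rule integral_dominated_convergence[where w="\<lambda>x. \<bar>v x\<bar>"])
    show "(\<lambda>x. v x * indicator (box 0 1 \<inter> C) x) \<in> borel_measurable torus"
      using Cm by (intro meas) auto
    show "(\<lambda>x. v x * indicator (W n) x) \<in> borel_measurable torus" for n
      using W by (intro meas) (auto intro: borel_open)
    show "integrable torus (\<lambda>x. \<bar>v x\<bar>)" using v by simp
    show "AE x in torus. norm (v x * indicator (W n) x) \<le> \<bar>v x\<bar>" for n
      by (rule AE_I2) (simp add: indicator_def)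
    show "AE x in torus. (\<lambda>n. v x * indicator (W n) x) \<longlonglongrightarrow> v x * indicator (box 0 1 \<inter> C) x"
    proof (rule AE_I2)
      fix x
      have "\<forall>\<^sub>F n in sequentially. indicator (W n) x = (indicator (box 0 1 \<inter> C) x :: real)"
      proof (cases "x \<in> box 0 1 \<inter> C")
        case True
        then show ?thesis by (auto simp: W_def U(2))
      next
        case False
        then obtain N where "x \<notin> box 0 1 \<or> x \<notin> U N" by (auto simp: U(2))
        then have "x \<notin> W n" if "n \<ge> N" for n using that by (auto simp: W_def)
        then show ?thesis using False unfolding eventually_sequentially
          by (metis indicator_simps(2))
      qed
      then show "(\<lambda>n. v x * indicator (W n) x) \<longlonglongrightarrow> v x * indicator (box 0 1 \<inter> C) x"
        by (intro tendsto_intros tendsto_eventually)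
    qed
  qed
  have "(LINT x|torus. v x * indicator (box 0 1 \<inter> C) x) = 0"
    using lim integral_open_zero[OF W] by (simp add: LIMSEQ_const_iff)
  moreover have "(LINT x:S|torus. v x) = (LINT x|torus. v x * indicator (box 0 1 \<inter> C) x)"
    unfolding set_lebesgue_integral_def
  proof (rule integral_cong_AE)
    show "(\<lambda>x. indicat_real S x *\<^sub>R v x) \<in> borel_measurable torus"
      using meas[OF S'(1)] by (simp add: mult.commute)
    show "(\<lambda>x. v x * indicator (box 0 1 \<inter> C) x) \<in> borel_measurable torus"
      using Cm by (intro meas) auto
    have "T \<union> (cbox 0 1 - box 0 1) \<in> null_sets lebesgue"
      using C(2) negligible_frontier_interval[of 0 "1::real^2"]
      by (auto simp: negligible_iff_null_sets)
    then have "AE x in lebesgue. x \<notin> T \<union> (cbox 0 1 - box 0 1)"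
      by (rule AE_not_in)
    then have "AE x in torus. x \<notin> T \<union> (cbox 0 1 - box 0 1)"
      by (subst AE_restrict_space_iff) auto
    then show "AE x in torus. indicat_real S x *\<^sub>R v x = v x * indicator (box 0 1 \<inter> C) x"
    proof (rule AE_mp[OF _ AE_I2], intro impI)
      fix x assume "x \<in> space torus" "x \<notin> T \<union> (cbox 0 1 - box 0 1)"
      then have "x \<in> box 0 1" "x \<in> S \<longleftrightarrow> x \<in> C" using C(3) by auto
      then show "indicat_real S x *\<^sub>R v x = v x * indicator (box 0 1 \<inter> C) x"
        by (simp add: indicator_def)
    qed
  qed
  ultimately show ?thesis by simp
qed

lemma orth_imp_AE_zero: "AE x in torus. v x = 0"
  by (rule density_unique_real[OF v]) (simp_all add: integral_set_zero)

end


lemma test_continuous: "\<phi> \<in> test_functions \<Longrightarrow> continuous_on UNIV \<phi>"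
  unfolding test_functions_def by (metis (mono_tags, lifting) Ck.simps(1) mem_Collect_eq)

lemma test_pd_continuous: "\<phi> \<in> test_functions \<Longrightarrow> continuous_on UNIV (pd i \<phi>)"
  unfolding test_functions_def by (metis (mono_tags, lifting) Ck.simps mem_Collect_eq)

lemma L1_integrable: "u \<in> L1 \<Longrightarrow> integrable torus u"
  by (simp add: L1_def)

lemma is_weak_pd_unique:
  assumes v: "is_weak_pd i u v" and w: "is_weak_pd i u w"
  shows "aeq v w"
proof -
  have iv: "integrable torus v" and iw: "integrable torus w"
    using v w by (auto simp: is_weak_pd_def L1_def)
  have "AE x in torus. v x - w x = 0"
  proof (rule orth_imp_AE_zero)
    show "integrable torus (\<lambda>x. v x - w x)" using iv iw by simp
    fix \<phi> assume \<phi>: "\<phi> \<in> test_functions"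
    have "(LINT x|torus. v x * \<phi> x) = (LINT x|torus. w x * \<phi> x)"
      using v w \<phi> by (auto simp: is_weak_pd_def)
    then show "(LINT x|torus. (v x - w x) * \<phi> x) = 0"
      using integrable_mult_continuous[OF iv test_continuous[OF \<phi>]]
        integrable_mult_continuous[OF iw test_continuous[OF \<phi>]]
      by (simp add: left_diff_distrib)
  qed
  then show ?thesis by (simp add: aeq_def)
qed

lemma aeq_refl [simp]: "aeq u u"
  by (simp add: aeq_def)

lemma aeq_sym: "aeq u v \<Longrightarrow> aeq v u"
  unfolding aeq_def by (auto elim: AE_mp)

lemma aeq_trans: "aeq u v \<Longrightarrow> aeq v w \<Longrightarrow> aeq u w"
  unfolding aeq_def by (elim AE_mp) auto

lemma aeq_add: "aeq u u' \<Longrightarrow> aeq v v' \<Longrightarrow> aeq (\<lambda>x. u x + v x) (\<lambda>x. u' x + v' x)"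
  unfolding aeq_def by (elim AE_mp) auto

lemma aeq_scale: "aeq u u' \<Longrightarrow> aeq (\<lambda>x. c * u x) (\<lambda>x. c * u' x)"
  unfolding aeq_def by (elim AE_mp) auto

lemma periodic_add: "periodic u \<Longrightarrow> periodic v \<Longrightarrow> periodic (\<lambda>x. u x + v x :: real)"
  by (simp add: periodic_def)

lemma periodic_scale: "periodic u \<Longrightarrow> periodic (\<lambda>x. c * u x :: real)"
  by (simp add: periodic_def)

lemma L1_add: "u \<in> L1 \<Longrightarrow> v \<in> L1 \<Longrightarrow> (\<lambda>x. u x + v x) \<in> L1"
  by (simp add: L1_def periodic_add)

lemma L1_scale: "u \<in> L1 \<Longrightarrow> (\<lambda>x. c * u x) \<in> L1"
  by (simp add: L1_def periodic_scale)

lemma L2_mult_integrable: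
  assumes "u \<in> L2" "v \<in> L2"
  shows "integrable torus (\<lambda>x. u x * v x)"
proof (rule Bochner_Integration.integrable_bound)
  show "integrable torus (\<lambda>x. (u x)\<^sup>2 + (v x)\<^sup>2)" using assms by (simp add: L2_def)
  show "(\<lambda>x. u x * v x) \<in> borel_measurable torus"
    using assms by (auto simp: L2_def intro!: borel_measurable_times)
  show "AE x in torus. norm (u x * v x) \<le> norm ((u x)\<^sup>2 + (v x)\<^sup>2)"
  proof (rule AE_I2)
    fix x
    have "2 * \<bar>u x\<bar> * \<bar>v x\<bar> \<le> \<bar>u x\<bar>\<^sup>2 + \<bar>v x\<bar>\<^sup>2" by (rule sum_squares_bound)
    moreover have "0 \<le> \<bar>u x\<bar> * \<bar>v x\<bar>" by simp
    ultimately have "\<bar>u x\<bar> * \<bar>v x\<bar> \<le> (u x)\<^sup>2 + (v x)\<^sup>2" unfolding power2_abs by linarith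
    then have "\<bar>u x * v x\<bar> \<le> (u x)\<^sup>2 + (v x)\<^sup>2" by (simp add: abs_mult)
    then show "norm (u x * v x) \<le> norm ((u x)\<^sup>2 + (v x)\<^sup>2)" by simp
  qed
qed

lemma L2_add: "u \<in> L2 \<Longrightarrow> v \<in> L2 \<Longrightarrow> (\<lambda>x. u x + v x) \<in> L2"
  using L2_mult_integrable[of u v]
  by (auto simp: L2_def periodic_add power2_sum mult.assoc intro!: borel_measurable_add)

lemma L2_scale: "u \<in> L2 \<Longrightarrow> (\<lambda>x. c * u x) \<in> L2"
  by (auto simp: L2_def periodic_scale power_mult_distrib intro!: borel_measurable_times)

lemma L2_zero: "(\<lambda>x. 0) \<in> L2"
  by (simp add: L2_def periodic_def)

lemma L2_L1: "u \<in> L2 \<Longrightarrow> u \<in> L1"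
  using finite_measure.square_integrable_imp_integrable[OF finite_measure_torus]
  by (auto simp: L2_def L1_def)

lemma L2_aeq:
  assumes "u \<in> L2" "v \<in> L1" "aeq u v"
  shows "v \<in> L2"
proof -
  have "integrable torus (\<lambda>x. (u x)\<^sup>2) \<longleftrightarrow> integrable torus (\<lambda>x. (v x)\<^sup>2)"
    using assms by (intro integrable_cong_AE) (auto simp: L1_def L2_def aeq_def elim: AE_mp)
  then show ?thesis using assms by (auto simp: L1_def L2_def)
qed

lemma is_weak_pd_add:
  assumes "is_weak_pd i u u'" "is_weak_pd i v v'"
  shows "is_weak_pd i (\<lambda>x. u x + v x) (\<lambda>x. u' x + v' x)"
  using assms unfolding is_weak_pd_def
  by (auto simp: L1_add distrib_right integrable_mult_continuous L1_integrable test_continuous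
      test_pd_continuous)

lemma is_weak_pd_scale:
  assumes "is_weak_pd i u u'"
  shows "is_weak_pd i (\<lambda>x. c * u x) (\<lambda>x. c * u' x)"
  using assms unfolding is_weak_pd_def
  by (auto simp: L1_scale mult.assoc)

lemma is_weak_pd_aeq:
  assumes "is_weak_pd i u u'" "v \<in> L1" "aeq u v"
  shows "is_weak_pd i v u'"
proof -
  have "(LINT x|torus. v x * pd i \<phi> x) = (LINT x|torus. u x * pd i \<phi> x)"
    if \<phi>: "\<phi> \<in> test_functions" for \<phi>
  proof (rule integral_cong_AE)
    have "u \<in> L1" using assms by (simp add: is_weak_pd_def)
    then show "(\<lambda>x. u x * pd i \<phi> x) \<in> borel_measurable torus"
      "(\<lambda>x. v x * pd i \<phi> x) \<in> borel_measurable torus"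
      using integrable_mult_continuous[OF L1_integrable test_pd_continuous[OF \<phi>]] assms by auto
    show "AE x in torus. v x * pd i \<phi> x = u x * pd i \<phi> x"
      using assms(3) by (auto simp: aeq_def elim: AE_mp)
  qed
  then show ?thesis using assms by (auto simp: is_weak_pd_def)
qed

lemma wpd_works: "is_weak_pd i u v \<Longrightarrow> is_weak_pd i u (wpd i u)"
  unfolding wpd_def by (rule someI[where P = "is_weak_pd i u"])

lemma wpd_aeqI: "is_weak_pd i u v \<Longrightarrow> aeq (wpd i u) v"
  by (rule is_weak_pd_unique[OF wpd_works])

lemma wpd_cong:
  assumes "u \<in> L1 \<longleftrightarrow> v \<in> L1" "aeq u v"
  shows "wpd i u = wpd i v"
proof -
  have "is_weak_pd i u w \<longleftrightarrow> is_weak_pd i v w" for w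
    using assms is_weak_pd_aeq[of i u w v] is_weak_pd_aeq[of i v w u] aeq_sym[of u v]
    by (auto simp: is_weak_pd_def)
  then show ?thesis by (simp add: wpd_def)
qed

lemma H2_funI:
  assumes "u \<in> L2" "\<And>i. is_weak_pd i u (v i)" "\<And>i. v i \<in> L2"
    "\<And>i j. is_weak_pd j (v i) (w i j)" "\<And>i j. w i j \<in> L2"
  shows "u \<in> H2_fun"
  unfolding H2_fun_def mem_Collect_eq
proof (intro conjI allI)
  fix i
  show "\<exists>v\<in>L2. is_weak_pd i u v \<and> (\<forall>j. \<exists>w\<in>L2. is_weak_pd j v w)"
    by (rule bexI[of _ "v i"], intro conjI allI)
      (use assms in \<open>blast+\<close>)
qed (rule assms)

lemma H2_fun_iff:
  "u \<in> H2_fun \<longleftrightarrow> u \<in> L2 \<and>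
     (\<forall>i. is_weak_pd i u (wpd i u) \<and> wpd i u \<in> L2 \<and>
       (\<forall>j. is_weak_pd j (wpd i u) (wpd j (wpd i u)) \<and> wpd j (wpd i u) \<in> L2))"
  (is "_ \<longleftrightarrow> ?R")
proof
  assume u: "u \<in> H2_fun"
  have "is_weak_pd i u (wpd i u) \<and> wpd i u \<in> L2 \<and>
       (\<forall>j. is_weak_pd j (wpd i u) (wpd j (wpd i u)) \<and> wpd j (wpd i u) \<in> L2)" for i
  proof -
    obtain v where v: "v \<in> L2" "is_weak_pd i u v" "\<forall>j. \<exists>w\<in>L2. is_weak_pd j v w"
      using u unfolding H2_fun_def by blast
    have wp: "is_weak_pd i u (wpd i u)" using v by (intro wpd_works)
    then have w1: "wpd i u \<in> L1" by (simp add: is_weak_pd_def)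
    have ae: "aeq v (wpd i u)" using wpd_aeqI[OF v(2)] by (rule aeq_sym)
    have "is_weak_pd j (wpd i u) (wpd j (wpd i u)) \<and> wpd j (wpd i u) \<in> L2" for j
    proof -
      obtain w where w: "w \<in> L2" "is_weak_pd j v w" using v by blast
      have *: "is_weak_pd j (wpd i u) w" by (rule is_weak_pd_aeq[OF w(2) w1 ae])
      have "wpd j (wpd i u) \<in> L1" using wpd_works[OF *] by (simp add: is_weak_pd_def)
      then have "wpd j (wpd i u) \<in> L2"
        by (rule L2_aeq[OF w(1) _ aeq_sym[OF wpd_aeqI[OF *]]])
      then show ?thesis using wpd_works[OF *] by simp
    qed
    then show ?thesis using wp L2_aeq[OF v(1) w1 ae] by blast
  qed
  moreover have "u \<in> L2" using u by (simp add: H2_fun_def)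
  ultimately show ?R by blast
next
  assume ?R
  then show "u \<in> H2_fun"
    by (intro H2_funI[of u "\<lambda>i. wpd i u" "\<lambda>i j. wpd j (wpd i u)"]) simp_all
qed

lemma H2_fun_L1: "u \<in> H2_fun \<Longrightarrow> u \<in> L1"
  by (simp add: H2_fun_def L2_L1)

lemma H2_fun_add: "u \<in> H2_fun \<Longrightarrow> v \<in> H2_fun \<Longrightarrow> (\<lambda>x. u x + v x) \<in> H2_fun"
  by (rule H2_funI[where v = "\<lambda>i x. wpd i u x + wpd i v x"
        and w = "\<lambda>i j x. wpd j (wpd i u) x + wpd j (wpd i v) x"])
    (simp_all add: H2_fun_iff L2_add is_weak_pd_add)

lemma H2_fun_scale: "u \<in> H2_fun \<Longrightarrow> (\<lambda>x. c * u x) \<in> H2_fun"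
  by (rule H2_funI[where v = "\<lambda>i x. c * wpd i u x" and w = "\<lambda>i j x. c * wpd j (wpd i u) x"])
    (simp_all add: H2_fun_iff L2_scale is_weak_pd_scale)

lemma is_weak_pd_zero: "is_weak_pd i (\<lambda>x. 0) (\<lambda>x. 0)"
  by (simp add: is_weak_pd_def L2_L1[OF L2_zero])

lemma H2_fun_zero: "(\<lambda>x. 0) \<in> H2_fun"
  by (rule H2_funI[OF L2_zero is_weak_pd_zero L2_zero is_weak_pd_zero L2_zero])

lemma wpd_add:
  assumes "u \<in> H2_fun" "v \<in> H2_fun"
  shows "aeq (wpd i (\<lambda>x. u x + v x)) (\<lambda>x. wpd i u x + wpd i v x)"
    and "aeq (wpd j (wpd i (\<lambda>x. u x + v x))) (\<lambda>x. wpd j (wpd i u) x + wpd j (wpd i v) x)"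
proof -
  show 1: "aeq (wpd i (\<lambda>x. u x + v x)) (\<lambda>x. wpd i u x + wpd i v x)"
    using assms by (intro wpd_aeqI is_weak_pd_add) (auto simp: H2_fun_iff)
  have "wpd j (wpd i (\<lambda>x. u x + v x)) = wpd j (\<lambda>x. wpd i u x + wpd i v x)"
    using assms H2_fun_add[OF assms] 1
    by (intro wpd_cong) (auto simp: H2_fun_iff L2_L1 L1_add)
  then show "aeq (wpd j (wpd i (\<lambda>x. u x + v x))) (\<lambda>x. wpd j (wpd i u) x + wpd j (wpd i v) x)"
    using assms by (auto intro!: wpd_aeqI is_weak_pd_add simp: H2_fun_iff)
qed

lemma wpd_scale:
  assumes "u \<in> H2_fun"
  shows "aeq (wpd i (\<lambda>x. c * u x)) (\<lambda>x. c * wpd i u x)"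
    and "aeq (wpd j (wpd i (\<lambda>x. c * u x))) (\<lambda>x. c * wpd j (wpd i u) x)"
proof -
  show 1: "aeq (wpd i (\<lambda>x. c * u x)) (\<lambda>x. c * wpd i u x)"
    using assms by (intro wpd_aeqI is_weak_pd_scale) (auto simp: H2_fun_iff)
  have "wpd j (wpd i (\<lambda>x. c * u x)) = wpd j (\<lambda>x. c * wpd i u x)"
    using assms H2_fun_scale[OF assms, of c] 1
    by (intro wpd_cong) (auto simp: H2_fun_iff L2_L1 L1_scale)
  then show "aeq (wpd j (wpd i (\<lambda>x. c * u x))) (\<lambda>x. c * wpd j (wpd i u) x)"
    using assms by (auto intro!: wpd_aeqI is_weak_pd_scale simp: H2_fun_iff)
qed

lemma L2_integral_cong:
  assumes "aeq u u'" "u \<in> L2" "u' \<in> L2" "v \<in> L2"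
  shows "(LINT x|torus. u x * v x) = (LINT x|torus. u' x * v x)"
  using assms by (intro integral_cong_AE) (auto simp: aeq_def L2_def elim: AE_mp)

lemma H2_inner_commute: "H2_inner u v = H2_inner v u"
  by (simp add: H2_inner_def mult.commute)

lemma H2_inner_cong:
  assumes "aeq u u'" "u \<in> H2_fun" "u' \<in> H2_fun" "v \<in> H2_fun"
  shows "H2_inner u v = H2_inner u' v"
proof -
  have "wpd i u = wpd i u'" for i using assms by (intro wpd_cong) (auto simp: H2_fun_L1)
  moreover have "(LINT x|torus. u x * v x) = (LINT x|torus. u' x * v x)"
    using assms by (intro L2_integral_cong) (auto simp: H2_fun_iff)
  ultimately show ?thesis by (simp add: H2_inner_def)
qed

lemma L2_integral_add:
  assumes "u \<in> L2" "v \<in> L2" "w \<in> L2" "z \<in> L2" "aeq z (\<lambda>x. u x + v x)"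
  shows "(LINT x|torus. z x * w x) = (LINT x|torus. u x * w x) + (LINT x|torus. v x * w x)"
proof -
  have "(LINT x|torus. z x * w x) = (LINT x|torus. (u x + v x) * w x)"
    using assms by (intro L2_integral_cong) (auto simp: L2_add)
  then show ?thesis using assms by (simp add: distrib_right L2_mult_integrable)
qed

lemma L2_integral_scale:
  assumes "u \<in> L2" "w \<in> L2" "z \<in> L2" "aeq z (\<lambda>x. c * u x)"
  shows "(LINT x|torus. z x * w x) = c * (LINT x|torus. u x * w x)"
proof -
  have "(LINT x|torus. z x * w x) = (LINT x|torus. (c * u x) * w x)"
    using assms by (intro L2_integral_cong) (auto simp: L2_scale)
  then show ?thesis by (simp add: mult.assoc)
qed

lemma H2_inner_add:
  assumes "u \<in> H2_fun" "v \<in> H2_fun" "w \<in> H2_fun"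
  shows "H2_inner (\<lambda>x. u x + v x) w = H2_inner u w + H2_inner v w"
proof -
  have s: "(\<lambda>x. u x + v x) \<in> H2_fun" using assms by (simp add: H2_fun_add)
  have 0: "(LINT x|torus. (u x + v x) * w x) = (LINT x|torus. u x * w x) + (LINT x|torus. v x * w x)"
    using assms s by (intro L2_integral_add) (auto simp: H2_fun_iff)
  have 1: "(LINT x|torus. wpd i (\<lambda>x. u x + v x) x * wpd i w x) =
      (LINT x|torus. wpd i u x * wpd i w x) + (LINT x|torus. wpd i v x * wpd i w x)" for i
    using assms s by (intro L2_integral_add wpd_add) (auto simp: H2_fun_iff)
  have 2: "(LINT x|torus. wpd j (wpd i (\<lambda>x. u x + v x)) x * wpd j (wpd i w) x) =
      (LINT x|torus. wpd j (wpd i u) x * wpd j (wpd i w) x) +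
      (LINT x|torus. wpd j (wpd i v) x * wpd j (wpd i w) x)" for i j
    using assms s by (intro L2_integral_add wpd_add) (auto simp: H2_fun_iff)
  show ?thesis unfolding H2_inner_def 0 1 2 by (simp add: sum.distrib)
qed

lemma H2_inner_scale:
  assumes "u \<in> H2_fun" "w \<in> H2_fun"
  shows "H2_inner (\<lambda>x. c * u x) w = c * H2_inner u w"
proof -
  have s: "(\<lambda>x. c * u x) \<in> H2_fun" using assms by (simp add: H2_fun_scale)
  have 0: "(LINT x|torus. (c * u x) * w x) = c * (LINT x|torus. u x * w x)"
    using assms s by (intro L2_integral_scale) (auto simp: H2_fun_iff)
  have 1: "(LINT x|torus. wpd i (\<lambda>x. c * u x) x * wpd i w x) =
      c * (LINT x|torus. wpd i u x * wpd i w x)" for i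
    using assms s by (intro L2_integral_scale wpd_scale) (auto simp: H2_fun_iff)
  have 2: "(LINT x|torus. wpd j (wpd i (\<lambda>x. c * u x)) x * wpd j (wpd i w) x) =
      c * (LINT x|torus. wpd j (wpd i u) x * wpd j (wpd i w) x)" for i j
    using assms s by (intro L2_integral_scale wpd_scale) (auto simp: H2_fun_iff)
  show ?thesis unfolding H2_inner_def 0 1 2 by (simp add: sum_distrib_left distrib_left)
qed

lemma H2_inner_ge: "H2_inner u u \<ge> (LINT x|torus. (u x)\<^sup>2)"
proof -
  have nn: "0 \<le> (LINT x|torus. h x * h x)" for h :: "real^2 \<Rightarrow> real"
    by (rule Bochner_Integration.integral_nonneg) simp
  have "0 \<le> (\<Sum>i\<in>UNIV. LINT x|torus. wpd i u x * wpd i u x)"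
    by (rule sum_nonneg) (rule nn)
  moreover have "0 \<le> (\<Sum>i\<in>UNIV. \<Sum>j\<in>UNIV. LINT x|torus. wpd j (wpd i u) x * wpd j (wpd i u) x)"
    by (intro sum_nonneg nn)
  ultimately show ?thesis unfolding H2_inner_def power2_eq_square by linarith
qed

lemma H2_inner_nonneg: "H2_inner u u \<ge> 0"
proof -
  have "0 \<le> (LINT x|torus. (u x)\<^sup>2)" by (rule Bochner_Integration.integral_nonneg) simp
  then show ?thesis using H2_inner_ge[of u] by linarith
qed

lemma H2_inner_zero:
  assumes "u \<in> H2_fun" "H2_inner u u = 0"
  shows "aeq u (\<lambda>x. 0)"
proof -
  have "(LINT x|torus. (u x)\<^sup>2) = 0"
  proof (rule antisym)
    show "0 \<le> (LINT x|torus. (u x)\<^sup>2)" by (rule Bochner_Integration.integral_nonneg) simp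
  qed (use H2_inner_ge[of u] assms(2) in simp)
  then have "AE x in torus. (u x)\<^sup>2 = 0"
    using assms(1)
    by (subst (asm) integral_nonneg_eq_0_iff_AE) (auto simp: H2_fun_def L2_def)
  then show ?thesis by (simp add: aeq_def)
qed

lemma H2_inner_zero_left: "v \<in> H2_fun \<Longrightarrow> H2_inner (\<lambda>x. 0) v = 0"
  using H2_inner_scale[OF H2_fun_zero, of v 0] by simp


subsection \<open>The Hilbert space of classes\<close>

definition H2_rel :: "(real^2 \<Rightarrow> real) \<Rightarrow> (real^2 \<Rightarrow> real) \<Rightarrow> bool" where
  "H2_rel u v \<longleftrightarrow> u \<in> H2_fun \<and> v \<in> H2_fun \<and> aeq u v"

quotient_type H2 = "real^2 \<Rightarrow> real" / partial: H2_rel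
proof (rule part_equivpI)
  show "\<exists>u. H2_rel u u" using H2_fun_zero by (auto simp: H2_rel_def)
  show "symp H2_rel" by (auto simp: H2_rel_def intro!: sympI intro: aeq_sym)
  show "transp H2_rel" unfolding H2_rel_def by (intro transpI) (meson aeq_trans)
qed

instantiation H2 :: real_inner
begin

lift_definition zero_H2 :: H2 is "\<lambda>x. 0"
  by (simp add: H2_rel_def H2_fun_zero)

lift_definition plus_H2 :: "H2 \<Rightarrow> H2 \<Rightarrow> H2" is "\<lambda>u v x. u x + v x"
  by (simp add: H2_rel_def H2_fun_add aeq_add)

lift_definition scaleR_H2 :: "real \<Rightarrow> H2 \<Rightarrow> H2" is "\<lambda>c u x. c * u x"
  by (simp add: H2_rel_def H2_fun_scale aeq_scale)

lift_definition inner_H2 :: "H2 \<Rightarrow> H2 \<Rightarrow> real" is H2_inner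
  unfolding H2_rel_def by (metis H2_inner_cong H2_inner_commute)

definition uminus_H2 :: "H2 \<Rightarrow> H2" where "uminus_H2 u = (-1) *\<^sub>R u"
definition minus_H2 :: "H2 \<Rightarrow> H2 \<Rightarrow> H2" where "minus_H2 u v = u + - v"
definition norm_H2 :: "H2 \<Rightarrow> real" where "norm_H2 u = sqrt (inner u u)"
definition sgn_H2 :: "H2 \<Rightarrow> H2" where "sgn_H2 u = inverse (norm u) *\<^sub>R u"
definition dist_H2 :: "H2 \<Rightarrow> H2 \<Rightarrow> real" where "dist_H2 u v = norm (u - v)"
definition uniformity_H2 :: "(H2 \<times> H2) filter" where
  "uniformity_H2 = (INF e\<in>{0<..}. principal {(x, y). dist x y < e})"
definition open_H2 :: "H2 set \<Rightarrow> bool" where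
  "open_H2 U \<longleftrightarrow> (\<forall>x\<in>U. eventually (\<lambda>(x', y). x' = x \<longrightarrow> y \<in> U) uniformity)"

instance
proof
  fix u v w :: H2 and a b :: real and U :: "H2 set"
  have H2_relI: "H2_rel x y" if "x = y" "H2_rel x x" for x y using that by simp
  show "u + v + w = u + (v + w)"
    by transfer (auto simp: H2_rel_def add.assoc intro: H2_fun_add)
  show "u + v = v + u"
    by transfer (auto simp: H2_rel_def add.commute intro: H2_fun_add)
  show "0 + u = u"
    by transfer (auto simp: H2_rel_def)
  show "- u + u = 0"
    unfolding uminus_H2_def
    by transfer (auto simp: H2_rel_def H2_fun_zero)
  show "u - v = u + - v" by (simp add: minus_H2_def)
  show "a *\<^sub>R (u + v) = a *\<^sub>R u + a *\<^sub>R v"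
    by transfer (auto simp: H2_rel_def distrib_left intro: H2_fun_add H2_fun_scale)
  show "(a + b) *\<^sub>R u = a *\<^sub>R u + b *\<^sub>R u"
    by transfer (auto simp: H2_rel_def distrib_right intro: H2_fun_add H2_fun_scale)
  show "a *\<^sub>R b *\<^sub>R u = (a * b) *\<^sub>R u"
    by transfer (auto simp: H2_rel_def mult.assoc intro: H2_fun_scale)
  show "1 *\<^sub>R u = u"
    by transfer (auto simp: H2_rel_def)
  show "dist u v = norm (u - v)" by (rule dist_H2_def)
  show "sgn u = inverse (norm u) *\<^sub>R u" by (rule sgn_H2_def)
  show "uniformity = (INF e\<in>{0<..}. principal {(x, y). dist (x::H2) y < e})"
    by (rule uniformity_H2_def)
  show "open U \<longleftrightarrow> (\<forall>x\<in>U. eventually (\<lambda>(x', y). x' = x \<longrightarrow> y \<in> U) uniformity)"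
    by (rule open_H2_def)
  show "norm u = sqrt (inner u u)" by (rule norm_H2_def)
  show "inner u v = inner v u"
    by transfer (rule H2_inner_commute)
  show "inner (u + v) w = inner u w + inner v w"
    by transfer (simp add: H2_rel_def H2_inner_add)
  show "inner (a *\<^sub>R u) v = a * inner u v"
    by transfer (simp add: H2_rel_def H2_inner_scale)
  show "0 \<le> inner u u"
    by transfer (rule H2_inner_nonneg)
  show "inner u u = 0 \<longleftrightarrow> u = 0"
  proof transfer
    fix u assume "H2_rel u u"
    then have u: "u \<in> H2_fun" by (simp add: H2_rel_def)
    show "H2_inner u u = 0 \<longleftrightarrow> H2_rel u (\<lambda>x. 0)"
    proof
      assume "H2_inner u u = 0"
      then show "H2_rel u (\<lambda>x. 0)" using u by (simp add: H2_rel_def H2_inner_zero H2_fun_zero)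
    next
      assume "H2_rel u (\<lambda>x. 0)"
      then have "H2_inner u u = H2_inner (\<lambda>x. 0) u"
        by (intro H2_inner_cong) (auto simp: H2_rel_def)
      then show "H2_inner u u = 0" using u by (simp add: H2_inner_zero_left)
    qed
  qed
qed

end


section \<open>The functional and the weak formulation\<close>

text \<open>The integrands of \<open>I\<^sub>\<epsilon>\<close> involving the nonlinearity; \<open>v\<close> stands for \<open>\<sigma> + u\<close>.\<close>

definition gradient_density :: "(real \<Rightarrow> real) \<Rightarrow> (real^2 \<Rightarrow> real) \<Rightarrow> real^2 \<Rightarrow> real" where
  "gradient_density f v x = deriv f (exp (v x)) * exp (v x) * (norm (wgrad v x))\<^sup>2"

definition potential_density :: "(real \<Rightarrow> real) \<Rightarrow> real \<Rightarrow> (real^2 \<Rightarrow> real) \<Rightarrow> real^2 \<Rightarrow> real" where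
  "potential_density f s v x = (f (exp (v x)) - s)\<^sup>2"

definition energy ::
    "(real \<Rightarrow> real) \<Rightarrow> real \<Rightarrow> real \<Rightarrow> (real^2 \<Rightarrow> real) \<Rightarrow> real \<Rightarrow> real \<Rightarrow> (real^2 \<Rightarrow> real) \<Rightarrow> real" where
  "energy f s A \<sigma> \<epsilon> lam u =
       \<epsilon>\<^sup>2 / 2 * (LINT x|torus. (wlaplace u x)\<^sup>2)
     + 1 / 2 * (LINT x|torus. (norm (wgrad u x))\<^sup>2)
     + \<epsilon> * lam * (LINT x|torus. gradient_density f (\<lambda>y. \<sigma> y + u y) x)
     + lam\<^sup>2 / 2 * (LINT x|torus. potential_density f s (\<lambda>y. \<sigma> y + u y) x)
     - A * (LINT x|torus. u x)"

lemma integral_cong_AE_torus: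
  fixes g h :: "real^2 \<Rightarrow> real"
  assumes ae: "AE x in torus. g x = h x"
  shows "(LINT x|torus. g x) = (LINT x|torus. h x)"
proof -
  have meas: "h \<in> borel_measurable torus"
    if g: "g \<in> borel_measurable torus" and ae: "AE x in torus. g x = h x"
    for g h :: "real^2 \<Rightarrow> real"
  proof -
    let ?Q = "cbox 0 (1::real^2)"
    have "(\<lambda>x. if x \<in> ?Q then g x else 0) \<in> borel_measurable lebesgue"
      using g by (subst borel_measurable_if) auto
    moreover have "AE x in lebesgue. (if x \<in> ?Q then g x else 0) = (if x \<in> ?Q then h x else 0)"
      using ae by (subst (asm) AE_restrict_space_iff) (auto elim: AE_mp)
    ultimately have "(\<lambda>x. if x \<in> ?Q then h x else 0) \<in> borel_measurable lebesgue"
      by (rule borel_measurable_AE)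
    then show ?thesis by (subst (asm) borel_measurable_if) auto
  qed
  have ae': "AE x in torus. h x = g x" using ae by (auto elim: AE_mp)
  show ?thesis
  proof (cases "g \<in> borel_measurable torus")
    case True
    then show ?thesis using meas[OF True ae] ae by (intro integral_cong_AE)
  next
    case False
    then have "h \<notin> borel_measurable torus" using meas[OF _ ae'] by blast
    then show ?thesis using False
      by (metis borel_measurable_integrable not_integrable_integral_eq)
  qed
qed

lemma energy_cong:
  assumes "H2_rel u u'"
  shows "energy f s A \<sigma> \<epsilon> lam u = energy f s A \<sigma> \<epsilon> lam u'"
proof -
  have u: "u \<in> L1" "u' \<in> L1" and ae: "aeq u u'"
    using assms by (auto simp: H2_rel_def H2_fun_L1)
  let ?v = "\<lambda>x. \<sigma> x + u x" and ?v' = "\<lambda>x. \<sigma> x + u' x"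
  have wpd: "wpd i u = wpd i u'" for i using u ae by (intro wpd_cong) auto
  have "?v \<in> L1 \<longleftrightarrow> ?v' \<in> L1"
    using L1_add[OF _ L1_add[OF u(2) L1_scale[OF u(1), of "-1"]], of ?v]
      L1_add[OF _ L1_add[OF u(1) L1_scale[OF u(2), of "-1"]], of ?v']
    by (auto simp: algebra_simps)
  then have wpd': "wpd i ?v = wpd i ?v'" for i
    using ae by (intro wpd_cong) (auto intro: aeq_add)
  have "AE x in torus. u x = u' x" using ae by (simp add: aeq_def)
  then have 1: "AE x in torus. gradient_density f ?v x = gradient_density f ?v' x"
    and 2: "AE x in torus. potential_density f s ?v x = potential_density f s ?v' x"
    by (auto simp: gradient_density_def potential_density_def wgrad_def wpd' elim: AE_mp)
  show ?thesis
    using integral_cong_AE_torus[OF 1] integral_cong_AE_torus[OF 2]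
      integral_cong_AE_torus[OF ae[unfolded aeq_def]]
    by (simp add: energy_def wlaplace_def wgrad_def wpd)
qed

lift_definition energy_H2 ::
    "(real \<Rightarrow> real) \<Rightarrow> real \<Rightarrow> real \<Rightarrow> (real^2 \<Rightarrow> real) \<Rightarrow> real \<Rightarrow> real \<Rightarrow> H2 \<Rightarrow> real" is energy
  by (rule energy_cong)

text \<open>
  Non-integrable functions have integral \<open>0\<close> and \<^const>\<open>wpd\<close> is arbitrary on functions
  without weak derivatives.  This says that neither happens in \<^const>\<open>energy\<close>; the remaining
  integrands are integrable by definition of \<^const>\<open>H2_fun\<close>.
\<close>

definition energy_well_defined ::
    "(real \<Rightarrow> real) \<Rightarrow> real \<Rightarrow> (real^2 \<Rightarrow> real) \<Rightarrow> (real^2 \<Rightarrow> real) \<Rightarrow> bool" where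
  "energy_well_defined f s \<sigma> u \<longleftrightarrow>
     weakly_differentiable (\<lambda>x. \<sigma> x + u x) \<and>
     integrable torus (gradient_density f (\<lambda>x. \<sigma> x + u x)) \<and>
     integrable torus (potential_density f s (\<lambda>x. \<sigma> x + u x))"

text \<open>
  The first conjuncts require that every term of the identity makes sense.  The term
  \<open>2\<epsilon>\<lambda> \<Delta> f(e\<^bsup>\<sigma>+u\<^esup>)\<close> tested against \<open>\<phi>\<close> is \<open>- 2\<epsilon>\<lambda> \<integral> \<nabla> f(e\<^bsup>\<sigma>+u\<^esup>) \<bullet> \<nabla>\<phi>\<close>.
\<close>

definition weak_solution ::
    "(real \<Rightarrow> real) \<Rightarrow> real \<Rightarrow> real \<Rightarrow> (real^2 \<Rightarrow> real) \<Rightarrow> real \<Rightarrow> real \<Rightarrow> (real^2 \<Rightarrow> real) \<Rightarrow> bool" where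
  "weak_solution f s A \<sigma> \<epsilon> lam u \<longleftrightarrow> u \<in> H2_fun \<and>
     (let v = (\<lambda>x. \<sigma> x + u x);
          F = (\<lambda>x. f (exp (v x)));
          R = (\<lambda>x. ((deriv ^^ 2) f (exp (v x)) * exp (v x) + deriv f (exp (v x)))
                     * exp (v x) * (norm (wgrad v x))\<^sup>2);
          N = (\<lambda>x. deriv f (exp (v x)) * exp (v x) * (s - f (exp (v x))))
      in weakly_differentiable v \<and> weakly_differentiable F \<and>
         (\<forall>\<phi>\<in>H2_fun.
            integrable torus (\<lambda>x. R x * \<phi> x) \<and>
            integrable torus (\<lambda>x. wgrad F x \<bullet> wgrad \<phi> x) \<and>
            integrable torus (\<lambda>x. N x * \<phi> x) \<and>
            \<epsilon>\<^sup>2 * (LINT x|torus. wlaplace u x * wlaplace \<phi> x)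
              + (LINT x|torus. wgrad u x \<bullet> wgrad \<phi> x)
            = - \<epsilon> * lam * (LINT x|torus. R x * \<phi> x)
              - 2 * \<epsilon> * lam * (LINT x|torus. wgrad F x \<bullet> wgrad \<phi> x)
              + lam\<^sup>2 * (LINT x|torus. N x * \<phi> x)
              + A * (LINT x|torus. \<phi> x)))"

definition C1_functional :: "('a::real_normed_vector \<Rightarrow> real) \<Rightarrow> bool" where
  "C1_functional J \<longleftrightarrow>
     (\<exists>J' :: 'a \<Rightarrow> 'a \<Rightarrow>\<^sub>L real. (\<forall>u. (J has_derivative blinfun_apply (J' u)) (at u)) \<and>
        continuous_on UNIV J')"

definition critical_point :: "('a::real_normed_vector \<Rightarrow> real) \<Rightarrow> 'a \<Rightarrow> bool" where
  "critical_point J u \<longleftrightarrow> (J has_derivative (\<lambda>h. 0)) (at u)"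

end

theory Submission
  imports Defs
begin

text \<open>
  The derivative of the functional in direction \<open>\<phi>\<close> is the weak formulation tested with \<open>\<phi>\<close>, so
  everything rests on a second-order Taylor estimate of the functional that is locally uniform in the
  base point. For \<open>G = f \<circ> exp\<close> the hypotheses on \<open>f\<close> bound the first three derivatives of \<open>G\<close>
  at \<open>t\<close> by a multiple of \<open>exp (- \<bar>t\<bar>)\<close>, and \<open>H\<^sup>2\<close> embeds into the bounded functions. Hence all
  that is needed about the singular function \<open>\<sigma>\<close> is that it is weakly differentiable with
  \<open>exp (- \<bar>\<sigma>\<bar>) \<bar>\<nabla>\<sigma>\<bar>\<^sup>2\<close> integrable. This follows without a Green function: convolution with
  trigonometric kernels keeps the Laplacians bounded in \<open>L\<^sup>1\<close>, and one tests them with the truncations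
  \<open>\<delta> arctan (\<sigma> / \<delta>)\<close>, as Boccardo and Gallouet do. Large \<open>\<delta>\<close> gives bounds in \<open>L\<^sup>4\<close>, small
  \<open>\<delta>\<close> the convergence of the gradients in \<open>L\<^sup>1\<close>.
\<close>

section \<open>Calculus on the unit cell\<close>

text \<open>The obstacle is that \<open>\<sigma>\<close> is logarithmic at a vortex point, so its
  squared gradient is not integrable there; only the factor \<open>G'\<close>, comparable to a power
  of the distance, makes the functional finite. Three derivatives of \<open>G\<close> enter because
  the quadratic remainder of \<open>G' (v)\<close> times the squared gradient of \<open>v\<close> is
  measured in the sup norm of the increment. Adding a bounded function to \<open>\<sigma>\<close>
  changes the exponential weight by a bounded factor only, so one weight serves a whole ball of the
  Sobolev space; hence the uniformity. For \<open>\<sigma>\<close> the difficulty is that the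
  Laplacians of differences \<open>d\<close> of two mollifications are bounded in the mean but do
  not become small. The truncation gives (integral of |grad d|)^2 \<le> 4 \<delta> L + (4 L /
  \<delta>) (integral of d^2) in each direction: a small \<delta> settles the first term, and the L4
  bound upgrades mean convergence of the mollifications to the mean square convergence that settles
  the second. Trigonometric kernels make every mollification a test function at once.\<close>

lemma integrable_torus_continuous:
  "continuous_on UNIV (g :: real^2 \<Rightarrow> real) \<Longrightarrow> integrable torus g"
  using integrable_mult_continuous[of "\<lambda>x. 1" g] finite_measure_torus
  by (simp add: finite_measure.integrable_const)

lemma measure_torus [simp]: "measure torus (cbox 0 1) = 1"
  by (simp add: measure_restrict_space content_cbox_if_cart interval_ne_empty_cart)

section \<open>Coordinates and Fubini's theorem on the unit cell\<close>

text \<open>Arithmetic in the type \<open>2\<close> is modulo 2, so \<open>i + 1\<close> is the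
  index other than \<open>i\<close>. This lets one statement treat both axes.\<close>

lemma index2_cases: "j = i \<or> j = i + 1" for i j :: 2
  using exhaust_2[of i] exhaust_2[of j] by auto

lemma index2_neq [simp]: "i + 1 \<noteq> (i::2)"
  using exhaust_2[of i] by auto

lemma all_index2: "(\<forall>j. P j) \<longleftrightarrow> P i \<and> P (i + 1)" for i :: 2
  using index2_cases[of _ i] by metis

lemma UNIV_index2: "UNIV = {i, i + 1 :: 2}"
  using index2_cases[of _ i] by auto

definition pt :: "2 \<Rightarrow> real \<Rightarrow> real \<Rightarrow> real^2" where
  "pt i s t = (\<chi> j. if j = i then s else t)"

lemma pt_nth [simp]: "pt i s t $ i = s" "pt i s t $ (i + 1) = t"
  by (simp_all add: pt_def)

lemma pt_collapse [simp]: "pt i (x $ i) (x $ (i + 1)) = x"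
  using index2_cases[of _ i] by (force simp: pt_def vec_eq_iff)

lemma pt_swap: "pt (i + 1) t s = pt i s t"
  using index2_cases[of _ i] by (force simp: pt_def vec_eq_iff)

lemma pt_line: "pt i s t = pt i 0 t + s *\<^sub>R axis i 1"
  by (auto simp: pt_def vec_eq_iff axis_def)

lemma continuous_on_pt [continuous_intros]:
  assumes "continuous_on S a" "continuous_on S b"
  shows "continuous_on S (\<lambda>x. pt i (a x) (b x))"
proof -
  have "continuous_on S (\<lambda>x. if j = i then a x else b x)" for j :: 2
    using assms by (cases "j = i") auto
  then show ?thesis unfolding pt_def by (intro continuous_on_vec_lambda)
qed

text \<open>Together with \<open>content_pt_cbox\<close> this says that reordering the coordinates
  maps boxes to boxes of the same content, as the change of variables
  \<open>has_integral_twiddle\<close> demands.\<close>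

lemma pt_image_cbox: "(\<lambda>(t, s). pt i s t) ` cbox u v = cbox (pt i (snd u) (fst u)) (pt i (snd v) (fst v))"
proof (intro set_eqI iffI)
  fix x assume "x \<in> cbox (pt i (snd u) (fst u)) (pt i (snd v) (fst v))"
  then have "pt i (snd u) (fst u) $ j \<le> x $ j \<and> x $ j \<le> pt i (snd v) (fst v) $ j" for j
    by (auto simp: mem_box_cart)
  from this[of i] this[of "i + 1"] have "(x $ (i + 1), x $ i) \<in> cbox (fst u, snd u) (fst v, snd v)"
    by (simp only: cbox_Pair_iff) simp
  then show "x \<in> (\<lambda>(t, s). pt i s t) ` cbox u v"
    by (intro image_eqI[where x = "(x $ (i + 1), x $ i)"]) auto
next
  fix x assume "x \<in> (\<lambda>(t, s). pt i s t) ` cbox u v"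
  then obtain t s where x: "x = pt i s t" "(t, s) \<in> cbox (fst u, snd u) (fst v, snd v)" by auto
  then have "fst u \<le> t" "t \<le> fst v" "snd u \<le> s" "s \<le> snd v" by (simp_all only: cbox_Pair_iff) simp_all
  then show "x \<in> cbox (pt i (snd u) (fst u)) (pt i (snd v) (fst v))"
    by (simp add: x mem_box_cart pt_def)
qed

lemma content_pt_cbox:
  "measure lborel (cbox (pt i (snd u) (fst u)) (pt i (snd v) (fst v))) = measure lborel (cbox u v)"
proof -
  have e: "cbox u v = cbox (fst u) (fst v) \<times> cbox (snd u) (snd v)"
    by (metis cbox_Pair_eq prod.collapse)
  have "measure lborel (cbox u v) = measure lborel (cbox (fst u) (fst v)) * measure lborel (cbox (snd u) (snd v))"
    by (metis content_Pair prod.collapse)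
  moreover have "cbox (pt i (snd u) (fst u)) (pt i (snd v) (fst v)) \<noteq> {} \<longleftrightarrow>
      fst u \<le> fst v \<and> snd u \<le> snd v"
    by (auto simp: interval_ne_empty_cart all_index2[of _ i])
  ultimately show ?thesis
    by (auto simp: content_cbox_if_cart UNIV_index2[of i] content_real)
qed

text \<open>The integral is moved to a product of two real intervals, where a continuous integrand
  may be integrated iteratedly. The inner variable is the coordinate \<open>i\<close>, so that a
  derivative in direction \<open>i\<close> is integrated first.\<close>

lemma torus_fubini:
  fixes f :: "real^2 \<Rightarrow> real"
  assumes f: "continuous_on UNIV f"
  shows "(LINT x|torus. f x) = integral {0..1} (\<lambda>t. integral {0..1} (\<lambda>s. f (pt i s t)))"
proof -
  let ?g = "\<lambda>(t, s). pt i s t" and ?h = "\<lambda>x::real^2. (x $ (i + 1), x $ i)"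
  have cg: "continuous_on UNIV (\<lambda>z. pt i (snd z) (fst z))" by (intro continuous_intros)
  have "(f has_integral integral (cbox 0 1) f) (cbox 0 1)"
    using f by (intro integrable_integral integrable_continuous) (auto intro: continuous_on_subset)
  then have "((\<lambda>x. f (?g x)) has_integral (1 / 1) *\<^sub>R integral (cbox 0 1) f) (?h ` cbox 0 1)"
  proof (rule has_integral_twiddle[rotated -1])
    show "\<exists>w z. ?g ` cbox u v = cbox w z" for u v using pt_image_cbox by blast
    show "\<exists>w z. ?h ` cbox u v = cbox w z" for u v
    proof -
      have "cbox u v = cbox (pt i (u $ i) (u $ (i + 1))) (pt i (v $ i) (v $ (i + 1)))" by simp
      also have "\<dots> = ?g ` cbox (u $ (i + 1), u $ i) (v $ (i + 1), v $ i)"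
        using pt_image_cbox[of i "(u $ (i + 1), u $ i)" "(v $ (i + 1), v $ i)"] by simp
      finally have "?h ` cbox u v = (\<lambda>z. z) ` cbox (u $ (i + 1), u $ i) (v $ (i + 1), v $ i)"
        by (simp only: image_image) (auto simp: case_prod_beta)
      then show ?thesis by auto
    qed
    show "isCont ?g x" for x
      using cg unfolding case_prod_beta' by (metis UNIV_I continuous_on_eq_continuous_at open_UNIV)
    show "measure lborel (?g ` cbox u v) = 1 * measure lborel (cbox u v)" for u v
      by (simp only: pt_image_cbox content_pt_cbox)
  qed auto
  moreover have "?h ` cbox 0 1 = cbox (0, 0) (1, 1)"
  proof -
    have "cbox 0 (1::real^2) = cbox (pt i 0 0) (pt i 1 1)"
      by (simp add: pt_def zero_vec_def one_vec_def)
    also have "\<dots> = ?g ` cbox (0, 0) (1, 1)" using pt_image_cbox[of i "(0,0)" "(1,1)"] by simp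
    finally show ?thesis by (auto simp only: image_image) (auto simp: case_prod_beta)
  qed
  ultimately have "integral (cbox (0, 0) (1, 1)) (\<lambda>x. f (?g x)) = integral (cbox 0 1) f"
    by (simp add: integral_unique)
  moreover have "integral (cbox (0, 0) (1, 1)) (\<lambda>x. f (?g x)) =
      integral (cbox 0 1) (\<lambda>t. integral (cbox 0 1) (\<lambda>s. f (?g (t, s))))"
  proof (rule integral_prod_continuous)
    have "continuous_on UNIV (\<lambda>z. f (pt i (snd z) (fst z)))"
      by (rule continuous_on_compose2[OF f cg]) simp
    then show "continuous_on (cbox (0, 0) (1, 1)) (\<lambda>x. f (?g x))"
      by (auto simp: case_prod_beta intro: continuous_on_subset)
  qed
  moreover have "(LINT x|torus. f x) = integral (cbox 0 1) f"
    by (rule lebesgue_integral_eq_integral) (simp_all add: integrable_torus_continuous f)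
  ultimately show ?thesis by simp
qed

section \<open>One-dimensional slices and Sobolev inequalities for smooth functions\<close>

lemma pd_slice:
  assumes "w differentiable_on UNIV"
  shows "((\<lambda>s. w (pt i s t)) has_real_derivative pd i w (pt i s t)) (at s within S)"
proof -
  have w: "(w has_derivative frechet_derivative w (at (pt i s t))) (at (pt i s t))"
    using assms by (simp add: differentiable_on_def frechet_derivative_works)
  have "((\<lambda>s. pt i s t) has_derivative (\<lambda>d. d *\<^sub>R axis i 1)) (at s within S)"
    by (subst (1) pt_line[abs_def]) (auto intro!: derivative_eq_intros)
  from diff_chain_within[OF this has_derivative_at_withinI[OF w]]
  have "((\<lambda>s. w (pt i s t)) has_derivative
      (\<lambda>d. frechet_derivative w (at (pt i s t)) (d *\<^sub>R axis i 1))) (at s within S)"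
    by (simp add: o_def)
  moreover have "frechet_derivative w (at (pt i s t)) (d *\<^sub>R axis i 1) = d * pd i w (pt i s t)" for d
    using has_derivative_linear[OF w] by (simp add: pd_def linear_scale)
  moreover have "(*) (pd i w (pt i s t)) = (\<lambda>d. d * pd i w (pt i s t))" by auto
  ultimately show ?thesis by (simp add: has_field_derivative_def)
qed

text \<open>On each slice the fundamental theorem leaves the difference of the two end values, which
  agree by periodicity.\<close>

lemma integral_pd_zero:
  assumes w: "w differentiable_on UNIV" "continuous_on UNIV (pd i w)" and per: "periodic w"
  shows "(LINT x|torus. pd i w x) = 0"
proof -
  have "integral {0..1} (\<lambda>s. pd i w (pt i s t)) = 0" for t
  proof -
    have "((\<lambda>s. pd i w (pt i s t)) has_integral w (pt i 1 t) - w (pt i 0 t)) {0..1}"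
      by (rule fundamental_theorem_of_calculus)
        (auto simp: has_real_derivative_iff_has_vector_derivative[symmetric] intro: pd_slice w)
    moreover have "w (pt i 1 t) = w (pt i 0 t)"
      using per by (subst pt_line) (simp add: periodic_def)
    ultimately show ?thesis by (simp add: integral_unique)
  qed
  then show ?thesis by (simp add: torus_fubini[OF w(2), of i])
qed

text \<open>The value at \<open>\<tau>\<close> differs from the value at any other point by at most
  the integral of the derivative's modulus; averaging over that point, in an interval of length one,
  gives the bound.\<close>

lemma interval_sup_bound:
  fixes h h' :: "real \<Rightarrow> real"
  assumes h: "\<And>s. (h has_real_derivative h' s) (at s within {0..1})"
    and h': "continuous_on {0..1} h'" and \<tau>: "\<tau> \<in> {0..1}"
  shows "\<bar>h \<tau>\<bar> \<le> integral {0..1} (\<lambda>s. \<bar>h s\<bar> + \<bar>h' s\<bar>)"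
proof -
  let ?I = "integral {0..1} (\<lambda>s. \<bar>h' s\<bar>)"
  have ch: "continuous_on {0..1} h"
    by (rule DERIV_continuous_on) (rule h)
  have ftc: "\<bar>h b - h a\<bar> \<le> ?I" if ab: "0 \<le> a" "a \<le> b" "b \<le> 1" for a b
  proof -
    have "(h' has_integral h b - h a) {a..b}"
    proof (rule fundamental_theorem_of_calculus)
      fix x assume "x \<in> {a..b}"
      show "(h has_vector_derivative h' x) (at x within {a..b})"
        using has_vector_derivative_within_subset[OF
            h[of x, unfolded has_real_derivative_iff_has_vector_derivative]] ab by simp
    qed (use ab in auto)
    have sub: "continuous_on {a..b} h'" if "0 \<le> a" "b \<le> 1" for a b
      using continuous_on_subset[OF h', of "{a..b}"] that by simp
    have int: "h' integrable_on {a..b}" "(\<lambda>s. \<bar>h' s\<bar>) integrable_on {a..b}"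
      if "0 \<le> a" "b \<le> 1" for a b
      by (intro integrable_continuous_interval continuous_on_rabs sub that)+
    have "h b - h a = integral {a..b} h'" using \<open>(h' has_integral h b - h a) {a..b}\<close> by (simp add: integral_unique)
    moreover have "\<bar>integral {a..b} h'\<bar> \<le> integral {a..b} (\<lambda>s. \<bar>h' s\<bar>)"
      using integral_norm_bound_integral[OF int(1)[OF ab(1,3)] int(2)[OF ab(1,3)]] by simp
    moreover have "integral {a..b} (\<lambda>s. \<bar>h' s\<bar>) \<le> ?I"
      using ab by (intro integral_subset_le int(2)) auto
    ultimately show ?thesis by simp
  qed
  have le: "\<bar>h \<tau>\<bar> - ?I \<le> \<bar>h s\<bar>" if "s \<in> {0..1}" for s
    using ftc[of s \<tau>] ftc[of \<tau> s] \<tau> that by (cases "s \<le> \<tau>") auto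
  have "integral {0..1::real} (\<lambda>s. \<bar>h \<tau>\<bar> - ?I) \<le> integral {0..1} (\<lambda>s. \<bar>h s\<bar>)"
    by (rule integral_le[OF _ _ le]) (auto intro!: integrable_continuous_interval ch continuous_intros)
  moreover have "integral {0..1} (\<lambda>s. \<bar>h s\<bar> + \<bar>h' s\<bar>) = integral {0..1} (\<lambda>s. \<bar>h s\<bar>) + ?I"
    by (intro integral_add integrable_continuous_interval continuous_intros ch h')
  ultimately show ?thesis by simp
qed

lemma slice_sup_bound:
  assumes w: "w differentiable_on UNIV" "continuous_on UNIV (pd i w)" and s: "s \<in> {0..1}"
  shows "\<bar>w (pt i s t)\<bar> \<le> integral {0..1} (\<lambda>s. \<bar>w (pt i s t)\<bar> + \<bar>pd i w (pt i s t)\<bar>)"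
  by (rule interval_sup_bound[OF pd_slice[OF w(1)] _ s])
    (intro continuous_on_compose2[OF w(2)] continuous_intros, simp)

lemma continuous_on_slice_integral:
  fixes f :: "real^2 \<Rightarrow> real"
  assumes f: "continuous_on UNIV f"
  shows "continuous_on S (\<lambda>t. integral {0..1} (\<lambda>s. f (pt i s t)))"
proof -
  have "continuous_on (S \<times> cbox 0 1) (\<lambda>(t, s). f (pt i s t))"
    unfolding case_prod_beta by (intro continuous_on_compose2[OF f] continuous_intros) simp
  from integral_continuous_on_param[OF this] show ?thesis by simp
qed

lemma integrable_slice:
  fixes f :: "real^2 \<Rightarrow> real"
  assumes f: "continuous_on UNIV f"
  shows "(\<lambda>s. f (pt i s t)) integrable_on {0..1}"
  by (intro integrable_continuous_interval continuous_on_compose2[OF f] continuous_intros) simp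

text \<open>One factor of the square is bounded by its integral along the first axis, the other by
  its integral along the second. The two bounds depend on different variables, so the integral of
  their product factorises.\<close>

lemma gagliardo_nirenberg:
  assumes w: "w differentiable_on UNIV" "\<And>i. continuous_on UNIV (pd i w)"
  shows "(LINT x|torus. (w x)\<^sup>2) \<le>
    (LINT x|torus. \<bar>w x\<bar> + \<bar>pd 1 w x\<bar>) * (LINT x|torus. \<bar>w x\<bar> + \<bar>pd 2 w x\<bar>)"
proof -
  have cw: "continuous_on UNIV w" using w(1) by (rule differentiable_imp_continuous_on)
  have c: "continuous_on UNIV (\<lambda>x. \<bar>w x\<bar> + \<bar>pd i w x\<bar>)" for i
    by (intro continuous_intros cw w)
  define B where "B i t = integral {0..1} (\<lambda>s. \<bar>w (pt i s t)\<bar> + \<bar>pd i w (pt i s t)\<bar>)" for i t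
  have cB: "continuous_on S (B i)" for S i unfolding B_def by (rule continuous_on_slice_integral[OF c])
  have iB: "B i integrable_on {0..1}" for i by (intro integrable_continuous_interval cB)
  have le: "(w (pt 1 s t))\<^sup>2 \<le> B 1 t * B 2 s" if "s \<in> {0..1}" "t \<in> {0..1}" for s t
  proof -
    have p: "pt 2 t s = pt 1 s t" using pt_swap[of 1 t s] by simp
    have "\<bar>w (pt 1 s t)\<bar> * \<bar>w (pt 2 t s)\<bar> \<le> B 1 t * B 2 s"
      unfolding B_def by (intro mult_mono slice_sup_bound w that abs_ge_zero
          Henstock_Kurzweil_Integration.integral_nonneg integrable_slice[OF c] add_nonneg_nonneg)
    then show ?thesis by (simp add: p power2_eq_square)
  qed
  have c2: "continuous_on UNIV (\<lambda>x. (w x)\<^sup>2)" by (intro continuous_intros cw)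
  have "(LINT x|torus. (w x)\<^sup>2) = integral {0..1} (\<lambda>t. integral {0..1} (\<lambda>s. (w (pt 1 s t))\<^sup>2))"
    by (rule torus_fubini[OF c2])
  also have "\<dots> \<le> integral {0..1} (\<lambda>t. B 1 t * integral {0..1} (B 2))"
  proof (rule integral_le)
    show "(\<lambda>t. integral {0..1} (\<lambda>s. (w (pt 1 s t))\<^sup>2)) integrable_on {0..1}"
      by (intro integrable_continuous_interval continuous_on_slice_integral[OF c2])
    show "(\<lambda>t. B 1 t * integral {0..1} (B 2)) integrable_on {0..1}"
      by (intro integrable_continuous_interval continuous_intros cB)
    fix t :: real assume t: "t \<in> {0..1}"
    have "integral {0..1} (\<lambda>s. (w (pt 1 s t))\<^sup>2) \<le> integral {0..1} (\<lambda>s. B 1 t * B 2 s)"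
      using le t by (intro integral_le integrable_slice[OF c2] integrable_continuous_interval
          continuous_intros cB) auto
    then show "integral {0..1} (\<lambda>s. (w (pt 1 s t))\<^sup>2) \<le> B 1 t * integral {0..1} (B 2)" by simp
  qed
  also have "\<dots> = integral {0..1} (B 1) * integral {0..1} (B 2)" by simp
  also have "\<dots> = (LINT x|torus. \<bar>w x\<bar> + \<bar>pd 1 w x\<bar>) * (LINT x|torus. \<bar>w x\<bar> + \<bar>pd 2 w x\<bar>)"
    by (simp only: torus_fubini[OF c, of 1 1] torus_fubini[OF c, of 2 2] B_def[abs_def])
  finally show ?thesis .
qed

text \<open>The slice bound is applied along the first axis, and then along the second to
  \<open>w\<close> and to \<open>pd 1 w\<close>. This is why the mixed derivative is the only second
  derivative that occurs.\<close>

lemma sobolev_sup_bound: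
  assumes w: "w differentiable_on UNIV" "\<And>i. pd i w differentiable_on UNIV"
    "\<And>i j. continuous_on UNIV (pd j (pd i w))" and x: "x \<in> cbox 0 1"
  shows "\<bar>w x\<bar> \<le> (LINT x|torus. \<bar>w x\<bar> + \<bar>pd 1 w x\<bar> + \<bar>pd 2 w x\<bar> + \<bar>pd 2 (pd 1 w) x\<bar>)"
proof -
  let ?F = "\<lambda>x. \<bar>w x\<bar> + \<bar>pd 1 w x\<bar> + \<bar>pd 2 w x\<bar> + \<bar>pd 2 (pd 1 w) x\<bar>"
  have cw: "continuous_on UNIV w" "continuous_on UNIV (pd i w)" for i
    using w by (auto intro: differentiable_imp_continuous_on)
  have c: "continuous_on UNIV ?F" "continuous_on UNIV (\<lambda>x. \<bar>w x\<bar> + \<bar>pd 1 w x\<bar>)"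
    "continuous_on UNIV (\<lambda>x. \<bar>w x\<bar> + \<bar>pd 2 w x\<bar>)"
    "continuous_on UNIV (\<lambda>x. \<bar>pd 1 w x\<bar> + \<bar>pd 2 (pd 1 w) x\<bar>)"
    by (intro continuous_intros cw w)+
  define a b where "a = x $ 1" and "b = x $ 2"
  have x': "x = pt 1 a b" using pt_collapse[of 1 x] by (simp add: a_def b_def)
  have ab: "a \<in> {0..1}" "b \<in> {0..1}" using x by (auto simp: mem_box_cart a_def b_def)
  have p: "pt 2 t s = pt 1 s t" for s t using pt_swap[of 1 t s] by simp
  have "\<bar>w (pt 1 a b)\<bar> \<le> integral {0..1} (\<lambda>s. \<bar>w (pt 1 s b)\<bar> + \<bar>pd 1 w (pt 1 s b)\<bar>)"
    by (rule slice_sup_bound[OF w(1) cw(2) ab(1)])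
  also have "\<dots> \<le> integral {0..1} (\<lambda>s. integral {0..1} (\<lambda>t. ?F (pt 2 t s)))"
  proof (rule integral_le)
    show "(\<lambda>s. \<bar>w (pt 1 s b)\<bar> + \<bar>pd 1 w (pt 1 s b)\<bar>) integrable_on {0..1}"
      by (rule integrable_slice[OF c(2)])
    show "(\<lambda>s. integral {0..1} (\<lambda>t. ?F (pt 2 t s))) integrable_on {0..1}"
      by (intro integrable_continuous_interval continuous_on_slice_integral[OF c(1)])
    fix s :: real
    have "\<bar>w (pt 2 b s)\<bar> + \<bar>pd 1 w (pt 2 b s)\<bar> \<le>
        integral {0..1} (\<lambda>t. \<bar>w (pt 2 t s)\<bar> + \<bar>pd 2 w (pt 2 t s)\<bar>) +
        integral {0..1} (\<lambda>t. \<bar>pd 1 w (pt 2 t s)\<bar> + \<bar>pd 2 (pd 1 w) (pt 2 t s)\<bar>)"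
      by (intro add_mono slice_sup_bound w cw ab)
    also have "\<dots> = integral {0..1} (\<lambda>t. ?F (pt 2 t s))"
      by (subst integral_add[symmetric]) (auto intro!: integrable_slice[OF c(3)]
          integrable_slice[OF c(4)] integral_cong)
    finally show "\<bar>w (pt 1 s b)\<bar> + \<bar>pd 1 w (pt 1 s b)\<bar> \<le> integral {0..1} (\<lambda>t. ?F (pt 2 t s))"
      by (simp add: p)
  qed
  also have "\<dots> = (LINT x|torus. ?F x)" by (rule torus_fubini[OF c(1), symmetric])
  finally show ?thesis by (simp add: x')
qed

section \<open>Convolution with trigonometric kernels\<close>

lemma trig_uminus: "trig u \<Longrightarrow> trig (\<lambda>x. - u x)"
  using trig_mult[OF trig_const[of "-1"]] by simp

lemma trig_diff: "trig u \<Longrightarrow> trig v \<Longrightarrow> trig (\<lambda>x. u x - v x)"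
  using trig_add[OF _ trig_uminus] by simp

lemma trig_power: "trig u \<Longrightarrow> trig (\<lambda>x. u x ^ n)"
  by (induction n) (auto intro: trig_const trig_mult)

lemma trig_prod: "finite I \<Longrightarrow> (\<And>i. i \<in> I \<Longrightarrow> trig (u i)) \<Longrightarrow> trig (\<lambda>x. \<Prod>i\<in>I. u i x)"
  by (induction rule: finite_induct) (auto intro: trig.intros)

lemma trig_differentiable: "trig u \<Longrightarrow> u differentiable_on UNIV"
  by (simp add: trig_pd)

lemma trig_pd_trig: "trig u \<Longrightarrow> trig (pd i u)"
  by (simp add: trig_pd)

lemma trig_continuous: "trig u \<Longrightarrow> continuous_on UNIV u"
  by (simp add: test_continuous trig_test)

lemma trig_integrable: "trig u \<Longrightarrow> integrable torus u"
  by (simp add: integrable_torus_continuous trig_continuous)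

lemma trig_mult_integrable: "integrable torus v \<Longrightarrow> trig u \<Longrightarrow> integrable torus (\<lambda>x. v x * u x)"
  by (simp add: integrable_mult_continuous trig_continuous)

lemma pd_works: "u differentiable_on UNIV \<Longrightarrow> (u has_derivative frechet_derivative u (at x)) (at x)"
  by (simp add: differentiable_on_def frechet_derivative_works)

lemma pd_add:
  assumes "u differentiable_on UNIV" "v differentiable_on UNIV"
  shows "pd i (\<lambda>x. u x + v x) = (\<lambda>x. pd i u x + pd i v x)"
  by (subst pd_eqI[OF has_derivative_add[OF assms[THEN pd_works]]]) (simp add: pd_def)

lemma pd_mult:
  assumes "u differentiable_on UNIV" "v differentiable_on UNIV"
  shows "pd i (\<lambda>x. u x * v x) = (\<lambda>x. u x * pd i v x + pd i u x * v x)"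
  by (subst pd_eqI[OF has_derivative_mult[OF assms[THEN pd_works]]]) (simp add: pd_def)

lemma pd_cmult:
  assumes "u differentiable_on UNIV"
  shows "pd i (\<lambda>x. c * u x) = (\<lambda>x. c * pd i u x)"
  by (subst pd_eqI[OF has_derivative_mult_right[OF assms[THEN pd_works]]]) (simp add: pd_def)

lemma pd_compose_diff:
  assumes "u differentiable_on UNIV"
  shows "pd i (\<lambda>x. u (x - y)) = (\<lambda>x. pd i u (x - y))"
    and "pd i (\<lambda>y. u (x - y)) = (\<lambda>y. - pd i u (x - y))"
proof -
  have "((\<lambda>x. u (x - y)) has_derivative (\<lambda>h. frechet_derivative u (at (x - y)) h)) (at x)" for x
    by (rule has_derivative_eq_rhs[OF diff_chain_at[OF _ pd_works[OF assms], where f = "\<lambda>x. x - y", unfolded o_def]])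
      (auto intro!: derivative_eq_intros)
  from pd_eqI[OF this] show "pd i (\<lambda>x. u (x - y)) = (\<lambda>x. pd i u (x - y))"
    by (simp add: pd_def)
  have "((\<lambda>y. u (x - y)) has_derivative (\<lambda>h. frechet_derivative u (at (x - y)) (- h))) (at y)" for y
    by (rule has_derivative_eq_rhs[OF diff_chain_at[OF _ pd_works[OF assms], where f = "\<lambda>y. x - y", unfolded o_def]])
      (auto intro!: derivative_eq_intros)
  from pd_eqI[OF this] show "pd i (\<lambda>y. u (x - y)) = (\<lambda>y. - pd i u (x - y))"
    using has_derivative_linear[OF pd_works[OF assms]] by (simp add: pd_def linear_neg)
qed

text \<open>Kernels of finite rank, for which Fubini's theorem is trivial.\<close>

inductive sep :: "(real^2 \<Rightarrow> real^2 \<Rightarrow> real) \<Rightarrow> bool" where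
  sep_prod: "trig a \<Longrightarrow> trig b \<Longrightarrow> sep (\<lambda>x y. a x * b y)"
| sep_add: "sep k \<Longrightarrow> sep l \<Longrightarrow> sep (\<lambda>x y. k x y + l x y)"

lemma sep_mult: "sep k \<Longrightarrow> sep l \<Longrightarrow> sep (\<lambda>x y. k x y * l x y)"
proof (induction k rule: sep.induct)
  case (sep_prod a b)
  from sep_prod(3) show ?case
  proof (induction l rule: sep.induct)
    case (sep_prod c d)
    have "sep (\<lambda>x y. (a x * c x) * (b y * d y))"
      by (intro sep.sep_prod trig_mult) fact+
    then show ?case by (simp add: ac_simps)
  next
    case (sep_add k l)
    then show ?case using sep.sep_add by (simp add: distrib_left)
  qed
next
  case (sep_add k k')
  then show ?case using sep.sep_add by (simp add: distrib_right)
qed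

text \<open>The addition theorems split sine and cosine of a difference into sums of products; sums
  and products of such kernels are again of this kind.\<close>

lemma trig_diff_sep: "trig \<kappa> \<Longrightarrow> sep (\<lambda>x y. \<kappa> (x - y))"
proof (induction rule: trig.induct)
  case (trig_const c)
  show ?case using sep_prod[OF trig.trig_const[of c] trig.trig_const[of 1]] by simp
next
  case (trig_cos i)
  have "sep (\<lambda>x y. cos (2 * pi * x $ i) * cos (2 * pi * y $ i) + sin (2 * pi * x $ i) * sin (2 * pi * y $ i))"
    by (intro sep.intros trig.intros)
  then show ?case by (simp add: right_diff_distrib cos_diff)
next
  case (trig_sin i)
  have "sep (\<lambda>x y. sin (2 * pi * x $ i) * cos (2 * pi * y $ i) +
      cos (2 * pi * x $ i) * (- sin (2 * pi * y $ i)))"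
    by (intro sep.intros trig.intros trig_uminus)
  then show ?case by (simp add: right_diff_distrib sin_diff)
qed (auto intro: sep_add sep_mult)

lemma sep_trig: "sep k \<Longrightarrow> trig (\<lambda>x. k x y)" "sep k \<Longrightarrow> trig (\<lambda>y. k x y)"
  by (induction rule: sep.induct) (auto intro: trig.intros)

context
  fixes v :: "real^2 \<Rightarrow> real"
  assumes v: "integrable torus v"
begin

text \<open>Of an arbitrary integrable \<open>v\<close> only the finitely many numbers obtained by
  integrating it against the second factors survive; they are the coefficients of the
  result.\<close>

lemma sep_integral_trig: "sep k \<Longrightarrow> trig (\<lambda>x. LINT y|torus. v y * k x y)"
proof (induction rule: sep.induct)
  case (sep_prod a b)
  have "(LINT y|torus. v y * (a x * b y)) = a x * (LINT y|torus. v y * b y)" for x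
    by (simp add: mult.left_commute[of _ "a x"])
  then show ?case using sep_prod by (auto intro: trig.intros)
next
  case (sep_add k l)
  have "(LINT y|torus. v y * (k x y + l x y)) =
      (LINT y|torus. v y * k x y) + (LINT y|torus. v y * l x y)" for x
    using sep_add v by (simp add: distrib_left trig_mult_integrable sep_trig)
  then show ?case using sep_add by (auto intro: trig.intros)
qed

text \<open>Differentiation under the integral sign. The second conjunct rides along in the
  induction because the sum case needs integrability of the differentiated kernels.\<close>

lemma sep_integral_pd:
  "sep k \<Longrightarrow> pd i (\<lambda>x. LINT y|torus. v y * k x y) = (\<lambda>x. LINT y|torus. v y * pd i (\<lambda>x. k x y) x)
    \<and> sep (\<lambda>x y. pd i (\<lambda>x. k x y) x)"
proof (induction rule: sep.induct)
  case (sep_prod a b)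
  have a: "pd i (\<lambda>x. a x * c) = (\<lambda>x. pd i a x * c)" for c
    using pd_cmult[OF trig_differentiable, of a i c] sep_prod by (simp add: mult.commute)
  have "(LINT y|torus. v y * (c * b y)) = c * (LINT y|torus. v y * b y)" for c
    by (simp add: mult.left_commute[of _ c])
  then show ?case using sep_prod by (auto simp: a intro: sep.intros trig_pd_trig)
next
  case (sep_add k l)
  have d: "pd i (\<lambda>x. k x y + l x y) = (\<lambda>x. pd i (\<lambda>x. k x y) x + pd i (\<lambda>x. l x y) x)" for y
    by (intro pd_add trig_differentiable sep_trig sep_add)
  have "(LINT y|torus. v y * (k x y + l x y)) =
      (LINT y|torus. v y * k x y) + (LINT y|torus. v y * l x y)" for x
    using sep_add v by (simp add: distrib_left trig_mult_integrable sep_trig)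
  then have "pd i (\<lambda>x. LINT y|torus. v y * (k x y + l x y)) =
      (\<lambda>x. (LINT y|torus. v y * pd i (\<lambda>x. k x y) x) + (LINT y|torus. v y * pd i (\<lambda>x. l x y) x))"
    using sep_add by (simp add: pd_add trig_differentiable sep_integral_trig)
  also have "\<dots> = (\<lambda>x. LINT y|torus. v y * pd i (\<lambda>x. k x y + l x y) x)"
  proof -
    have "integrable torus (\<lambda>y. v y * pd i (\<lambda>x. h x y) x)" if "sep (\<lambda>x y. pd i (\<lambda>x. h x y) x)" for h x
      by (rule trig_mult_integrable[OF v sep_trig(2)[OF that]])
    then show ?thesis using sep_add by (simp add: d distrib_left)
  qed
  finally show ?case using sep_add by (auto simp: d intro: sep.intros)
qed

lemma sep_fubini:
  assumes "integrable torus \<psi>"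
  shows "sep k \<Longrightarrow> (LINT x|torus. \<psi> x * (LINT y|torus. v y * k x y)) =
    (LINT y|torus. v y * (LINT x|torus. \<psi> x * k x y))"
proof (induction rule: sep.induct)
  case (sep_prod a b)
  have 1: "(LINT y|torus. v y * (c * b y)) = c * (LINT y|torus. v y * b y)" for c
    by (simp add: mult.left_commute[of _ c])
  have 2: "(LINT y|torus. \<psi> y * (a y * c)) = (LINT y|torus. \<psi> y * a y) * c" for c
    by (simp add: mult.assoc[symmetric])
  show ?case unfolding 1 2
    by (simp add: mult.assoc[symmetric] mult.left_commute[of "v _"])
next
  case (sep_add k l)
  have 1: "(LINT y|torus. v y * (k x y + l x y)) =
      (LINT y|torus. v y * k x y) + (LINT y|torus. v y * l x y)" for x
    using sep_add v by (simp add: distrib_left trig_mult_integrable sep_trig)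
  have 2: "(LINT x|torus. \<psi> x * (k x y + l x y)) =
      (LINT x|torus. \<psi> x * k x y) + (LINT x|torus. \<psi> x * l x y)" for y
    using sep_add assms by (simp add: distrib_left trig_mult_integrable sep_trig)
  \<comment> \<open>The counterpart of \<open>sep_integral_trig\<close> with the roles of the two
    variables exchanged.\<close>
  have t: "trig (\<lambda>y. LINT x|torus. \<psi> x * h x y)" if "sep h" for h
    using that
  proof (induction rule: sep.induct)
    case (sep_prod a b)
    have "(LINT y|torus. \<psi> y * (a y * c)) = (LINT y|torus. \<psi> y * a y) * c" for c
      by (simp add: mult.assoc[symmetric])
    then show ?case using sep_prod by (auto intro: trig.intros)
  next
    case (sep_add k l)
    have "(LINT x|torus. \<psi> x * (k x y + l x y)) =
        (LINT x|torus. \<psi> x * k x y) + (LINT x|torus. \<psi> x * l x y)" for y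
      using sep_add assms by (simp add: distrib_left trig_mult_integrable sep_trig)
    then show ?case using sep_add by (auto intro: trig.intros)
  qed
  have i: "integrable torus (\<lambda>x. \<psi> x * (LINT y|torus. v y * h x y))"
    "integrable torus (\<lambda>y. v y * (LINT x|torus. \<psi> x * h x y))" if "sep h" for h
    by (intro trig_mult_integrable assms v sep_integral_trig t that)+
  show ?case unfolding 1 2 unfolding distrib_left
    by (subst (1 2) Bochner_Integration.integral_add) (simp_all only: i sep_add)
qed

end

section \<open>Periodic convolution\<close>

definition conv :: "(real^2 \<Rightarrow> real) \<Rightarrow> (real^2 \<Rightarrow> real) \<Rightarrow> real^2 \<Rightarrow> real" where
  "conv \<kappa> v x = (LINT y|torus. v y * \<kappa> (x - y))"

lemma trig_reflect: "trig \<kappa> \<Longrightarrow> trig (\<lambda>y. \<kappa> (x - y))"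
  by (rule sep_trig(2)[OF trig_diff_sep])

lemma trig_translate: "trig \<kappa> \<Longrightarrow> trig (\<lambda>x. \<kappa> (x - y))"
  by (rule sep_trig(1)[OF trig_diff_sep])

lemma conv_trig: "trig \<kappa> \<Longrightarrow> integrable torus v \<Longrightarrow> trig (conv \<kappa> v)"
  unfolding conv_def[abs_def] by (intro sep_integral_trig trig_diff_sep)

lemma pd_conv: "trig \<kappa> \<Longrightarrow> integrable torus v \<Longrightarrow> pd i (conv \<kappa> v) = conv (pd i \<kappa>) v"
  using sep_integral_pd[OF _ trig_diff_sep, of v \<kappa> i]
  by (simp add: conv_def[abs_def] pd_compose_diff trig_differentiable)

text \<open>The reflected kernel is an admissible test function. Its reflection contributes one sign
  and the weak identity another, so a weak derivative passes through the convolution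
  unchanged.\<close>

lemma conv_weak_pd:
  assumes "is_weak_pd i u v" "trig \<kappa>"
  shows "pd i (conv \<kappa> u) = conv \<kappa> v"
proof
  fix x
  have iu: "integrable torus u" using assms by (simp add: is_weak_pd_def L1_def)
  have "(LINT y|torus. u y * pd i (\<lambda>y. \<kappa> (x - y)) y) = - (LINT y|torus. v y * \<kappa> (x - y))"
    using assms trig_test[OF trig_reflect[OF assms(2)]] by (simp add: is_weak_pd_def)
  then show "pd i (conv \<kappa> u) x = conv \<kappa> v x"
    using assms iu by (simp add: pd_conv conv_def pd_compose_diff trig_differentiable)
qed

lemma conv_adjoint:
  assumes "trig \<kappa>" "integrable torus v" "integrable torus \<psi>"
  shows "(LINT x|torus. \<psi> x * conv \<kappa> v x) = (LINT y|torus. v y * (LINT x|torus. \<psi> x * \<kappa> (x - y)))"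
  unfolding conv_def by (rule sep_fubini[OF assms(2,3) trig_diff_sep[OF assms(1)]])

lemma conv_diff:
  assumes "trig \<kappa>" "integrable torus u" "integrable torus v"
  shows "conv \<kappa> (\<lambda>x. u x - v x) x = conv \<kappa> u x - conv \<kappa> v x"
  using assms by (simp add: conv_def left_diff_distrib trig_mult_integrable trig_reflect)

lemma pd_zero_imp_const:
  assumes "u differentiable_on UNIV" "\<And>i x. pd i u x = 0"
  shows "u x = u y"
proof -
  have "(u has_derivative (\<lambda>h. 0)) (at x within UNIV)" for x
  proof -
    have lin: "linear (frechet_derivative u (at x))"
      using has_derivative_linear[OF pd_works[OF assms(1)]] .
    have "frechet_derivative u (at x) h = 0" for h
    proof -
      have "frechet_derivative u (at x) (\<Sum>i\<in>UNIV. h $ i *\<^sub>R axis i 1) = (\<Sum>i\<in>UNIV. h $ i * pd i u x)"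
        by (simp add: linear_sum[OF lin] linear_scale[OF lin] pd_def)
      then have "frechet_derivative u (at x) h = (\<Sum>i\<in>UNIV. h $ i * pd i u x)"
        by (simp only: basis_expansion[of h, unfolded scalar_mult_eq_scaleR])
      then show ?thesis using assms by simp
    qed
    then have "frechet_derivative u (at x) = (\<lambda>h. 0)" by auto
    then show ?thesis using pd_works[OF assms(1), of x] by simp
  qed
  then obtain c where "\<And>x. x \<in> UNIV \<Longrightarrow> u x = c"
    using has_derivative_zero_constant[of UNIV u] by auto
  then show ?thesis by simp
qed

text \<open>Such an integral is the convolution of the kernel with the constant 1. Its partial
  derivatives are cell integrals of derivatives of periodic functions, hence zero, so it is
  constant; no change of variables on the cell is involved.\<close>

lemma integral_trig_translate:
  assumes "trig \<kappa>"
  shows "(LINT x|torus. \<kappa> (x - y)) = (LINT x|torus. \<kappa> x)"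
    and "(LINT y|torus. \<kappa> (x - y)) = (LINT y|torus. \<kappa> (- y))"
proof -
  have *: "(LINT x|torus. \<kappa> (a - x)) = (LINT x|torus. \<kappa> (b - x))" if "trig \<kappa>" for \<kappa> a b
  proof -
    have i1: "integrable torus (\<lambda>x. 1 :: real)" by (simp add: trig_integrable trig_const)
    have "pd i (conv \<kappa> (\<lambda>y. 1)) x = 0" for i x
    proof -
      have "(LINT y|torus. pd i (\<lambda>y. \<kappa> (x - y)) y) = 0"
        using trig_reflect[OF that] by (intro integral_pd_zero)
          (auto intro: trig_differentiable trig_continuous trig_pd_trig trig_periodic)
      then show ?thesis
        using that by (simp add: pd_conv i1 conv_def pd_compose_diff trig_differentiable)
    qed
    from pd_zero_imp_const[OF trig_differentiable[OF conv_trig[OF that i1]] this, of a b]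
    show ?thesis by (simp add: conv_def)
  qed
  have r: "trig (\<lambda>x. \<kappa> (- x))" using trig_reflect[OF assms, of 0] by simp
  show "(LINT x|torus. \<kappa> (x - y)) = (LINT x|torus. \<kappa> x)"
    using *[OF r, of y 0] by simp
  show "(LINT y|torus. \<kappa> (x - y)) = (LINT y|torus. \<kappa> (- y))"
    using *[OF assms, of x 0] by simp
qed

section \<open>An approximate identity\<close>

text \<open>Each factor is the square of the cosine of pi times the coordinate. The normalised
  powers are the de la Vallee Poussin kernels: nonnegative trigonometric polynomials that
  concentrate at the lattice.\<close>

definition cosbump :: "real^2 \<Rightarrow> real" where
  "cosbump x = (\<Prod>i\<in>UNIV. (1 + cos (2 * pi * x $ i)) / 2)"

definition bump :: "nat \<Rightarrow> real^2 \<Rightarrow> real" where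
  "bump k x = cosbump x ^ k / (LINT y|torus. cosbump y ^ k)"

text \<open>A smooth periodic substitute for the squared distance to the lattice: it is nonnegative
  and vanishes exactly at lattice points.\<close>

definition gap :: "real^2 \<Rightarrow> real" where
  "gap x = (\<Sum>i\<in>UNIV. 1 - cos (2 * pi * x $ i))"

lemma trig_cosbump: "trig cosbump"
proof -
  have "trig (\<lambda>x. \<Prod>i\<in>UNIV. (1 + cos (2 * pi * x $ i)) * (1 / 2))"
    by (intro trig_prod trig.intros) simp
  then show ?thesis by (simp add: cosbump_def[abs_def])
qed

lemma trig_bump: "trig (bump k)"
proof -
  have "trig (\<lambda>x. cosbump x ^ k * (1 / (LINT y|torus. cosbump y ^ k)))"
    by (intro trig_mult trig_power trig_cosbump trig.intros)
  then show ?thesis by (simp add: bump_def[abs_def])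
qed

lemma cosbump_factor:
  fixes t :: real
  shows "0 \<le> (1 + cos t) / 2" "(1 + cos t) / 2 \<le> 1"
proof -
  have "0 \<le> 1 + cos t" "1 + cos t \<le> 2"
    using cos_ge_minus_one[of t] cos_le_one[of t] by linarith+
  then show "0 \<le> (1 + cos t) / 2" "(1 + cos t) / 2 \<le> 1" by auto
qed

lemma cosbump_nonneg: "0 \<le> cosbump x"
  unfolding cosbump_def by (intro prod_nonneg cosbump_factor)

text \<open>A product of two numbers in the unit interval is at most each of them, hence at most
  their mean, and the mean of the two factors is \<open>1 - gap x / 4\<close>.\<close>

lemma cosbump_le:
  assumes "gap x \<ge> \<eta>"
  shows "cosbump x \<le> 1 - \<eta> / 4"
proof -
  define a b where "a = (1 + cos (2 * pi * x $ 1)) / 2" and "b = (1 + cos (2 * pi * x $ 2)) / 2"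
  have ab: "0 \<le> a" "a \<le> 1" "0 \<le> b" "b \<le> 1" unfolding a_def b_def by (rule cosbump_factor)+
  have "a * b \<le> a" "a * b \<le> b" using ab by (simp_all add: mult_left_le mult_left_le_one_le)
  moreover have "gap x = 4 - 2 * a - 2 * b" by (simp add: gap_def UNIV_2 a_def b_def field_simps)
  moreover have "cosbump x = a * b" by (simp add: cosbump_def UNIV_2 a_def b_def)
  ultimately have "4 * cosbump x \<le> 4 - \<eta>" using assms by linarith
  then show ?thesis by simp
qed

lemma emeasure_small_box:
  assumes "0 < c" "c \<le> 1"
  shows "measure lborel (box 0 (c *\<^sub>R 1 :: real^2)) = c\<^sup>2"
proof -
  have "measure lborel (box 0 (c *\<^sub>R 1 :: real^2)) = measure lborel (cbox 0 (c *\<^sub>R 1 :: real^2))"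
    by (simp add: measure_lborel_box_eq measure_lborel_cbox_eq)
  then show ?thesis using assms
    by (simp add: content_cbox_if_cart interval_ne_empty_cart power2_eq_square)
qed

text \<open>By continuity at the origin \<open>cosbump\<close> exceeds \<open>r\<close> on a small
  box, whose area serves as \<open>m\<close>. Since \<open>r\<close> may be any number below 1, this
  beats the decay of the powers at any fixed distance from the lattice.\<close>

lemma cosbump_power_integral:
  assumes "r < 1" "0 \<le> r"
  obtains m where "m > 0" "\<And>k. (LINT y|torus. cosbump y ^ k) \<ge> m * r ^ k"
proof -
  have "isCont cosbump 0"
    using trig_continuous[OF trig_cosbump] by (simp add: continuous_on_eq_continuous_at)
  moreover have "cosbump 0 = 1" by (simp add: cosbump_def)
  ultimately obtain d where d: "d > 0" "\<And>x. dist x 0 < d \<Longrightarrow> dist (cosbump x) 1 < 1 - r"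
    using assms unfolding continuous_at_eps_delta by (metis diff_gt_0_iff_gt)
  \<comment> \<open>The two coordinates add up to a norm of at most \<open>2 * c\<close>, which is
    below \<open>d\<close>; the minimum with 1 keeps the box inside the cell.\<close>
  define c where "c = min 1 (d / 4)"
  have c: "0 < c" "c \<le> 1" "2 * c < d" using d by (auto simp: c_def)
  define U where "U = box 0 (c *\<^sub>R 1 :: real^2)"
  have U: "r \<le> cosbump x" if "x \<in> U" for x
  proof -
    have "norm x \<le> (\<Sum>i\<in>UNIV. \<bar>x $ i\<bar>)" by (rule norm_le_l1_cart)
    also have "\<dots> \<le> (\<Sum>i\<in>(UNIV :: 2 set). c)"
      using that by (intro sum_mono) (auto simp: U_def mem_box_cart less_imp_le)
    also have "\<dots> < d" using c by simp
    finally show ?thesis using d(2)[of x] by (auto simp: dist_real_def)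
  qed
  have sub: "U \<subseteq> cbox 0 1" using c unfolding U_def by (force simp: mem_box_cart intro: less_imp_le order.trans[OF less_imp_le])
  have Um: "U \<in> sets torus" using sub by (auto simp: sets_restrict_space_iff U_def)
  have "measure torus U = c\<^sup>2"
    using emeasure_small_box[OF c(1,2)] sub by (simp add: U_def measure_restrict_space)
  then have m: "(LINT y|torus. indicator U y * r ^ k) = c\<^sup>2 * r ^ k" for k
    using Um sub by (simp add: Int_absorb2 lmeasurable_cbox)
  have "(LINT y|torus. cosbump y ^ k) \<ge> c\<^sup>2 * r ^ k" for k
    unfolding m[symmetric]
  proof (rule integral_mono)
    show "integrable torus (\<lambda>y. indicator U y * r ^ k)"
    proof (rule finite_measure.integrable_const_bound[OF finite_measure_torus, where B = "r ^ k"])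
      show "AE y in torus. norm (indicator U y * r ^ k) \<le> r ^ k"
        by (rule AE_I2) (simp add: assms indicator_def)
    qed (use Um in simp)
    show "integrable torus (\<lambda>y. cosbump y ^ k)" by (intro trig_integrable trig_power trig_cosbump)
    show "indicator U y * r ^ k \<le> cosbump y ^ k" for y
      using U[of y] assms cosbump_nonneg[of y] by (auto simp: indicator_def intro: power_mono)
  qed
  then show ?thesis using that[of "c\<^sup>2"] c by simp
qed

lemma cosbump_integral_pos: "(LINT y|torus. cosbump y ^ k) > 0"
proof -
  obtain m where "m > 0" "(LINT y|torus. cosbump y ^ k) \<ge> m * (1/2) ^ k"
    using cosbump_power_integral[of "1/2"] by auto
  moreover from this(1) have "m * (1/2) ^ k > 0" by simp
  ultimately show ?thesis by linarith
qed

lemma bump_nonneg: "0 \<le> bump k x"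
  unfolding bump_def using cosbump_integral_pos[of k] cosbump_nonneg by simp

lemma bump_minus: "bump k (- x) = bump k x"
  by (simp add: bump_def cosbump_def)

lemma integral_bump:
  fixes x y :: "real^2"
  shows "(LINT x|torus. bump k (x - y)) = 1" "(LINT y|torus. bump k (x - y)) = 1"
  using integral_trig_translate[OF trig_bump, of k] cosbump_integral_pos[of k]
  by (simp_all add: bump_minus) (simp_all add: bump_def)

text \<open>Away from the lattice \<open>cosbump\<close> is at most some \<open>\<rho>\<close> below
  1, while the normalising integral decays no faster than the powers of an \<open>r\<close> strictly
  between \<open>\<rho>\<close> and 1. The quotient decays geometrically.\<close>

lemma bump_far:
  assumes "\<eta> > 0" "e > 0"
  obtains N where "\<And>k x. k \<ge> N \<Longrightarrow> gap x \<ge> \<eta> \<Longrightarrow> bump k x \<le> e"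
proof -
  \<comment> \<open>For large \<open>\<eta>\<close> the bound from \<open>cosbump_le\<close> is
    negative; the maximum keeps \<open>\<rho>\<close> usable as the base of a power.\<close>
  define \<rho> where "\<rho> = max 0 (1 - \<eta> / 4)"
  define r where "r = (1 + \<rho>) / 2"
  have r: "0 \<le> \<rho>" "\<rho> < r" "0 < r" "r < 1" using assms by (auto simp: \<rho>_def r_def)
  obtain m where m: "m > 0" "\<And>k. (LINT y|torus. cosbump y ^ k) \<ge> m * r ^ k"
    using cosbump_power_integral[of r] r by auto
  have "(\<lambda>k. (\<rho> / r) ^ k / m) \<longlonglongrightarrow> 0 / m"
    using r m by (intro tendsto_divide LIMSEQ_power_zero) auto
  then have "eventually (\<lambda>k. (\<rho> / r) ^ k / m < e) sequentially"
    using assms(2) by (simp add: order_tendstoD(2))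
  then obtain N where N: "\<And>k. k \<ge> N \<Longrightarrow> (\<rho> / r) ^ k / m < e"
    by (auto simp: eventually_sequentially)
  show ?thesis
  proof (rule that[of N])
    fix k x assume k: "k \<ge> N" and x: "gap x \<ge> \<eta>"
    have "cosbump x \<le> \<rho>" using cosbump_le[OF x] by (simp add: \<rho>_def)
    then have "bump k x \<le> \<rho> ^ k / (m * r ^ k)"
      unfolding bump_def using m r cosbump_nonneg
      by (intro frac_le power_mono) auto
    also have "\<dots> = (\<rho> / r) ^ k / m" by (simp add: power_divide field_simps)
    finally show "bump k x \<le> e" using N[OF k] by linarith
  qed
qed

lemma gap_nonneg: "0 \<le> gap x"
  unfolding gap_def by (intro sum_nonneg) simp

lemma continuous_gap: "continuous_on S gap"
  unfolding gap_def[abs_def] by (intro continuous_intros)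

lemma gap_zero_imp_eq:
  assumes "gap (x - y) = 0" "x \<in> cbox 0 1" "y \<in> cbox 0 1" "x \<in> box 0 1 \<or> y \<in> box 0 1"
  shows "x = y"
proof -
  have "x $ i = y $ i" for i
  proof -
    have "(1 - cos (2 * pi * (x - y) $ i)) \<le> gap (x - y)"
      unfolding gap_def by (rule member_le_sum) auto
    then have "cos (2 * pi * (x $ i - y $ i)) = 1"
      using assms(1) cos_le_one[of "2 * pi * (x $ i - y $ i)"] by simp
    then obtain n :: int where "2 * pi * (x $ i - y $ i) = n * 2 * pi"
      by (auto simp: cos_one_2pi_int)
    then have n: "x $ i - y $ i = n" by simp
    moreover have "\<bar>x $ i - y $ i\<bar> < 1"
      using assms(2-4) unfolding mem_box_cart zero_index one_index by (smt (verit))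
    ultimately have "n = 0" by linarith
    then show ?thesis using n by simp
  qed
  then show ?thesis by (simp add: vec_eq_iff)
qed

section \<open>Convergence of the convolutions in the mean\<close>

text \<open>The periodic extension of \<open>g\<close> is continuous because \<open>g\<close> vanishes on the boundary of the
  cell; \<open>gap (x - y)\<close> stands for the distance of \<open>x\<close> and \<open>y\<close> in the torus.\<close>

lemma torus_uniform_continuity:
  fixes g :: "real^2 \<Rightarrow> real"
  assumes g: "continuous_on UNIV g" and g0: "\<And>x. x \<notin> box 0 1 \<Longrightarrow> g x = 0" and e: "e > 0"
  obtains \<eta> where "\<eta> > 0"
    "\<And>x y. x \<in> cbox 0 1 \<Longrightarrow> y \<in> cbox 0 1 \<Longrightarrow> gap (x - y) < \<eta> \<Longrightarrow> \<bar>g x - g y\<bar> < e"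
proof (rule ccontr)
  assume "\<not> thesis"
  then have "\<exists>x y. x \<in> cbox 0 1 \<and> y \<in> cbox 0 1 \<and> gap (x - y) < 1 / Suc n \<and> \<not> \<bar>g x - g y\<bar> < e" for n :: nat
    using that[of "1 / Suc n"] by fastforce
  then obtain X Y where XY: "\<And>n. X n \<in> cbox 0 1" "\<And>n. Y n \<in> cbox 0 1"
    "\<And>n. gap (X n - Y n) < 1 / Suc n" "\<And>n. \<not> \<bar>g (X n) - g (Y n)\<bar> < e" by metis
  have "compact (cbox 0 (1::real^2) \<times> cbox 0 (1::real^2))" by (intro compact_Times compact_cbox)
  then obtain l r where l: "l \<in> cbox 0 1 \<times> cbox 0 1" "strict_mono r" "((\<lambda>n. (X n, Y n)) \<circ> r) \<longlonglongrightarrow> l"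
    using XY(1,2) unfolding compact_def by (elim allE[of _ "\<lambda>n. (X n, Y n)"]) auto
  obtain x y where xy: "l = (x, y)" by (cases l)
  have X: "(\<lambda>n. X (r n)) \<longlonglongrightarrow> x" and Y: "(\<lambda>n. Y (r n)) \<longlonglongrightarrow> y"
    using tendsto_fst[OF l(3)] tendsto_snd[OF l(3)] by (simp_all add: xy o_def)
  have lim: "(\<lambda>n. h (Z n)) \<longlonglongrightarrow> h z" if "continuous_on UNIV h" "Z \<longlonglongrightarrow> z"
    for h :: "real^2 \<Rightarrow> real" and Z z
    by (rule continuous_on_tendsto_compose[OF that]) auto
  have "gap (x - y) \<le> 0"
  proof (rule LIMSEQ_le)
    show "(\<lambda>n. gap (X (r n) - Y (r n))) \<longlonglongrightarrow> gap (x - y)"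
      by (rule lim[OF continuous_gap tendsto_diff[OF X Y]])
    show "(\<lambda>n. 1 / Suc (r n)) \<longlonglongrightarrow> 0"
      using LIMSEQ_subseq_LIMSEQ[OF lim_inverse_n' [THEN LIMSEQ_Suc] l(2)] by (simp add: o_def)
    show "\<exists>N. \<forall>n\<ge>N. gap (X (r n) - Y (r n)) \<le> 1 / Suc (r n)" using XY(3) less_imp_le by blast
  qed
  then have gap0: "gap (x - y) = 0" using gap_nonneg[of "x - y"] by simp
  \<comment> \<open>If one limit is an interior point, the vanishing gap forces the two to coincide.
    If both lie on the boundary they may be different representatives of one point of the torus, but
    \<open>g\<close> is zero at both.\<close>
  have "g x = g y"
  proof (cases "x \<in> box 0 1 \<or> y \<in> box 0 1")
    case True
    then show ?thesis using gap_zero_imp_eq[OF gap0] l(1) by (simp add: xy)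
  next
    case False
    then show ?thesis using g0 by simp
  qed
  moreover have "e \<le> \<bar>g x - g y\<bar>"
  proof (rule LIMSEQ_le_const)
    show "(\<lambda>n. \<bar>g (X (r n)) - g (Y (r n))\<bar>) \<longlonglongrightarrow> \<bar>g x - g y\<bar>"
      by (intro tendsto_rabs tendsto_diff lim[OF g] X Y)
    show "\<exists>N. \<forall>n\<ge>N. e \<le> \<bar>g (X (r n)) - g (Y (r n))\<bar>" using XY(4) not_less by blast
  qed
  ultimately show False using e by simp
qed

text \<open>The kernel has mass one, so the error is an average of \<open>g y - g x\<close>. Where
  the gap is small uniform continuity applies, elsewhere the kernel itself is uniformly
  small.\<close>

lemma conv_bump_uniform:
  fixes g :: "real^2 \<Rightarrow> real"
  assumes g: "continuous_on UNIV g" and g0: "\<And>x. x \<notin> box 0 1 \<Longrightarrow> g x = 0" and e: "e > 0"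
  obtains N where "\<And>k x. k \<ge> N \<Longrightarrow> x \<in> cbox 0 1 \<Longrightarrow> \<bar>conv (bump k) g x - g x\<bar> \<le> e"
proof -
  obtain \<eta> where \<eta>: "\<eta> > 0"
    "\<And>x y. x \<in> cbox 0 1 \<Longrightarrow> y \<in> cbox 0 1 \<Longrightarrow> gap (x - y) < \<eta> \<Longrightarrow> \<bar>g x - g y\<bar> < e / 2"
    using torus_uniform_continuity[OF g g0, of "e / 2"] e by auto
  obtain B where B: "\<And>x. x \<in> cbox 0 1 \<Longrightarrow> \<bar>g x\<bar> \<le> B" using continuous_bounded_torus[OF g] by blast
  have B0: "B \<ge> 0" using B[of 0] by (auto simp: mem_box_cart)
  \<comment> \<open>With this bound on the kernel the far region contributes at most
    \<open>e / 2\<close>; the summand 1 keeps the denominator positive when \<open>B\<close> is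
    zero.\<close>
  define b where "b = e / (4 * B + 1)"
  have "b > 0" "b * (2 * B) \<le> e / 2" using e B0 by (auto simp: b_def field_simps)
  then obtain N where N: "\<And>k x. k \<ge> N \<Longrightarrow> gap x \<ge> \<eta> \<Longrightarrow> bump k x \<le> b"
    using bump_far[OF \<eta>(1)] by blast
  show ?thesis
  proof (rule that[of N])
    fix k and x :: "real^2" assume k: "k \<ge> N" and x: "x \<in> cbox 0 1"
    have ig: "integrable torus g" by (rule integrable_torus_continuous[OF g])
    have ib: "integrable torus (\<lambda>y. bump k (x - y))" by (intro trig_integrable trig_reflect trig_bump)
    have i1: "integrable torus (\<lambda>y. g y * bump k (x - y))"
      by (intro trig_mult_integrable ig trig_reflect trig_bump)
    have "conv (bump k) g x - g x = (LINT y|torus. g y * bump k (x - y)) - g x * (LINT y|torus. bump k (x - y))"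
      by (simp add: conv_def integral_bump)
    also have "\<dots> = (LINT y|torus. (g y - g x) * bump k (x - y))"
      using i1 ib by (simp add: left_diff_distrib)
    finally have "\<bar>conv (bump k) g x - g x\<bar> \<le> (LINT y|torus. \<bar>(g y - g x) * bump k (x - y)\<bar>)"
      using integral_abs_bound[of torus "\<lambda>y. (g y - g x) * bump k (x - y)"] by simp
    also have "\<dots> \<le> (LINT y|torus. e / 2 * bump k (x - y) + b * (2 * B))"
    proof (rule integral_mono)
      show "integrable torus (\<lambda>y. \<bar>(g y - g x) * bump k (x - y)\<bar>)"
        using i1 ib by (simp add: left_diff_distrib)
      show "integrable torus (\<lambda>y. e / 2 * bump k (x - y) + b * (2 * B))"
        using ib trig_integrable[OF trig_const] by simp
      fix y assume "y \<in> space torus"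
      then have y: "y \<in> cbox 0 1" by simp
      have bn: "0 \<le> bump k (x - y)" by (rule bump_nonneg)
      have "\<bar>g y - g x\<bar> * bump k (x - y) \<le> e / 2 * bump k (x - y) + b * (2 * B)"
      proof (cases "gap (x - y) < \<eta>")
        case True
        then have "\<bar>g y - g x\<bar> \<le> e / 2" using \<eta>(2)[OF x y] by linarith
        then have "\<bar>g y - g x\<bar> * bump k (x - y) \<le> e / 2 * bump k (x - y)"
          by (rule mult_right_mono[OF _ bn])
        then show ?thesis using B0 \<open>b > 0\<close> by (simp add: add_increasing2)
      next
        case False
        then have "bump k (x - y) \<le> b" using N[OF k] by simp
        moreover have "\<bar>g y - g x\<bar> \<le> 2 * B" using B[OF x] B[OF y] by linarith
        ultimately have "\<bar>g y - g x\<bar> * bump k (x - y) \<le> 2 * B * b"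
          using bn B0 by (intro mult_mono) auto
        then show ?thesis using e bn by (simp add: add_increasing mult.commute mult.left_commute)
      qed
      then show "\<bar>(g y - g x) * bump k (x - y)\<bar> \<le> e / 2 * bump k (x - y) + b * (2 * B)"
        using bn by (simp add: abs_mult)
    qed
    also have "\<dots> = e / 2 + b * (2 * B)"
      using ib trig_integrable[OF trig_const] by (simp add: integral_bump)
    also have "\<dots> \<le> e" using \<open>b * (2 * B) \<le> e / 2\<close> by simp
    finally show "\<bar>conv (bump k) g x - g x\<bar> \<le> e" .
  qed
qed

text \<open>By duality: the convolution is tested with its own sign, and the adjoint formula moves
  the kernel onto that sign function, where positivity and mass one bound the result by 1.\<close>

lemma conv_bump_contraction:
  assumes v: "integrable torus v"
  shows "(LINT x|torus. \<bar>conv (bump k) v x\<bar>) \<le> (LINT x|torus. \<bar>v x\<bar>)"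
proof -
  let ?c = "conv (bump k) v" and ?s = "\<lambda>x. sgn (conv (bump k) v x)"
  have c: "trig ?c" by (rule conv_trig[OF trig_bump v])
  have ms: "?s \<in> borel_measurable torus"
    using trig_integrable[OF c] by measurable
  have s: "integrable torus ?s"
    using ms by (intro finite_measure.integrable_const_bound[OF finite_measure_torus, where B = 1])
      (auto simp: sgn_if)
  have "(LINT x|torus. \<bar>?c x\<bar>) = (LINT x|torus. ?s x * ?c x)"
    by (simp add: abs_sgn mult.commute)
  also have "\<dots> = (LINT y|torus. v y * (LINT x|torus. ?s x * bump k (x - y)))"
    by (rule conv_adjoint[OF trig_bump v s])
  also have "\<dots> \<le> (LINT y|torus. \<bar>v y\<bar>)"
  proof (rule integral_mono')
    show "integrable torus (\<lambda>y. \<bar>v y\<bar>)" using v by simp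
    fix y
    have it: "integrable torus (\<lambda>x. bump k (x - y))" by (intro trig_integrable trig_translate trig_bump)
    have "\<bar>LINT x|torus. ?s x * bump k (x - y)\<bar> \<le> (LINT x|torus. \<bar>?s x * bump k (x - y)\<bar>)"
      by (rule integral_abs_bound)
    also have "\<dots> \<le> (LINT x|torus. bump k (x - y))"
      using it bump_nonneg by (intro integral_mono') (auto simp: abs_mult sgn_if)
    also have "\<dots> = 1" by (rule integral_bump)
    finally have "\<bar>v y\<bar> * \<bar>LINT x|torus. ?s x * bump k (x - y)\<bar> \<le> \<bar>v y\<bar> * 1"
      by (intro mult_left_mono) auto
    then show "v y * (LINT x|torus. ?s x * bump k (x - y)) \<le> \<bar>v y\<bar>"
      using abs_ge_self[of "v y * (LINT x|torus. ?s x * bump k (x - y))"]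
      unfolding abs_mult by linarith
  qed auto
  finally show ?thesis .
qed

lemma AE_torus_box: "AE x in torus. x \<in> box 0 1"
proof -
  have "cbox 0 1 - box 0 (1::real^2) \<in> null_sets lebesgue"
    using negligible_frontier_interval[of 0 "1::real^2"] by (simp add: negligible_iff_null_sets)
  then have "AE x in lebesgue. x \<notin> cbox 0 1 - box 0 (1::real^2)" by (rule AE_not_in)
  then show ?thesis by (subst AE_restrict_space_iff) (auto elim: AE_mp)
qed

definition clip :: "real \<Rightarrow> real \<Rightarrow> real" where
  "clip M t = max (- M) (min M t)"

lemma clip_bound: "M \<ge> 0 \<Longrightarrow> \<bar>clip M t\<bar> \<le> M"
  by (auto simp: clip_def)

text \<open>The function is truncated at a height \<open>M\<close>; measurability then supplies
  continuous functions converging almost everywhere, which are truncated as well and cut off near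
  the boundary. Dominated convergence with the constant \<open>2 * M\<close> concludes. Vanishing
  outside the open cell is what lets \<open>g\<close> be regarded as continuous on the
  torus.\<close>

lemma integrable_approx_continuous:
  fixes v :: "real^2 \<Rightarrow> real"
  assumes v: "integrable torus v" and e: "e > 0"
  obtains g where "continuous_on UNIV g" "\<And>x. x \<notin> box 0 1 \<Longrightarrow> g x = 0"
    "(LINT x|torus. \<bar>v x - g x\<bar>) < e"
proof -
  have mv: "v \<in> borel_measurable torus" using v by simp
  have mclip: "(\<lambda>x. clip M (v x)) \<in> borel_measurable torus" for M
    unfolding clip_def using mv by measurable
  have iclip: "integrable torus (\<lambda>x. clip M (v x))" if "M \<ge> 0" for M
    using that by (intro finite_measure.integrable_const_bound[OF finite_measure_torus, where B = M] mclip)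
      (auto simp: clip_bound)
  have "(\<lambda>M. LINT x|torus. \<bar>v x - clip (real M) (v x)\<bar>) \<longlonglongrightarrow> (LINT x|torus. \<bar>v x - v x\<bar>)"
  proof (rule integral_dominated_convergence[where w = "\<lambda>x. \<bar>v x\<bar>"])
    show "AE x in torus. (\<lambda>M. \<bar>v x - clip (real M) (v x)\<bar>) \<longlonglongrightarrow> \<bar>v x - v x\<bar>"
    proof (rule AE_I2)
      fix x
      obtain N :: nat where "\<bar>v x\<bar> < N" using reals_Archimedean2 by blast
      then have "\<forall>M\<ge>N. clip (real M) (v x) = v x" by (auto simp: clip_def)
      then have "eventually (\<lambda>M. clip (real M) (v x) = v x) sequentially"
        unfolding eventually_sequentially by blast
      then show "(\<lambda>M. \<bar>v x - clip (real M) (v x)\<bar>) \<longlonglongrightarrow> \<bar>v x - v x\<bar>"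
        by (intro tendsto_eventually) (auto elim: eventually_mono)
    qed
    show "AE x in torus. norm \<bar>v x - clip (real M) (v x)\<bar> \<le> \<bar>v x\<bar>" for M
      by (rule AE_I2) (auto simp: clip_def)
  qed (use v mclip in auto)
  then have "eventually (\<lambda>M. (LINT x|torus. \<bar>v x - clip (real M) (v x)\<bar>) < e / 2) sequentially"
    using e by (intro order_tendstoD(2)) auto
  then obtain M :: nat where M: "(LINT x|torus. \<bar>v x - clip (real M) (v x)\<bar>) < e / 2"
    by (auto simp: eventually_sequentially)
  have "(\<lambda>x. if x \<in> cbox 0 1 then v x else 0) \<in> borel_measurable lebesgue"
    using mv by (subst borel_measurable_if) auto
  then have "(\<lambda>x. if x \<in> cbox 0 1 then v x else 0) measurable_on box 0 1"
    by (intro lebesgue_measurable_imp_measurable_on_real) auto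
  then obtain Z G where Z: "negligible Z" and G: "\<And>n. continuous_on UNIV (G n)"
    "\<And>x. x \<notin> Z \<Longrightarrow> (\<lambda>n. G n x) \<longlonglongrightarrow> (if x \<in> box 0 1 then if x \<in> cbox 0 1 then v x else 0 else 0)"
    unfolding measurable_on_def by blast
  \<comment> \<open>Continuous, zero outside the open cell, and eventually equal to 1 at each point
    inside.\<close>
  define cut where "cut n x = min 1 (real n * infdist x (- box 0 1))" for n and x :: "real^2"
  have "(0::real^2) \<in> - box 0 1" by (simp add: mem_box_cart)
  then have ne: "- box 0 (1::real^2) \<noteq> {}" by blast
  have cut01: "0 \<le> cut n x" "cut n x \<le> 1" for n x using infdist_nonneg[of x] by (auto simp: cut_def)
  define h where "h n x = clip M (G n x) * cut n x" for n x
  have ch: "continuous_on UNIV (h n)" for n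
    unfolding h_def clip_def cut_def by (intro continuous_intros G)
  have hb: "\<bar>h n x\<bar> \<le> M" for n x
    using mult_mono[OF clip_bound[of "real M" "G n x"] cut01(2)[of n x]] cut01(1)[of n x]
    by (simp add: h_def abs_mult)
  have "(\<lambda>n. LINT x|torus. \<bar>clip M (v x) - h n x\<bar>) \<longlonglongrightarrow> (LINT x|torus. \<bar>clip M (v x) - clip M (v x)\<bar>)"
  proof (rule integral_dominated_convergence[where w = "\<lambda>x. 2 * real M"])
    have "AE x in lebesgue. x \<notin> Z" using Z by (intro AE_not_in) (simp add: negligible_iff_null_sets)
    then have "AE x in torus. x \<notin> Z" by (subst AE_restrict_space_iff) (auto elim: AE_mp)
    with AE_torus_box
    show "AE x in torus. (\<lambda>n. \<bar>clip M (v x) - h n x\<bar>) \<longlonglongrightarrow> \<bar>clip M (v x) - clip M (v x)\<bar>"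
    proof eventually_elim
      fix x assume x: "x \<in> box 0 1" "x \<notin> Z"
      then have G': "(\<lambda>n. G n x) \<longlonglongrightarrow> v x" using G(2)[of x] box_subset_cbox[of 0 "1::real^2"] by auto
      have pos: "infdist x (- box 0 1) > 0"
        using x ne by (intro infdist_pos_not_in_closed) (auto simp: closed_Compl)
      obtain N where N: "1 < real N * infdist x (- box 0 1)" using reals_Archimedean3[OF pos] by blast
      have "cut n x = 1" if "n \<ge> N" for n
      proof -
        have "real N * infdist x (- box 0 1) \<le> real n * infdist x (- box 0 1)"
          using that pos by (intro mult_right_mono) auto
        then show ?thesis using N unfolding cut_def by simp
      qed
      then have "(\<lambda>n. cut n x) \<longlonglongrightarrow> 1"
        by (intro tendsto_eventually) (auto simp: eventually_sequentially)
      then have "(\<lambda>n. h n x) \<longlonglongrightarrow> clip M (v x) * 1"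
        unfolding h_def clip_def by (intro tendsto_intros G')
      then show "(\<lambda>n. \<bar>clip M (v x) - h n x\<bar>) \<longlonglongrightarrow> \<bar>clip M (v x) - clip M (v x)\<bar>"
        by (intro tendsto_intros) simp
    qed
    show "AE x in torus. norm \<bar>clip M (v x) - h n x\<bar> \<le> 2 * real M" for n
    proof (rule AE_I2)
      fix x show "norm \<bar>clip M (v x) - h n x\<bar> \<le> 2 * real M"
        using clip_bound[of M "v x"] hb[of n x] by simp
    qed
    show "(\<lambda>x. \<bar>clip M (v x) - h n x\<bar>) \<in> borel_measurable torus" for n
      using mclip[of M] continuous_measurable_torus[OF ch] by measurable
  qed (auto simp: trig_integrable trig_const)
  then have "eventually (\<lambda>n. (LINT x|torus. \<bar>clip M (v x) - h n x\<bar>) < e / 2) sequentially"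
    using e by (intro order_tendstoD(2)) auto
  then obtain n where n: "(LINT x|torus. \<bar>clip M (v x) - h n x\<bar>) < e / 2"
    by (auto simp: eventually_sequentially)
  have ih: "integrable torus (h n)" by (rule integrable_torus_continuous[OF ch])
  have "(LINT x|torus. \<bar>v x - h n x\<bar>) \<le> (LINT x|torus. \<bar>v x - clip M (v x)\<bar> + \<bar>clip M (v x) - h n x\<bar>)"
    using v iclip[of M] ih by (intro integral_mono) auto
  also have "\<dots> = (LINT x|torus. \<bar>v x - clip M (v x)\<bar>) + (LINT x|torus. \<bar>clip M (v x) - h n x\<bar>)"
    using v iclip[of M] ih by simp
  also have "\<dots> < e" using M n by simp
  finally show ?thesis using that[of "h n"] ch
    by (simp add: h_def cut_def)
qed

text \<open>A density argument: \<open>conv_bump_uniform\<close> treats a continuous approximation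
  and \<open>conv_bump_contraction\<close> the error made by approximating. Three contributions of
  at most \<open>e / 4\<close> remain.\<close>

theorem conv_bump_tendsto:
  assumes v: "integrable torus v"
  shows "(\<lambda>k. LINT x|torus. \<bar>conv (bump k) v x - v x\<bar>) \<longlonglongrightarrow> 0"
proof (rule LIMSEQ_I)
  fix e :: real assume e: "0 < e"
  obtain g where g: "continuous_on UNIV g" "\<And>x. x \<notin> box 0 1 \<Longrightarrow> g x = 0"
    "(LINT x|torus. \<bar>v x - g x\<bar>) < e / 4"
    using integrable_approx_continuous[OF v, of "e / 4"] e by auto
  obtain N where N: "\<And>k x. k \<ge> N \<Longrightarrow> x \<in> cbox 0 1 \<Longrightarrow> \<bar>conv (bump k) g x - g x\<bar> \<le> e / 4"
    using conv_bump_uniform[OF g(1,2), of "e / 4"] e by auto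
  have ig: "integrable torus g" by (rule integrable_torus_continuous[OF g(1)])
  have ic: "integrable torus (conv (bump k) u)" if "integrable torus u" for k u
    by (rule trig_integrable[OF conv_trig[OF trig_bump that]])
  have "norm ((LINT x|torus. \<bar>conv (bump k) v x - v x\<bar>) - 0) < e" if k: "k \<ge> N" for k
  proof -
    have ivg: "integrable torus (\<lambda>x. v x - g x)" using v ig by simp
    note ints = ic[OF ivg, of k] ic[OF ig, of k] ic[OF v, of k] v ig trig_integrable[OF trig_const]
    have "(LINT x|torus. \<bar>conv (bump k) v x - v x\<bar>) \<le>
      (LINT x|torus. \<bar>conv (bump k) (\<lambda>x. v x - g x) x\<bar> + e / 4 + \<bar>v x - g x\<bar>)"
    proof (rule integral_mono)
      fix x assume "x \<in> space torus"
      then have "\<bar>conv (bump k) g x - g x\<bar> \<le> e / 4" using N[OF k] by simp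
      then show "\<bar>conv (bump k) v x - v x\<bar> \<le> \<bar>conv (bump k) (\<lambda>x. v x - g x) x\<bar> + e / 4 + \<bar>v x - g x\<bar>"
        using conv_diff[OF trig_bump v ig, of k x] by linarith
    qed (use ints in auto)
    also have "\<dots> = (LINT x|torus. \<bar>conv (bump k) (\<lambda>x. v x - g x) x\<bar>) + e / 4 + (LINT x|torus. \<bar>v x - g x\<bar>)"
      using ints by simp
    also have "\<dots> < e" using conv_bump_contraction[OF ivg, of k] g(3) e by linarith
    finally show ?thesis by simp
  qed
  then show "\<exists>N. \<forall>k\<ge>N. norm ((LINT x|torus. \<bar>conv (bump k) v x - v x\<bar>) - 0) < e" by blast
qed

section \<open>Weak derivatives\<close>

text \<open>The product is split as \<open>(a k - a') * b k + a' * b k\<close>: the first part is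
  small by mean convergence and boundedness, the second converges by domination. This is the means
  of passing from mollified to weak identities.\<close>

lemma L1_tendsto_integral_mult:
  fixes a :: "nat \<Rightarrow> real^2 \<Rightarrow> real"
  assumes a: "\<And>k. integrable torus (a k)" "integrable torus a'"
    and lim: "(\<lambda>k. LINT x|torus. \<bar>a k x - a' x\<bar>) \<longlonglongrightarrow> 0"
    and b: "\<And>k. b k \<in> borel_measurable torus" "b' \<in> borel_measurable torus"
    and bd: "\<And>k x. x \<in> cbox 0 1 \<Longrightarrow> \<bar>b k x\<bar> \<le> C"
    and ae: "AE x in torus. (\<lambda>k. b k x) \<longlonglongrightarrow> b' x"
  shows "(\<lambda>k. LINT x|torus. a k x * b k x) \<longlonglongrightarrow> (LINT x|torus. a' x * b' x)"
proof -
  have i: "integrable torus (\<lambda>x. w x * b k x)" if "integrable torus w" for w k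
    by (rule integrable_mult_bounded[OF that b(1) bd])
  have 1: "(\<lambda>k. LINT x|torus. (a k x - a' x) * b k x) \<longlonglongrightarrow> 0"
  proof (rule Lim_null_comparison)
    show "(\<lambda>k. \<bar>C\<bar> * (LINT x|torus. \<bar>a k x - a' x\<bar>)) \<longlonglongrightarrow> 0"
      using tendsto_mult[OF tendsto_const[of "\<bar>C\<bar>"] lim] by simp
    have "\<bar>LINT x|torus. (a k x - a' x) * b k x\<bar> \<le> \<bar>C\<bar> * (LINT x|torus. \<bar>a k x - a' x\<bar>)" for k
    proof -
      have "\<bar>LINT x|torus. (a k x - a' x) * b k x\<bar> \<le> (LINT x|torus. \<bar>(a k x - a' x) * b k x\<bar>)"
        by (rule integral_abs_bound)
      also have "\<dots> \<le> (LINT x|torus. \<bar>C\<bar> * \<bar>a k x - a' x\<bar>)"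
      proof (rule integral_mono)
        show "integrable torus (\<lambda>x. \<bar>(a k x - a' x) * b k x\<bar>)" using a by (intro integrable_abs i) simp
        show "integrable torus (\<lambda>x. \<bar>C\<bar> * \<bar>a k x - a' x\<bar>)" using a by simp
        fix x assume "x \<in> space torus"
        then have "\<bar>b k x\<bar> \<le> \<bar>C\<bar>" using bd[of x k] by simp
        then show "\<bar>(a k x - a' x) * b k x\<bar> \<le> \<bar>C\<bar> * \<bar>a k x - a' x\<bar>"
          by (simp add: abs_mult mult.commute[of "\<bar>C\<bar>"] mult_left_mono)
      qed
      finally show ?thesis by simp
    qed
    then show "\<forall>\<^sub>F k in sequentially. norm (LINT x|torus. (a k x - a' x) * b k x) \<le>
        \<bar>C\<bar> * (LINT x|torus. \<bar>a k x - a' x\<bar>)" by simp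
  qed
  have 2: "(\<lambda>k. LINT x|torus. a' x * b k x) \<longlonglongrightarrow> (LINT x|torus. a' x * b' x)"
  proof (rule integral_dominated_convergence[where w = "\<lambda>x. \<bar>C\<bar> * \<bar>a' x\<bar>"])
    show "(\<lambda>x. a' x * b' x) \<in> borel_measurable torus" using a b by measurable
    show "(\<lambda>x. a' x * b k x) \<in> borel_measurable torus" for k using a b by measurable
    show "AE x in torus. (\<lambda>k. a' x * b k x) \<longlonglongrightarrow> a' x * b' x"
      using ae by eventually_elim (intro tendsto_intros)
    show "AE x in torus. norm (a' x * b k x) \<le> \<bar>C\<bar> * \<bar>a' x\<bar>" for k
    proof (rule AE_I2)
      fix x assume "x \<in> space torus"
      then have "\<bar>b k x\<bar> \<le> \<bar>C\<bar>" using bd[of x k] by simp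
      then show "norm (a' x * b k x) \<le> \<bar>C\<bar> * \<bar>a' x\<bar>"
        by (simp add: abs_mult mult.commute[of "\<bar>C\<bar>"] mult_left_mono)
    qed
  qed (use a in simp)
  have "(LINT x|torus. a k x * b k x) = (LINT x|torus. (a k x - a' x) * b k x) + (LINT x|torus. a' x * b k x)" for k
    using a i by (simp add: left_diff_distrib)
  then show ?thesis using tendsto_add[OF 1 2] by simp
qed

lemma conv_bump_AE_subseq:
  assumes "integrable torus v"
  obtains r :: "nat \<Rightarrow> nat" where "strict_mono r"
    "AE x in torus. (\<lambda>k. conv (bump (r k)) v x) \<longlonglongrightarrow> v x"
proof -
  have "\<exists>r::nat\<Rightarrow>nat. strict_mono r \<and> (AE x in torus. (\<lambda>k. conv (bump (r k)) v x - v x) \<longlonglongrightarrow> 0)"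
  proof (rule tendsto_L1_AE_subseq)
    show "integrable torus (\<lambda>x. conv (bump k) v x - v x)" for k
      using assms trig_integrable[OF conv_trig[OF trig_bump assms]] by simp
    show "(\<lambda>k. LINT x|torus. norm (conv (bump k) v x - v x)) \<longlonglongrightarrow> 0"
      using conv_bump_tendsto[OF assms] by simp
  qed
  then show ?thesis using that by (auto simp: LIM_zero_iff)
qed

lemma pd_compose:
  assumes u: "u differentiable_on UNIV" and G: "\<And>s. (G has_real_derivative g s) (at s)"
  shows "(\<lambda>x. G (u x)) differentiable_on UNIV" "pd i (\<lambda>x. G (u x)) = (\<lambda>x. g (u x) * pd i u x)"
proof -
  have D: "((\<lambda>x. G (u x)) has_derivative (\<lambda>h. g (u x) * frechet_derivative u (at x) h)) (at x)" for x
    using diff_chain_at[OF pd_works[OF u] G[of "u x", unfolded has_field_derivative_def]]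
    by (simp add: o_def)
  then show "(\<lambda>x. G (u x)) differentiable_on UNIV"
    by (auto simp: differentiable_on_def differentiable_def)
  show "pd i (\<lambda>x. G (u x)) = (\<lambda>x. g (u x) * pd i u x)"
    unfolding pd_eqI[OF D] by (simp add: pd_def)
qed

lemma continuous_comp: "continuous_on UNIV g \<Longrightarrow> continuous_on UNIV u \<Longrightarrow> continuous_on UNIV (\<lambda>x. g (u x))"
  by (rule continuous_on_compose2) auto

lemma deriv_continuous: "(\<And>s. (G has_real_derivative g s) (at s)) \<Longrightarrow> continuous_on UNIV G"
  by (intro continuous_at_imp_continuous_on ballI DERIV_isCont)

lemma deriv_lipschitz:
  fixes G :: "real \<Rightarrow> real"
  assumes G: "\<And>s. (G has_real_derivative g s) (at s)" and B: "\<And>s. \<bar>g s\<bar> \<le> B"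
  shows "\<bar>G a - G b\<bar> \<le> B * \<bar>a - b\<bar>"
  using field_differentiable_bound[of UNIV G g B a b] G B by simp

lemma integrable_lipschitz_comp:
  assumes G: "\<And>s. (G has_real_derivative g s) (at s)" and B: "\<And>s. \<bar>g s\<bar> \<le> B"
    and u: "integrable torus u"
  shows "integrable torus (\<lambda>x. G (u x))"
proof (rule Bochner_Integration.integrable_bound)
  show "integrable torus (\<lambda>x. B * \<bar>u x\<bar> + \<bar>G 0\<bar>)" using u trig_integrable[OF trig_const] by simp
  have "G \<in> borel_measurable borel" by (rule borel_measurable_continuous_onI[OF deriv_continuous[OF G]])
  then show "(\<lambda>x. G (u x)) \<in> borel_measurable torus"
    by (rule measurable_compose[OF borel_measurable_integrable[OF u]])
  show "AE x in torus. norm (G (u x)) \<le> norm (B * \<bar>u x\<bar> + \<bar>G 0\<bar>)"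
  proof (rule AE_I2)
    fix x
    have "\<bar>G (u x) - G 0\<bar> \<le> B * \<bar>u x\<bar>" using deriv_lipschitz[OF G B, of "u x" 0] by simp
    then show "norm (G (u x)) \<le> norm (B * \<bar>u x\<bar> + \<bar>G 0\<bar>)" by simp
  qed
qed

lemma test_differentiable: "\<phi> \<in> test_functions \<Longrightarrow> \<phi> differentiable_on UNIV"
  and test_periodic: "\<phi> \<in> test_functions \<Longrightarrow> periodic \<phi>"
proof -
  assume \<phi>: "\<phi> \<in> test_functions"
  have "Ck (Suc 0) \<phi>" using \<phi> by (simp only: test_functions_def mem_Collect_eq)
  then show "\<phi> differentiable_on UNIV" by simp
  show "periodic \<phi>" using \<phi> by (simp only: test_functions_def mem_Collect_eq)
qed

lemma integral_by_parts:
  assumes u: "u differentiable_on UNIV" "continuous_on UNIV (pd i u)" "periodic u"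
    and v: "v differentiable_on UNIV" "continuous_on UNIV (pd i v)" "periodic v"
  shows "(LINT x|torus. u x * pd i v x) = - (LINT x|torus. pd i u x * v x)"
proof -
  have c: "continuous_on UNIV (\<lambda>x. u x * pd i v x)" "continuous_on UNIV (\<lambda>x. pd i u x * v x)"
    by (intro continuous_on_mult u v differentiable_imp_continuous_on)+
  have "(LINT x|torus. pd i (\<lambda>x. u x * v x) x) = 0"
  proof (rule integral_pd_zero)
    show "continuous_on UNIV (pd i (\<lambda>x. u x * v x))"
      unfolding pd_mult[OF u(1) v(1)] by (intro continuous_on_add c)
  qed (use u(3) v(3) in \<open>auto intro: differentiable_on_mult u v simp: periodic_def\<close>)
  then show ?thesis
    using integrable_torus_continuous[OF c(1)] integrable_torus_continuous[OF c(2)]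
    by (simp add: pd_mult[OF u(1) v(1)])
qed

text \<open>The classical chain rule is integrated by parts for the mollifications. Their
  derivatives converge in the mean, while the coefficient \<open>g\<close> stays bounded and, along
  a subsequence, converges almost everywhere.\<close>

theorem weak_pd_chain:
  assumes w: "is_weak_pd i u w"
    and G: "\<And>s. (G has_real_derivative g s) (at s)" and cg: "continuous_on UNIV g"
    and B: "\<And>s. \<bar>g s\<bar> \<le> B"
  shows "is_weak_pd i (\<lambda>x. G (u x)) (\<lambda>x. g (u x) * w x)"
proof -
  have iu: "integrable torus u" and iw: "integrable torus w" and per: "periodic u" "periodic w"
    using w by (auto simp: is_weak_pd_def L1_def)
  have B0: "B \<ge> 0" using B[of 0] by simp
  have mg: "(\<lambda>x. g (h x)) \<in> borel_measurable torus" if "h \<in> borel_measurable torus" for h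
    by (rule measurable_compose[OF that borel_measurable_continuous_onI[OF cg]])
  have mu: "u \<in> borel_measurable torus" using iu by simp
  have "integrable torus (\<lambda>x. w x * g (u x))"
    by (rule integrable_mult_bounded[OF iw mg[OF mu]]) (rule B)
  then have L: "(\<lambda>x. G (u x)) \<in> L1" "(\<lambda>x. g (u x) * w x) \<in> L1"
    using per integrable_lipschitz_comp[OF G B iu] by (auto simp: L1_def periodic_def mult.commute)
  moreover have "(LINT x|torus. G (u x) * pd i \<phi> x) = - (LINT x|torus. g (u x) * w x * \<phi> x)"
    if \<phi>: "\<phi> \<in> test_functions" for \<phi>
  proof -
    have c\<phi>: "continuous_on UNIV \<phi>" "continuous_on UNIV (pd i \<phi>)"
      using \<phi> by (rule test_continuous test_pd_continuous)+
    obtain b0 where b0: "\<And>x. x \<in> cbox 0 1 \<Longrightarrow> \<bar>\<phi> x\<bar> \<le> b0" using continuous_bounded_torus[OF c\<phi>(1)] by blast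
    obtain b1 where b1: "\<And>x. x \<in> cbox 0 1 \<Longrightarrow> \<bar>pd i \<phi> x\<bar> \<le> b1" using continuous_bounded_torus[OF c\<phi>(2)] by blast
    obtain r :: "nat \<Rightarrow> nat" where r: "strict_mono r" "AE x in torus. (\<lambda>k. conv (bump (r k)) u x) \<longlonglongrightarrow> u x"
      using conv_bump_AE_subseq[OF iu] by blast
    define U where "U k = conv (bump (r k)) u" for k
    have tU: "trig (U k)" for k unfolding U_def by (rule conv_trig[OF trig_bump iu])
    note cU = trig_continuous[OF tU] and dU = trig_differentiable[OF tU]
    have pU: "pd i (U k) = conv (bump (r k)) w" for k
      unfolding U_def by (rule conv_weak_pd[OF w trig_bump])
    have GU: "integrable torus (\<lambda>x. G (U k x))" for k
      by (rule integrable_lipschitz_comp[OF G B trig_integrable[OF tU]])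
    have limU: "(\<lambda>k. LINT x|torus. \<bar>U k x - u x\<bar>) \<longlonglongrightarrow> 0"
      "(\<lambda>k. LINT x|torus. \<bar>pd i (U k) x - w x\<bar>) \<longlonglongrightarrow> 0"
      using LIMSEQ_subseq_LIMSEQ[OF conv_bump_tendsto[OF iu] r(1)]
        LIMSEQ_subseq_LIMSEQ[OF conv_bump_tendsto[OF iw] r(1)] by (simp_all add: o_def pU) (simp add: U_def)
    have parts: "(LINT x|torus. G (U k x) * pd i \<phi> x) = - (LINT x|torus. pd i (U k) x * (g (U k x) * \<phi> x))" for k
    proof -
      have c: "continuous_on UNIV (pd i (\<lambda>x. G (U k x)))"
        unfolding pd_compose(2)[OF dU G]
        by (intro continuous_on_mult continuous_comp[OF cg] cU trig_continuous trig_pd_trig tU)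
      have per: "periodic (\<lambda>x. G (U k x))" using trig_periodic[OF tU, of k] by (simp add: periodic_def)
      show ?thesis
        using integral_by_parts[OF pd_compose(1)[OF dU G] c per test_differentiable[OF \<phi>] c\<phi>(2) test_periodic[OF \<phi>]]
        by (simp add: pd_compose(2)[OF dU G] ac_simps)
    qed
    have "(\<lambda>k. LINT x|torus. G (U k x) * pd i \<phi> x) \<longlonglongrightarrow> (LINT x|torus. G (u x) * pd i \<phi> x)"
    proof (rule L1_tendsto_integral_mult[OF GU L1_integrable[OF L(1)] _ _ _ b1])
      show "(\<lambda>k. LINT x|torus. \<bar>G (U k x) - G (u x)\<bar>) \<longlonglongrightarrow> 0"
      proof (rule Lim_null_comparison)
        show "(\<lambda>k. B * (LINT x|torus. \<bar>U k x - u x\<bar>)) \<longlonglongrightarrow> 0"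
          using tendsto_mult[OF tendsto_const[of B] limU(1)] by simp
        have "(LINT x|torus. \<bar>G (U k x) - G (u x)\<bar>) \<le> (LINT x|torus. B * \<bar>U k x - u x\<bar>)" for k
          using GU L1_integrable[OF L(1)] trig_integrable[OF tU] iu
          by (intro integral_mono deriv_lipschitz[OF G B]) auto
        then show "\<forall>\<^sub>F k in sequentially. norm (LINT x|torus. \<bar>G (U k x) - G (u x)\<bar>) \<le>
            B * (LINT x|torus. \<bar>U k x - u x\<bar>)" by simp
      qed
    qed (use continuous_measurable_torus[OF c\<phi>(2)] in auto)
    moreover have "(\<lambda>k. LINT x|torus. pd i (U k) x * (g (U k x) * \<phi> x)) \<longlonglongrightarrow> (LINT x|torus. w x * (g (u x) * \<phi> x))"
    proof (rule L1_tendsto_integral_mult[OF trig_integrable[OF trig_pd_trig[OF tU]] iw limU(2)])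
      show "(\<lambda>x. g (U k x) * \<phi> x) \<in> borel_measurable torus" for k
        using trig_integrable[OF tU] by (intro borel_measurable_times mg continuous_measurable_torus[OF c\<phi>(1)]) auto
      show "(\<lambda>x. g (u x) * \<phi> x) \<in> borel_measurable torus"
        by (intro borel_measurable_times mg continuous_measurable_torus[OF c\<phi>(1)] mu)
      show "\<bar>g (U k x) * \<phi> x\<bar> \<le> B * b0" if "x \<in> cbox 0 1" for k x
        unfolding abs_mult using b0[OF that] B B0 by (intro mult_mono) auto
      show "AE x in torus. (\<lambda>k. g (U k x) * \<phi> x) \<longlonglongrightarrow> g (u x) * \<phi> x"
        using r(2)
      proof eventually_elim
        fix x assume "(\<lambda>k. conv (bump (r k)) u x) \<longlonglongrightarrow> u x"
        then have "(\<lambda>k. g (U k x)) \<longlonglongrightarrow> g (u x)"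
          unfolding U_def by (intro continuous_on_tendsto_compose[OF cg]) auto
        then show "(\<lambda>k. g (U k x) * \<phi> x) \<longlonglongrightarrow> g (u x) * \<phi> x" by (intro tendsto_intros)
      qed
    qed
    ultimately have "(LINT x|torus. G (u x) * pd i \<phi> x) = - (LINT x|torus. w x * (g (u x) * \<phi> x))"
      unfolding parts by (intro LIMSEQ_unique[OF _ tendsto_minus])
    then show ?thesis by (simp add: ac_simps)
  qed
  ultimately show ?thesis by (simp add: is_weak_pd_def)
qed

section \<open>The Cauchy-Schwarz inequality and the sup bound\<close>

text \<open>The elementary inequality between a product and two squares is integrated with a free
  scaling parameter \<open>t\<close>, over which one then optimises.\<close>

lemma integral_Cauchy_Schwarz:
  fixes a b :: "'a \<Rightarrow> real"
  assumes a: "integrable M (\<lambda>x. (a x)\<^sup>2)" and b: "integrable M (\<lambda>x. (b x)\<^sup>2)"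
    and m: "a \<in> borel_measurable M" "b \<in> borel_measurable M"
  shows "integrable M (\<lambda>x. a x * b x)"
    and "(LINT x|M. \<bar>a x * b x\<bar>) \<le> sqrt (LINT x|M. (a x)\<^sup>2) * sqrt (LINT x|M. (b x)\<^sup>2)"
proof -
  have young: "2 * \<bar>s * t\<bar> \<le> s\<^sup>2 + t\<^sup>2" for s t :: real
    using sum_squares_bound[of "\<bar>s\<bar>" "\<bar>t\<bar>"] by (simp add: abs_mult mult.assoc)
  show i: "integrable M (\<lambda>x. a x * b x)"
  proof (rule Bochner_Integration.integrable_bound)
    show "integrable M (\<lambda>x. (a x)\<^sup>2 + (b x)\<^sup>2)" using a b by simp
    show "AE x in M. norm (a x * b x) \<le> norm ((a x)\<^sup>2 + (b x)\<^sup>2)"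
      using young by (intro AE_I2) (smt (verit) real_norm_def)
  qed (use m in measurable)
  define A B P where "A = (LINT x|M. (a x)\<^sup>2)" and "B = (LINT x|M. (b x)\<^sup>2)" and "P = (LINT x|M. \<bar>a x * b x\<bar>)"
  have nn: "A \<ge> 0" "B \<ge> 0" "P \<ge> 0" by (auto simp: A_def B_def P_def)
  have le: "2 * t * P \<le> t\<^sup>2 * A + B" if "t \<ge> 0" for t
  proof -
    have "2 * t * P = (LINT x|M. 2 * \<bar>t * a x * b x\<bar>)"
      using that by (simp add: P_def abs_mult mult.assoc)
    also have "\<dots> \<le> (LINT x|M. t\<^sup>2 * (a x)\<^sup>2 + (b x)\<^sup>2)"
      using a b integrable_mult_right[OF i, of t] young[of "t * a _"]
      by (intro integral_mono) (auto simp: mult.assoc power_mult_distrib)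
    also have "\<dots> = t\<^sup>2 * A + B" using a b by (simp add: A_def B_def)
    finally show ?thesis .
  qed
  have "P\<^sup>2 \<le> A * B"
  proof (cases "A = 0")
    \<comment> \<open>Here \<open>le\<close> bounds a multiple of \<open>P\<close> that grows
      linearly in \<open>t\<close> by the constant \<open>B\<close>, so a large \<open>t\<close>
      forces \<open>P\<close> to be zero.\<close>
    case True
    have "P = 0"
    proof (rule ccontr)
      assume "P \<noteq> 0"
      then have "2 * ((B + 1) / P) * P \<le> B" using le[of "(B + 1) / P"] nn True by auto
      then show False using \<open>P \<noteq> 0\<close> nn by simp
    qed
    then show ?thesis using nn by simp
  next
    case False
    \<comment> \<open>The optimal value of the parameter is \<open>P / A\<close>.\<close>
    then have "2 * (P / A) * P \<le> (P / A)\<^sup>2 * A + B" using le[of "P / A"] nn by simp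
    then show ?thesis using False nn by (simp add: power2_eq_square field_simps)
  qed
  then show "P \<le> sqrt A * sqrt B" using nn by (metis real_le_rsqrt real_sqrt_mult)
qed

lemma torus_L1_le_L2:
  assumes "v \<in> borel_measurable torus" "integrable torus (\<lambda>x. (v x)\<^sup>2)"
  shows "(LINT x|torus. \<bar>v x\<bar>) \<le> sqrt (LINT x|torus. (v x)\<^sup>2)"
  using integral_Cauchy_Schwarz(2)[of torus v "\<lambda>x. 1"] assms trig_integrable[OF trig_const] by simp

text \<open>The Hilbert norm of a class evaluated on a representative, so that all estimates can be
  made for functions; see \<open>norm_H2_rep\<close>.\<close>

definition H2_norm :: "(real^2 \<Rightarrow> real) \<Rightarrow> real" where
  "H2_norm u = sqrt (H2_inner u u)"

lemma H2_norm_nonneg: "0 \<le> H2_norm u"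
  by (simp add: H2_norm_def H2_inner_nonneg)

lemma H2_norm_square: "(H2_norm u)\<^sup>2 = H2_inner u u"
  by (simp add: H2_norm_def H2_inner_nonneg)

lemma H2_inner_bounds:
  shows "(LINT x|torus. (u x)\<^sup>2) \<le> (H2_norm u)\<^sup>2"
    and "(LINT x|torus. (wpd i u x)\<^sup>2) \<le> (H2_norm u)\<^sup>2"
    and "(LINT x|torus. (wpd j (wpd i u) x)\<^sup>2) \<le> (H2_norm u)\<^sup>2"
proof -
  have nn: "0 \<le> (LINT x|torus. h x * h x)" for h :: "real^2 \<Rightarrow> real"
    by (rule Bochner_Integration.integral_nonneg) simp
  have 1: "(LINT x|torus. wpd i u x * wpd i u x) \<le> (\<Sum>i\<in>UNIV. LINT x|torus. wpd i u x * wpd i u x)"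
    by (rule member_le_sum) (auto intro: nn)
  have "(LINT x|torus. wpd j (wpd i u) x * wpd j (wpd i u) x) \<le>
      (\<Sum>j\<in>UNIV. LINT x|torus. wpd j (wpd i u) x * wpd j (wpd i u) x)"
    by (rule member_le_sum) (auto intro: nn)
  also have "\<dots> \<le> (\<Sum>i\<in>UNIV. \<Sum>j\<in>UNIV. LINT x|torus. wpd j (wpd i u) x * wpd j (wpd i u) x)"
    by (rule member_le_sum[of i UNIV "\<lambda>i. \<Sum>j\<in>UNIV. LINT x|torus. wpd j (wpd i u) x * wpd j (wpd i u) x"])
      (auto intro!: sum_nonneg nn)
  finally have 2: "(LINT x|torus. wpd j (wpd i u) x * wpd j (wpd i u) x) \<le> \<dots>" .
  have 0: "0 \<le> (\<Sum>i\<in>UNIV. LINT x|torus. wpd i u x * wpd i u x)"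
    "0 \<le> (\<Sum>i\<in>UNIV. \<Sum>j\<in>UNIV. LINT x|torus. wpd j (wpd i u) x * wpd j (wpd i u) x)"
    by (intro sum_nonneg nn)+
  show "(LINT x|torus. (u x)\<^sup>2) \<le> (H2_norm u)\<^sup>2"
    "(LINT x|torus. (wpd i u x)\<^sup>2) \<le> (H2_norm u)\<^sup>2"
    "(LINT x|torus. (wpd j (wpd i u) x)\<^sup>2) \<le> (H2_norm u)\<^sup>2"
    using 0 1 2 nn[of u] unfolding H2_norm_square unfolding H2_inner_def power2_eq_square by linarith+
qed

lemma H2_L1_bounds:
  assumes "u \<in> H2_fun"
  shows "(LINT x|torus. \<bar>u x\<bar>) \<le> H2_norm u"
    and "(LINT x|torus. \<bar>wpd i u x\<bar>) \<le> H2_norm u"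
    and "(LINT x|torus. \<bar>wpd j (wpd i u) x\<bar>) \<le> H2_norm u"
proof -
  have *: "(LINT x|torus. \<bar>v x\<bar>) \<le> H2_norm u"
    if "v \<in> L2" "(LINT x|torus. (v x)\<^sup>2) \<le> (H2_norm u)\<^sup>2" for v
    using torus_L1_le_L2[of v] that real_le_lsqrt[OF H2_norm_nonneg that(2)] by (simp add: L2_def)
  show "(LINT x|torus. \<bar>u x\<bar>) \<le> H2_norm u" "(LINT x|torus. \<bar>wpd i u x\<bar>) \<le> H2_norm u"
    "(LINT x|torus. \<bar>wpd j (wpd i u) x\<bar>) \<le> H2_norm u"
    using assms by (auto intro!: * H2_inner_bounds simp: H2_fun_iff)
qed

text \<open>The derivatives of a mollification are mollifications of the weak derivatives, so
  \<open>sobolev_sup_bound\<close> and the contraction property bound all mollifications uniformly.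
  An almost everywhere convergent subsequence transfers the bound; the 4 counts the four terms of
  the Sobolev inequality.\<close>

theorem H2_sup_bound:
  assumes u: "u \<in> H2_fun"
  shows "AE x in torus. \<bar>u x\<bar> \<le> 4 * H2_norm u"
proof -
  have wp: "is_weak_pd i u (wpd i u)" "is_weak_pd j (wpd i u) (wpd j (wpd i u))" for i j
    using u by (auto simp: H2_fun_iff)
  have int: "integrable torus u" "integrable torus (wpd i u)" "integrable torus (wpd j (wpd i u))" for i j
    using u by (auto simp: H2_fun_iff intro!: L1_integrable L2_L1)
  have bd: "\<bar>conv (bump k) u x\<bar> \<le> 4 * H2_norm u" if x: "x \<in> cbox 0 1" for k x
  proof -
    let ?w = "conv (bump k) u"
    have t: "trig ?w" by (rule conv_trig[OF trig_bump int(1)])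
    have p: "pd i ?w = conv (bump k) (wpd i u)"
      "pd j (pd i ?w) = conv (bump k) (wpd j (wpd i u))" for i j
      by (simp_all add: conv_weak_pd[OF wp(1) trig_bump] conv_weak_pd[OF wp(2) trig_bump])
    have "\<bar>?w x\<bar> \<le> (LINT x|torus. \<bar>?w x\<bar> + \<bar>pd 1 ?w x\<bar> + \<bar>pd 2 ?w x\<bar> + \<bar>pd 2 (pd 1 ?w) x\<bar>)"
      using t x by (intro sobolev_sup_bound) (auto intro: trig_differentiable trig_continuous trig_pd_trig)
    also have "\<dots> = (LINT x|torus. \<bar>?w x\<bar>) + (LINT x|torus. \<bar>pd 1 ?w x\<bar>) + (LINT x|torus. \<bar>pd 2 ?w x\<bar>)
        + (LINT x|torus. \<bar>pd 2 (pd 1 ?w) x\<bar>)"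
      using t by (simp add: trig_integrable trig_pd_trig)
    also have "\<dots> \<le> H2_norm u + H2_norm u + H2_norm u + H2_norm u"
      unfolding p(2) unfolding p(1) by (intro add_mono order.trans[OF conv_bump_contraction] int H2_L1_bounds u)
    finally show ?thesis by simp
  qed
  obtain r :: "nat \<Rightarrow> nat" where "AE x in torus. (\<lambda>k. conv (bump (r k)) u x) \<longlonglongrightarrow> u x"
    using conv_bump_AE_subseq[OF int(1)] by blast
  then show ?thesis
  proof (rule AE_mp[OF _ AE_I2], intro impI)
    fix x assume x: "x \<in> space torus" and l: "(\<lambda>k. conv (bump (r k)) u x) \<longlonglongrightarrow> u x"
    show "\<bar>u x\<bar> \<le> 4 * H2_norm u"
      by (rule LIMSEQ_le_const2[OF tendsto_rabs[OF l]]) (use bd x in auto)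
  qed
qed

section \<open>Regularity of the vortex potential\<close>

text \<open>Fatou's lemma as a criterion: integrability of the limit is part of the conclusion,
  although no convergence of integrals is known.\<close>

lemma fatou_real:
  fixes h :: "nat \<Rightarrow> 'a \<Rightarrow> real"
  assumes h: "\<And>n. integrable M (h n)" "\<And>n x. 0 \<le> h n x" and m: "h' \<in> borel_measurable M"
    and ae: "AE x in M. (\<lambda>n. h n x) \<longlonglongrightarrow> h' x"
    and bd: "\<forall>\<^sub>F n in sequentially. (LINT x|M. h n x) \<le> C"
  shows "integrable M h'" "(LINT x|M. h' x) \<le> C"
proof -
  have C: "C \<ge> 0"
  proof -
    obtain n where "(LINT x|M. h n x) \<le> C" using bd by (auto simp: eventually_sequentially)
    moreover have "0 \<le> (LINT x|M. h n x)" by (simp add: h)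
    ultimately show ?thesis by linarith
  qed
  have nn: "AE x in M. 0 \<le> h' x"
    using ae by eventually_elim (rule LIMSEQ_le_const, auto simp: h)
  have "(\<integral>\<^sup>+x. ennreal (h' x) \<partial>M) = (\<integral>\<^sup>+x. liminf (\<lambda>n. ennreal (h n x)) \<partial>M)"
  proof (rule nn_integral_cong_AE)
    show "AE x in M. ennreal (h' x) = liminf (\<lambda>n. ennreal (h n x))"
      using ae by eventually_elim (metis lim_imp_Liminf sequentially_bot tendsto_ennrealI)
  qed
  also have "\<dots> \<le> liminf (\<lambda>n. \<integral>\<^sup>+x. ennreal (h n x) \<partial>M)"
    by (intro nn_integral_liminf measurable_compose[OF _ measurable_ennreal] borel_measurable_integrable h)
  also have "\<dots> \<le> ennreal C"
  proof -
    have "\<forall>\<^sub>F n in sequentially. (\<integral>\<^sup>+x. ennreal (h n x) \<partial>M) \<le> ennreal C"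
      using bd by eventually_elim (simp add: nn_integral_eq_integral h ennreal_leI)
    then have "liminf (\<lambda>n. \<integral>\<^sup>+x. ennreal (h n x) \<partial>M) \<le> liminf (\<lambda>n. ennreal C)"
      by (rule Liminf_mono)
    then show ?thesis by (simp add: Liminf_const)
  qed
  finally have le: "(\<integral>\<^sup>+x. ennreal (h' x) \<partial>M) \<le> ennreal C" .
  show i: "integrable M h'"
    using le nn m by (intro integrableI_nonneg) (auto simp: le_less_trans)
  show "(LINT x|M. h' x) \<le> C"
    using le C by (simp add: nn_integral_eq_integral[OF i nn])
qed

text \<open>The Riesz-Fischer argument for functions instead of classes: a rapidly Cauchy
  subsequence is written as a telescoping series that converges absolutely almost
  everywhere.\<close>

lemma L1_complete:
  fixes g :: "nat \<Rightarrow> real^2 \<Rightarrow> real"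
  assumes g: "\<And>n. integrable torus (g n)" "\<And>n. periodic (g n)"
    and cauchy: "\<And>e. e > 0 \<Longrightarrow> \<exists>N. \<forall>k\<ge>N. \<forall>l\<ge>N. (LINT x|torus. \<bar>g k x - g l x\<bar>) \<le> e"
  obtains g' where "g' \<in> L1" "(\<lambda>n. LINT x|torus. \<bar>g n x - g' x\<bar>) \<longlonglongrightarrow> 0"
proof -
  have "\<exists>N. \<forall>n. \<forall>k\<ge>N n. \<forall>l\<ge>N n. (LINT x|torus. \<bar>g k x - g l x\<bar>) \<le> (1/2)^n"
    by (rule choice) (use cauchy in simp)
  then obtain N where N: "\<And>n k l. N n \<le> k \<Longrightarrow> N n \<le> l \<Longrightarrow> (LINT x|torus. \<bar>g k x - g l x\<bar>) \<le> (1/2)^n" by blast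
  \<comment> \<open>Nondecreasing, at least \<open>N n\<close> for the rapid Cauchy estimate, and at
    least \<open>n\<close> so that it eventually passes any index.\<close>
  define r where "r n = n + (\<Sum>i\<le>n. N i)" for n
  have rN: "N n \<le> r n" for n
    unfolding r_def using member_le_sum[of n "{..n}" N] by (simp add: trans_le_add2)
  have rS: "r n \<le> r (Suc n)" for n by (simp add: r_def)
  define f where "f n x = g (r (Suc n)) x - g (r n) x" for n x
  have fi: "integrable torus (f n)" for n unfolding f_def[abs_def] using g by simp
  have "(LINT x|torus. \<bar>f n x\<bar>) \<le> (1/2)^n" for n
    unfolding f_def by (rule N) (use rN[of n] rS[of n] in auto)
  then have fb: "(\<integral>\<^sup>+x. ennreal \<bar>f n x\<bar> \<partial>torus) \<le> ennreal ((1/2)^n)" for n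
    using fi by (simp add: nn_integral_eq_integral ennreal_leI)
  have "(\<integral>\<^sup>+x. (\<Sum>n. ennreal \<bar>f n x\<bar>) \<partial>torus) = (\<Sum>n. \<integral>\<^sup>+x. ennreal \<bar>f n x\<bar> \<partial>torus)"
    using borel_measurable_integrable[OF fi] by (intro nn_integral_suminf) measurable
  also have "\<dots> \<le> (\<Sum>n. ennreal ((1/2)^n))" by (intro suminf_le fb) auto
  also have "\<dots> < top"
  proof -
    have "(\<Sum>n. ennreal ((1/2)^n)) = ennreal (\<Sum>n. (1/2)^n)"
      by (rule suminf_ennreal2) (auto intro: summable_geometric)
    then show ?thesis by (simp only: ennreal_less_top)
  qed
  finally have fin: "(\<integral>\<^sup>+x. (\<Sum>n. ennreal \<bar>f n x\<bar>) \<partial>torus) \<noteq> \<infinity>" by simp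
  have "AE x in torus. (\<Sum>n. ennreal \<bar>f n x\<bar>) \<noteq> \<infinity>"
    using borel_measurable_integrable[OF fi] by (intro nn_integral_PInf_AE fin) measurable
  then have sm: "AE x in torus. summable (\<lambda>n. f n x)"
  proof eventually_elim
    fix x assume "(\<Sum>n. ennreal \<bar>f n x\<bar>) \<noteq> \<infinity>"
    then have "summable (\<lambda>n. \<bar>f n x\<bar>)" by (intro summable_suminf_not_top) auto
    then show "summable (\<lambda>n. f n x)" by (rule summable_rabs_cancel)
  qed
  \<comment> \<open>The formula is used at every point, also where the series diverges and has an
    unspecified value. That value depends only on the terms, so periodicity is inherited
    exactly.\<close>
  define g' where "g' x = g (r 0) x + (\<Sum>n. f n x)" for x
  have per: "periodic g'" using g(2) by (simp add: periodic_def g'_def f_def)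
  have mg': "g' \<in> borel_measurable torus"
    unfolding g'_def by (intro borel_measurable_add borel_measurable_suminf borel_measurable_integrable fi g)
  have lim: "AE x in torus. (\<lambda>n. g (r n) x) \<longlonglongrightarrow> g' x"
    using sm
  proof eventually_elim
    fix x assume "summable (\<lambda>n. f n x)"
    then have "(\<lambda>n. g (r 0) x + (\<Sum>i<n. f i x)) \<longlonglongrightarrow> g' x"
      unfolding g'_def by (intro tendsto_intros summable_LIMSEQ)
    moreover have "g (r 0) x + (\<Sum>i<n. f i x) = g (r n) x" for n
      by (induction n) (auto simp: f_def)
    ultimately show "(\<lambda>n. g (r n) x) \<longlonglongrightarrow> g' x" by simp
  qed
  \<comment> \<open>Letting one index run to infinity along the subsequence, Fatou preserves the
    Cauchy bound. This yields convergence of the whole sequence.\<close>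
  have close: "integrable torus (\<lambda>x. \<bar>g k x - g' x\<bar>) \<and> (LINT x|torus. \<bar>g k x - g' x\<bar>) \<le> e"
    if "\<forall>k\<ge>K. \<forall>l\<ge>K. (LINT x|torus. \<bar>g k x - g l x\<bar>) \<le> e" "k \<ge> K" for k K e
  proof (intro conjI)
    have ev: "\<forall>\<^sub>F n in sequentially. (LINT x|torus. \<bar>g k x - g (r n) x\<bar>) \<le> e"
    proof -
      have "r n \<ge> K" if "n \<ge> K" for n using that by (simp add: r_def trans_le_add1)
      then show ?thesis using that unfolding eventually_sequentially by blast
    qed
    have ae: "AE x in torus. (\<lambda>n. \<bar>g k x - g (r n) x\<bar>) \<longlonglongrightarrow> \<bar>g k x - g' x\<bar>"
      using lim by eventually_elim (intro tendsto_intros)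
    have m: "(\<lambda>x. \<bar>g k x - g' x\<bar>) \<in> borel_measurable torus"
      using mg' g(1)[of k] by measurable
    show "integrable torus (\<lambda>x. \<bar>g k x - g' x\<bar>)" "(LINT x|torus. \<bar>g k x - g' x\<bar>) \<le> e"
      by (rule fatou_real[OF _ _ m ae ev]; use g in simp)+
  qed
  have "integrable torus g'"
  proof -
    obtain K where "\<forall>k\<ge>K. \<forall>l\<ge>K. (LINT x|torus. \<bar>g k x - g l x\<bar>) \<le> 1" using cauchy[of 1] by auto
    then have "integrable torus (\<lambda>x. \<bar>g K x - g' x\<bar>)" using close by blast
    then have "integrable torus (\<lambda>x. g K x - g' x)"
      by (rule integrable_abs_cancel) (use mg' g(1)[of K] in measurable)
    from Bochner_Integration.integrable_diff[OF g(1)[of K] this]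
    have "integrable torus (\<lambda>x. g K x - (g K x - g' x))" .
    moreover have "(\<lambda>x. g K x - (g K x - g' x)) = g'" by auto
    ultimately show ?thesis by (simp only:)
  qed
  moreover have "(\<lambda>n. LINT x|torus. \<bar>g n x - g' x\<bar>) \<longlonglongrightarrow> 0"
  proof (rule LIMSEQ_I)
    fix e :: real assume "0 < e"
    then obtain K where "\<forall>k\<ge>K. \<forall>l\<ge>K. (LINT x|torus. \<bar>g k x - g l x\<bar>) \<le> e / 2" using cauchy[of "e / 2"] by auto
    then have "(LINT x|torus. \<bar>g k x - g' x\<bar>) \<le> e / 2" if "k \<ge> K" for k using close that by blast
    then have "norm ((LINT x|torus. \<bar>g k x - g' x\<bar>) - 0) < e" if "k \<ge> K" for k
      using that \<open>0 < e\<close> by fastforce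
    then show "\<exists>K. \<forall>k\<ge>K. norm ((LINT x|torus. \<bar>g k x - g' x\<bar>) - 0) < e" by blast
  qed
  ultimately show ?thesis using that per by (simp add: L1_def)
qed

section \<open>Estimates from a bound on the Laplacian in the mean\<close>

definition laplace :: "(real^2 \<Rightarrow> real) \<Rightarrow> real^2 \<Rightarrow> real" where
  "laplace w x = (\<Sum>i\<in>UNIV. pd i (pd i w) x)"

lemma trig_laplace: "trig w \<Longrightarrow> trig (laplace w)"
  unfolding laplace_def[abs_def] by (intro trig_sum trig_pd_trig) auto

lemma pd_trig_diff:
  assumes "trig u" "trig v"
  shows "pd i (\<lambda>x. u x - v x) = (\<lambda>x. pd i u x - pd i v x)"
proof -
  have "pd i (\<lambda>x. u x + (-1) * v x) = (\<lambda>x. pd i u x + pd i (\<lambda>x. (-1) * v x) x)"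
    by (intro pd_add trig_differentiable assms trig_mult trig_const)
  then show ?thesis by (simp add: pd_cmult[OF trig_differentiable[OF assms(2)], of i "-1", simplified])
qed

lemma laplace_diff:
  assumes "trig u" "trig v"
  shows "laplace (\<lambda>x. u x - v x) x = laplace u x - laplace v x"
  using assms by (simp add: laplace_def pd_trig_diff trig_pd_trig sum_subtractf)

text \<open>Testing \<open>- \<Delta>w\<close> with the bounded function \<open>\<delta> arctan (w / \<delta>)\<close>.\<close>

lemma truncated_energy:
  assumes w: "trig w" and \<delta>: "\<delta> > 0" and L: "(LINT x|torus. \<bar>laplace w x\<bar>) \<le> L"
  shows "(LINT x|torus. (pd i w x)\<^sup>2 / (1 + (w x / \<delta>)\<^sup>2)) \<le> 2 * \<delta> * L"
proof -
  let ?\<tau> = "\<lambda>s. 1 / (1 + (s / \<delta>)\<^sup>2)" and ?T = "\<lambda>s. \<delta> * arctan (s / \<delta>)"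
  have pos: "1 + s\<^sup>2 > 0" "1 + s\<^sup>2 \<noteq> 0" for s :: real
    using zero_le_power2[of s] by (linarith, simp add: add_nonneg_eq_0_iff)
  have T: "(?T has_real_derivative ?\<tau> s) (at s)" for s
    using \<delta> by (auto intro!: derivative_eq_intros simp: inverse_eq_divide)
  have c\<tau>: "continuous_on UNIV ?\<tau>" by (intro continuous_intros) (use pos \<delta> in auto)
  have cT: "continuous_on UNIV ?T" by (rule deriv_continuous[OF T])
  have cw: "continuous_on UNIV w" and dw: "w differentiable_on UNIV"
    using w by (rule trig_continuous trig_differentiable)+
  have c1: "continuous_on UNIV (\<lambda>x. ?\<tau> (w x) * (pd j w x)\<^sup>2)" for j
    by (intro continuous_intros continuous_comp[OF c\<tau> cw] trig_continuous trig_pd_trig w)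
  have c2: "continuous_on UNIV (\<lambda>x. ?T (w x) * pd j (pd j w) x)" for j
    by (intro continuous_on_mult continuous_comp[OF cT cw] trig_continuous trig_pd_trig w)
  note i1 = integrable_torus_continuous[OF c1] and i2 = integrable_torus_continuous[OF c2]
  have parts: "(LINT x|torus. ?\<tau> (w x) * (pd j w x)\<^sup>2) = - (LINT x|torus. ?T (w x) * pd j (pd j w) x)" for j
  proof -
    have c: "continuous_on UNIV (pd j (\<lambda>x. ?T (w x)))"
      unfolding pd_compose(2)[OF dw T]
      by (intro continuous_on_mult continuous_comp[OF c\<tau> cw] trig_continuous trig_pd_trig w)
    have per: "periodic (\<lambda>x. ?T (w x))" using trig_periodic[OF w] by (simp add: periodic_def)
    note tj = trig_pd_trig[OF w, of j]
    show ?thesis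
      using integral_by_parts[OF pd_compose(1)[OF dw T] c per trig_differentiable[OF tj]
          trig_continuous[OF trig_pd_trig[OF tj]] trig_periodic[OF tj]]
      by (simp add: pd_compose(2)[OF dw T] power2_eq_square)
  qed
  have "(LINT x|torus. (pd i w x)\<^sup>2 / (1 + (w x / \<delta>)\<^sup>2)) = (LINT x|torus. ?\<tau> (w x) * (pd i w x)\<^sup>2)"
    by simp
  also have "\<dots> \<le> (\<Sum>j\<in>UNIV. LINT x|torus. ?\<tau> (w x) * (pd j w x)\<^sup>2)"
    by (rule member_le_sum[of i UNIV "\<lambda>j. LINT x|torus. ?\<tau> (w x) * (pd j w x)\<^sup>2"])
      (auto intro!: Bochner_Integration.integral_nonneg divide_nonneg_pos pos)
  also have "\<dots> = - (LINT x|torus. ?T (w x) * laplace w x)"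
    unfolding parts laplace_def sum_distrib_left using i2
    by (simp add: Bochner_Integration.integral_sum sum_negf)
  also have "\<dots> \<le> \<bar>LINT x|torus. ?T (w x) * laplace w x\<bar>" by simp
  also have "\<dots> \<le> (LINT x|torus. \<bar>?T (w x) * laplace w x\<bar>)" by (rule integral_abs_bound)
  also have "\<dots> \<le> (LINT x|torus. 2 * \<delta> * \<bar>laplace w x\<bar>)"
  proof (rule integral_mono)
    have "continuous_on UNIV (\<lambda>x. ?T (w x) * laplace w x)"
      by (intro continuous_on_mult continuous_comp[OF cT cw] trig_continuous trig_laplace w)
    then show "integrable torus (\<lambda>x. \<bar>?T (w x) * laplace w x\<bar>)"
      by (intro integrable_abs integrable_torus_continuous)
    show "integrable torus (\<lambda>x. 2 * \<delta> * \<bar>laplace w x\<bar>)"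
      using trig_integrable[OF trig_laplace[OF w]] by simp
    fix x
    \<comment> \<open>The crude bound 2 in place of half of pi is the origin of the factor
      \<open>2 * \<delta>\<close>.\<close>
    have "\<bar>arctan (w x / \<delta>)\<bar> \<le> 2"
    proof -
      have "pi / 2 < 2" using pi_less_4 by simp
      then show ?thesis using arctan_bounded[of "w x / \<delta>"] by linarith
    qed
    then have "\<delta> * \<bar>arctan (w x / \<delta>)\<bar> * \<bar>laplace w x\<bar> \<le> \<delta> * 2 * \<bar>laplace w x\<bar>"
      using \<delta> by (intro mult_right_mono mult_left_mono) auto
    then show "\<bar>?T (w x) * laplace w x\<bar> \<le> 2 * \<delta> * \<bar>laplace w x\<bar>"
      using \<delta> by (simp add: abs_mult)
  qed
  also have "\<dots> \<le> 2 * \<delta> * L" using L \<delta> by simp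
  finally show ?thesis .
qed

text \<open>Cauchy-Schwarz after dividing the derivative and multiplying \<open>h\<close> by the
  square root of \<open>1 + (w x / \<delta>)\<^sup>2\<close>: the first factor is the truncated
  energy. The free parameter \<open>\<delta>\<close> weighs the two parts of the second factor
  against each other.\<close>

lemma weighted_gradient_bound:
  assumes w: "trig w" and \<delta>: "\<delta> > 0" and L: "(LINT x|torus. \<bar>laplace w x\<bar>) \<le> L"
    and h: "continuous_on UNIV h"
  shows "(LINT x|torus. \<bar>h x * pd i w x\<bar>)\<^sup>2 \<le> 2 * \<delta> * L * (LINT x|torus. (h x)\<^sup>2 * (1 + (w x / \<delta>)\<^sup>2))"
proof -
  let ?q = "\<lambda>x. sqrt (1 + (w x / \<delta>)\<^sup>2)"
  let ?a = "\<lambda>x. pd i w x / ?q x" and ?b = "\<lambda>x. h x * ?q x"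
  have pos: "1 + s\<^sup>2 > 0" for s :: real
    using zero_le_power2[of s] by linarith
  have q: "?q x > 0" "(?q x)\<^sup>2 = 1 + (w x / \<delta>)\<^sup>2" for x using pos[of "w x / \<delta>"] by auto
  have q0: "?q x \<noteq> 0" for x using q(1)[of x] by linarith
  have ca: "continuous_on UNIV ?a"
    by (intro continuous_on_divide continuous_intros trig_continuous trig_pd_trig w) (use q0 \<delta> in auto)
  have cb: "continuous_on UNIV ?b" 
    by (intro continuous_intros trig_continuous w h) (use \<delta> in auto)
  have "(LINT x|torus. \<bar>?a x * ?b x\<bar>) \<le> sqrt (LINT x|torus. (?a x)\<^sup>2) * sqrt (LINT x|torus. (?b x)\<^sup>2)"
    by (intro integral_Cauchy_Schwarz(2) integrable_torus_continuous continuous_on_power ca cb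
        continuous_measurable_torus)
  moreover have "?a x * ?b x = h x * pd i w x" for x using q0[of x] by simp
  ultimately have "(LINT x|torus. \<bar>h x * pd i w x\<bar>)\<^sup>2 \<le>
      (sqrt (LINT x|torus. (?a x)\<^sup>2) * sqrt (LINT x|torus. (?b x)\<^sup>2))\<^sup>2"
    by (intro power_mono) auto
  also have "\<dots> = (LINT x|torus. (?a x)\<^sup>2) * (LINT x|torus. (?b x)\<^sup>2)"
    by (simp add: power_mult_distrib)
  also have "\<dots> \<le> (2 * \<delta> * L) * (LINT x|torus. (?b x)\<^sup>2)"
    using truncated_energy[OF w \<delta> L, of i] by (intro mult_right_mono) (auto simp: power_divide q(2))
  finally show ?thesis by (simp add: power_mult_distrib q(2))
qed

text \<open>The product of norms is turned into a sum of squares, so that a multiple of the left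
  side hidden in \<open>X\<close> can be absorbed.\<close>

lemma gagliardo_nirenberg':
  assumes w: "w differentiable_on UNIV" "\<And>i. continuous_on UNIV (pd i w)"
    and X: "\<And>i. (LINT x|torus. \<bar>pd i w x\<bar>)\<^sup>2 \<le> X"
  shows "(LINT x|torus. (w x)\<^sup>2) \<le> 2 * (LINT x|torus. \<bar>w x\<bar>)\<^sup>2 + 2 * X"
proof -
  have cw: "continuous_on UNIV w" using w(1) by (rule differentiable_imp_continuous_on)
  define M where "M = (LINT x|torus. \<bar>w x\<bar>)"
  define d where "d i = (LINT x|torus. \<bar>pd i w x\<bar>)" for i
  have "(LINT x|torus. (w x)\<^sup>2) \<le> (M + d 1) * (M + d 2)"
    using gagliardo_nirenberg[OF w] integrable_torus_continuous[OF cw] integrable_torus_continuous[OF w(2)]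
    by (simp add: M_def d_def)
  also have "\<dots> \<le> 2 * M\<^sup>2 + (d 1)\<^sup>2 + (d 2)\<^sup>2"
  proof -
    have "0 \<le> (M - d 1)\<^sup>2 + (M - d 2)\<^sup>2 + (d 1 - d 2)\<^sup>2" by simp
    then have "2 * ((M + d 1) * (M + d 2)) \<le> 2 * (2 * M\<^sup>2 + (d 1)\<^sup>2 + (d 2)\<^sup>2)"
      by (simp add: power2_eq_square algebra_simps)
    then show ?thesis by simp
  qed
  also have "\<dots> \<le> 2 * M\<^sup>2 + 2 * X" using X[of 1] X[of 2] by (simp add: d_def)
  finally show ?thesis by (simp add: M_def)
qed

text \<open>With the parameter \<open>8 * L\<close> the gradient estimate returns only a quarter of
  the square integral \<open>S\<close>. After the inequality of Gagliardo and Nirenberg this is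
  \<open>S / 2\<close>, which the left side absorbs.\<close>

lemma trig_L2_bound:
  assumes w: "trig w" and L: "(LINT x|torus. \<bar>laplace w x\<bar>) \<le> L" "L > 0"
  shows "(LINT x|torus. (w x)\<^sup>2) \<le> 4 * (LINT x|torus. \<bar>w x\<bar>)\<^sup>2 + 64 * L\<^sup>2"
proof -
  define S where "S = (LINT x|torus. (w x)\<^sup>2)"
  have \<delta>: "8 * L > 0" using L by simp
  have "(LINT x|torus. \<bar>pd i w x\<bar>)\<^sup>2 \<le> 16 * L\<^sup>2 + S / 4" for i
  proof -
    have "(LINT x|torus. \<bar>1 * pd i w x\<bar>)\<^sup>2 \<le> 2 * (8 * L) * L * (LINT x|torus. 1\<^sup>2 * (1 + (w x / (8 * L))\<^sup>2))"
      by (rule weighted_gradient_bound[OF w \<delta> L(1)]) (rule continuous_on_const)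
    also have "(LINT x|torus. 1\<^sup>2 * (1 + (w x / (8 * L))\<^sup>2)) = 1 + S / (64 * L\<^sup>2)"
      using trig_integrable[OF trig_power[OF w]] trig_integrable[OF trig_const]
      by (simp add: power_divide power_mult_distrib S_def)
    also have "2 * (8 * L) * L * (1 + S / (64 * L\<^sup>2)) = 16 * L\<^sup>2 + S / 4"
      using L(2) by (simp add: field_simps power2_eq_square)
    finally show ?thesis by simp
  qed
  from gagliardo_nirenberg'[OF trig_differentiable[OF w] trig_continuous[OF trig_pd_trig[OF w]] this]
  have "S \<le> 2 * (LINT x|torus. \<bar>w x\<bar>)\<^sup>2 + 2 * (16 * L\<^sup>2 + S / 4)" by (simp add: S_def)
  then show ?thesis by (simp add: S_def)
qed

text \<open>The same absorption for the square of \<open>w\<close>. Its derivative brings the factor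
  \<open>2 * w x\<close>, so the parameter has to be \<open>32 * L\<close> for a quarter of the
  fourth power integral to return.\<close>

lemma trig_L4_bound:
  assumes w: "trig w" and L: "(LINT x|torus. \<bar>laplace w x\<bar>) \<le> L" "L > 0"
  shows "(LINT x|torus. (w x)^4) \<le> 4 * (LINT x|torus. (w x)\<^sup>2)\<^sup>2 + 1024 * L\<^sup>2 * (LINT x|torus. (w x)\<^sup>2)"
proof -
  define S where "S = (LINT x|torus. (w x)\<^sup>2)"
  define Y where "Y = (LINT x|torus. (w x)^4)"
  have \<delta>: "32 * L > 0" using L by simp
  have p: "pd i (\<lambda>x. (w x)\<^sup>2) = (\<lambda>x. 2 * w x * pd i w x)" for i
    unfolding power2_eq_square by (subst pd_mult) (auto simp: trig_differentiable w)
  have t: "trig (\<lambda>x. (w x)\<^sup>2)" by (rule trig_power[OF w])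
  have "(LINT x|torus. \<bar>pd i (\<lambda>x. (w x)\<^sup>2) x\<bar>)\<^sup>2 \<le> 256 * L\<^sup>2 * S + Y / 4" for i
  proof -
    have "(LINT x|torus. \<bar>2 * w x * pd i w x\<bar>)\<^sup>2 \<le>
        2 * (32 * L) * L * (LINT x|torus. (2 * w x)\<^sup>2 * (1 + (w x / (32 * L))\<^sup>2))"
      by (rule weighted_gradient_bound[OF w \<delta> L(1)]) (intro continuous_intros trig_continuous w)
    also have "(LINT x|torus. (2 * w x)\<^sup>2 * (1 + (w x / (32 * L))\<^sup>2)) =
        (LINT x|torus. 4 * (w x)\<^sup>2 + (w x)^4 / (256 * L\<^sup>2))"
      by (intro Bochner_Integration.integral_cong refl)
        (simp add: power_divide power_mult_distrib distrib_left power2_eq_square power4_eq_xxxx)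
    also have "\<dots> = 4 * S + Y / (256 * L\<^sup>2)"
      using trig_integrable[OF trig_power[OF w]] by (simp add: S_def Y_def)
    also have "2 * (32 * L) * L * (4 * S + Y / (256 * L\<^sup>2)) = 256 * L\<^sup>2 * S + Y / 4"
      using L(2) by (simp add: field_simps power2_eq_square)
    finally show ?thesis by (simp add: p)
  qed
  from gagliardo_nirenberg'[OF trig_differentiable[OF t] trig_continuous[OF trig_pd_trig[OF t]] this]
  have "Y \<le> 2 * S\<^sup>2 + 2 * (256 * L\<^sup>2 * S + Y / 4)"
    by (simp add: S_def Y_def power_mult[symmetric])
  then show ?thesis by (simp add: S_def Y_def)
qed

text \<open>Interpolation in pointwise form: convergence in the mean together with a bound on fourth
  powers gives convergence in mean square.\<close>

lemma square_le_split:
  fixes d a :: real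
  assumes "a > 0"
  shows "d\<^sup>2 \<le> a * \<bar>d\<bar> + d^4 / a\<^sup>2"
proof (cases "\<bar>d\<bar> \<le> a")
  case True
  then have "\<bar>d\<bar> * \<bar>d\<bar> \<le> a * \<bar>d\<bar>" by (intro mult_right_mono) auto
  then show ?thesis using assms by (simp add: power2_eq_square add_increasing2)
next
  case False
  then have "a\<^sup>2 \<le> d\<^sup>2" using assms by (metis abs_le_square_iff abs_of_pos linear)
  then have "d\<^sup>2 * a\<^sup>2 \<le> d\<^sup>2 * d\<^sup>2" by (intro mult_left_mono) auto
  then have "d\<^sup>2 \<le> d^4 / a\<^sup>2"
    using assms by (simp add: pos_le_divide_eq power2_eq_square power4_eq_xxxx mult.assoc)
  then show ?thesis using assms by (simp add: add_increasing)
qed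

text \<open>A difference \<open>d\<close> of two members has a Laplacian bounded by
  \<open>2 * L\<close>, but not small. In the weighted gradient bound a small
  \<open>\<delta>\<close> makes the constant term small; only then is the mean square of
  \<open>d\<close>, which enters divided by \<open>\<delta>\<close>, made small by interpolation
  between first and fourth powers.\<close>

lemma gradient_Cauchy:
  fixes w :: "nat \<Rightarrow> real^2 \<Rightarrow> real"
  assumes w: "\<And>k. trig (w k)" and L: "\<And>k. (LINT x|torus. \<bar>laplace (w k) x\<bar>) \<le> L" "L > 0"
    and u: "integrable torus u" "(\<lambda>k. LINT x|torus. \<bar>w k x - u x\<bar>) \<longlonglongrightarrow> 0"
    and e: "e > 0"
  shows "\<exists>N. \<forall>k\<ge>N. \<forall>l\<ge>N. (LINT x|torus. \<bar>pd i (w k) x - pd i (w l) x\<bar>) \<le> e"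
proof -
  have wi: "integrable torus (w k)" for k by (rule trig_integrable[OF w])
  have "Bseq (\<lambda>k. LINT x|torus. \<bar>w k x - u x\<bar>)" using u(2) by (auto intro: convergent_imp_Bseq convergentI)
  then obtain M0 where M0: "\<And>k. \<bar>LINT x|torus. \<bar>w k x - u x\<bar>\<bar> \<le> M0" by (auto simp: Bseq_def)
  define M where "M = M0 + (LINT x|torus. \<bar>u x\<bar>)"
  have M: "(LINT x|torus. \<bar>w k x\<bar>) \<le> M" for k
  proof -
    have "(LINT x|torus. \<bar>w k x\<bar>) \<le> (LINT x|torus. \<bar>w k x - u x\<bar> + \<bar>u x\<bar>)"
      using wi u by (intro integral_mono) auto
    also have "\<dots> = (LINT x|torus. \<bar>w k x - u x\<bar>) + (LINT x|torus. \<bar>u x\<bar>)" using wi u by simp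
    finally show ?thesis using M0[of k] by (simp add: M_def)
  qed
  have Mk: "0 \<le> (LINT x|torus. \<bar>w k x\<bar>)" for k by simp
  define S where "S = 4 * M\<^sup>2 + 64 * L\<^sup>2"
  have S: "(LINT x|torus. (w k x)\<^sup>2) \<le> S" for k
    using trig_L2_bound[OF w L, of k] power_mono[OF M Mk, of k 2] by (simp add: S_def)
  have Sk: "0 \<le> (LINT x|torus. (w k x)\<^sup>2)" for k by simp
  define Y where "Y = 4 * S\<^sup>2 + 1024 * L\<^sup>2 * S"
  have Y: "(LINT x|torus. (w k x)^4) \<le> Y" for k
  proof -
    have "1024 * L\<^sup>2 * (LINT x|torus. (w k x)\<^sup>2) \<le> 1024 * L\<^sup>2 * S" by (intro mult_left_mono S) simp
    then show ?thesis using trig_L4_bound[OF w L, of k] power_mono[OF S Sk, of k 2] by (simp add: Y_def)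
  qed
  have Y0: "0 \<le> Y" using order_trans[OF _ Y[of 0], of 0] by simp
  \<comment> \<open>Makes the constant term \<open>4 * \<delta> * L\<close> equal to
    \<open>e\<^sup>2 / 2\<close>.\<close>
  define \<delta> where "\<delta> = e\<^sup>2 / (8 * L)"
  have \<delta>: "\<delta> > 0" using e L by (simp add: \<delta>_def)
  \<comment> \<open>The splitting level is so large that the fourth power term costs at most
    \<open>e\<^sup>2 / 4\<close>; the summand 1 keeps it positive when \<open>Y\<close>
    vanishes.\<close>
  define a where "a = sqrt (256 * L * Y / (\<delta> * e\<^sup>2)) + 1"
  have a: "a > 0" by (simp add: a_def add_nonneg_pos L \<delta> Y0 less_imp_le)
  have aY: "4 * L / \<delta> * (16 * Y / a\<^sup>2) \<le> e\<^sup>2 / 4"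
  proof -
    have nn: "0 \<le> 256 * L * Y / (\<delta> * e\<^sup>2)" using L \<delta> Y0 by simp
    have "256 * L * Y / (\<delta> * e\<^sup>2) = (sqrt (256 * L * Y / (\<delta> * e\<^sup>2)))\<^sup>2"
      using nn by simp
    also have "\<dots> \<le> a\<^sup>2" using nn by (intro power_mono) (simp_all only: a_def, simp_all)
    finally have "256 * L * Y \<le> a\<^sup>2 * (\<delta> * e\<^sup>2)"
      using \<delta> e by (simp add: pos_divide_le_eq)
    then show ?thesis using \<delta> a by (simp add: field_simps)
  qed
  \<comment> \<open>The bound on the mean of \<open>d\<close> for which the remaining term is
    exactly \<open>e\<^sup>2 / 4\<close>.\<close>
  define b where "b = \<delta> * e\<^sup>2 / (16 * L * a)"
  have b: "b > 0" using \<delta> e L a by (simp add: b_def)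
  have ab: "4 * L / \<delta> * (a * b) = e\<^sup>2 / 4" using \<delta> L a by (simp add: b_def field_simps)
  obtain N where N: "\<And>k. k \<ge> N \<Longrightarrow> (LINT x|torus. \<bar>w k x - u x\<bar>) < b / 2"
    using order_tendstoD(2)[OF u(2), of "b / 2"] b by (auto simp: eventually_sequentially)
  have "(LINT x|torus. \<bar>pd i (w k) x - pd i (w l) x\<bar>) \<le> e" if kl: "k \<ge> N" "l \<ge> N" for k l
  proof -
    define d where "d x = w k x - w l x" for x
    have d: "trig d" unfolding d_def[abs_def] by (intro trig_diff w)
    have pdd: "pd i d = (\<lambda>x. pd i (w k) x - pd i (w l) x)"
      unfolding d_def[abs_def] by (rule pd_trig_diff[OF w w])
    have Ld: "(LINT x|torus. \<bar>laplace d x\<bar>) \<le> 2 * L"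
    proof -
      have "(LINT x|torus. \<bar>laplace d x\<bar>) \<le> (LINT x|torus. \<bar>laplace (w k) x\<bar> + \<bar>laplace (w l) x\<bar>)"
        using trig_integrable[OF trig_laplace[OF w]] trig_integrable[OF trig_laplace[OF d]]
        by (intro integral_mono) (auto simp: d_def[abs_def] laplace_diff[OF w w])
      also have "\<dots> \<le> 2 * L" using trig_integrable[OF trig_laplace[OF w]] L(1)[of k] L(1)[of l] by simp
      finally show ?thesis .
    qed
    have d1: "(LINT x|torus. \<bar>d x\<bar>) \<le> b"
    proof -
      have "(LINT x|torus. \<bar>d x\<bar>) \<le> (LINT x|torus. \<bar>w k x - u x\<bar> + \<bar>w l x - u x\<bar>)"
        using wi u trig_integrable[OF d] by (intro integral_mono) (auto simp: d_def)
      also have "\<dots> = (LINT x|torus. \<bar>w k x - u x\<bar>) + (LINT x|torus. \<bar>w l x - u x\<bar>)" using wi u by simp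
      finally show ?thesis using N[OF kl(1)] N[OF kl(2)] by simp
    qed
    have d4: "(LINT x|torus. (d x)^4) \<le> 16 * Y"
    proof -
      have "(LINT x|torus. (d x)^4) \<le> (LINT x|torus. 8 * (w k x)^4 + 8 * (w l x)^4)"
      proof (rule integral_mono)
        fix x
        have "((s - t)\<^sup>2)\<^sup>2 \<le> 8 * s^4 + 8 * t^4" for s t :: real
        proof -
          have "(s - t)\<^sup>2 \<le> 2 * s\<^sup>2 + 2 * t\<^sup>2"
            using zero_le_power2[of "s + t"] by (simp add: power2_eq_square algebra_simps)
          then have "((s - t)\<^sup>2)\<^sup>2 \<le> (2 * s\<^sup>2 + 2 * t\<^sup>2)\<^sup>2" by (intro power_mono) auto
          also have "\<dots> \<le> 8 * s^4 + 8 * t^4"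
            using zero_le_power2[of "s\<^sup>2 - t\<^sup>2"] by (simp add: power2_eq_square power4_eq_xxxx algebra_simps)
          finally show ?thesis .
        qed
        then show "(d x)^4 \<le> 8 * (w k x)^4 + 8 * (w l x)^4"
          by (simp add: d_def power_mult[symmetric] flip: power_mult)
      qed (use trig_integrable[OF trig_power[OF w]] trig_integrable[OF trig_power[OF d]] in auto)
      also have "\<dots> \<le> 16 * Y" using trig_integrable[OF trig_power[OF w]] Y[of k] Y[of l] by simp
      finally show ?thesis .
    qed
    have d2: "(LINT x|torus. (d x)\<^sup>2) \<le> a * b + 16 * Y / a\<^sup>2"
    proof -
      have "(LINT x|torus. (d x)\<^sup>2) \<le> (LINT x|torus. a * \<bar>d x\<bar> + (d x)^4 / a\<^sup>2)"
        using trig_integrable[OF trig_power[OF d]] trig_integrable[OF d]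
        by (intro integral_mono square_le_split[OF a]) auto
      also have "\<dots> = a * (LINT x|torus. \<bar>d x\<bar>) + (LINT x|torus. (d x)^4) / a\<^sup>2"
        using trig_integrable[OF trig_power[OF d]] trig_integrable[OF d] by simp
      also have "\<dots> \<le> a * b + 16 * Y / a\<^sup>2"
        using d1 d4 a by (intro add_mono mult_left_mono divide_right_mono) auto
      finally show ?thesis .
    qed
    have "(LINT x|torus. \<bar>1 * pd i d x\<bar>)\<^sup>2 \<le> 2 * \<delta> * (2 * L) * (LINT x|torus. 1\<^sup>2 * (1 + (d x / \<delta>)\<^sup>2))"
      by (rule weighted_gradient_bound[OF d \<delta> Ld]) (rule continuous_on_const)
    also have "(LINT x|torus. 1\<^sup>2 * (1 + (d x / \<delta>)\<^sup>2)) = 1 + (LINT x|torus. (d x)\<^sup>2) / \<delta>\<^sup>2"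
      using trig_integrable[OF trig_power[OF d]] trig_integrable[OF trig_const] by (simp add: power_divide)
    also have "2 * \<delta> * (2 * L) * (1 + (LINT x|torus. (d x)\<^sup>2) / \<delta>\<^sup>2) =
        4 * \<delta> * L + 4 * L / \<delta> * (LINT x|torus. (d x)\<^sup>2)"
      using \<delta> by (simp add: field_simps power2_eq_square)
    also have "\<dots> \<le> e\<^sup>2 / 2 + 4 * L / \<delta> * (a * b + 16 * Y / a\<^sup>2)"
    proof (intro add_mono mult_left_mono d2)
      show "4 * \<delta> * L \<le> e\<^sup>2 / 2" using L by (simp add: \<delta>_def)
      show "0 \<le> 4 * L / \<delta>" using L \<delta> by simp
    qed
    also have "\<dots> \<le> e\<^sup>2" using ab aY unfolding distrib_left by linarith
    finally have "(LINT x|torus. \<bar>pd i d x\<bar>) \<le> e" using e by (simp add: power_mono_iff)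
    then show ?thesis by (simp add: pdd)
  qed
  then show ?thesis by blast
qed

section \<open>Application to the vortex equation\<close>

text \<open>Extracting from the sum of the two errors makes a single subsequence serve both
  limits.\<close>

lemma tendsto_L1_AE_subseq2:
  fixes a b :: "nat \<Rightarrow> 'a \<Rightarrow> real"
  assumes "\<And>n. integrable M (a n)" "\<And>n. integrable M (b n)" "integrable M a'" "integrable M b'"
    and "(\<lambda>n. LINT x|M. \<bar>a n x - a' x\<bar>) \<longlonglongrightarrow> 0" "(\<lambda>n. LINT x|M. \<bar>b n x - b' x\<bar>) \<longlonglongrightarrow> 0"
  obtains r :: "nat \<Rightarrow> nat" where "strict_mono r" "AE x in M. (\<lambda>n. a (r n) x) \<longlonglongrightarrow> a' x"
    "AE x in M. (\<lambda>n. b (r n) x) \<longlonglongrightarrow> b' x"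
proof -
  let ?u = "\<lambda>n x. \<bar>a n x - a' x\<bar> + \<bar>b n x - b' x\<bar>"
  have "\<exists>r::nat\<Rightarrow>nat. strict_mono r \<and> (AE x in M. (\<lambda>n. ?u (r n) x) \<longlonglongrightarrow> 0)"
  proof (rule tendsto_L1_AE_subseq)
    show "integrable M (?u n)" for n using assms by simp
    show "(\<lambda>n. LINT x|M. norm (?u n x)) \<longlonglongrightarrow> 0"
      using tendsto_add[OF assms(5,6)] assms(1-4) by simp
  qed
  then obtain r :: "nat \<Rightarrow> nat" where r: "strict_mono r" and ae: "AE x in M. (\<lambda>n. ?u (r n) x) \<longlonglongrightarrow> 0" by blast
  show ?thesis
  proof (rule that[OF r])
    show "AE x in M. (\<lambda>n. a (r n) x) \<longlonglongrightarrow> a' x"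
      using ae
    proof eventually_elim
      case (elim x)
      have "(\<lambda>n. a (r n) x - a' x) \<longlonglongrightarrow> 0"
        by (rule Lim_null_comparison[OF _ elim]) simp
      then show ?case by (rule LIM_zero_cancel)
    qed
    show "AE x in M. (\<lambda>n. b (r n) x) \<longlonglongrightarrow> b' x"
      using ae
    proof eventually_elim
      case (elim x)
      have "(\<lambda>n. b (r n) x - b' x) \<longlonglongrightarrow> 0"
        by (rule Lim_null_comparison[OF _ elim]) simp
      then show ?case by (rule LIM_zero_cancel)
    qed
  qed
qed

text \<open>The equation is tested with the reflected kernel. Two derivatives cancel the two signs
  of the reflection, each Dirac mass becomes a translated kernel, and the constant survives because
  the kernel has mass one.\<close>

lemma vortex_laplace:
  assumes \<sigma>: "vortex_potential m n p q A \<sigma>"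
  shows "- laplace (conv (bump k) \<sigma>) x =
    4 * pi * (\<Sum>j=1..m. bump k (x - p j)) - 4 * pi * (\<Sum>j=1..n. bump k (x - q j)) - A"
proof -
  let ?\<phi> = "\<lambda>y. bump k (x - y)"
  have i\<sigma>: "integrable torus \<sigma>" using \<sigma> by (simp add: vortex_potential_def L1_def)
  have t: "trig (pd i (pd i (bump k)))" for i by (intro trig_pd_trig trig_bump)
  have p\<phi>: "pd i (pd i ?\<phi>) y = pd i (pd i (bump k)) (x - y)" for i y
  proof -
    have 1: "pd i ?\<phi> = (\<lambda>y. (-1) * pd i (bump k) (x - y))"
      by (simp add: pd_compose_diff trig_differentiable trig_bump)
    have "pd i (\<lambda>y. (-1) * pd i (bump k) (x - y)) = (\<lambda>y. (-1) * pd i (\<lambda>y. pd i (bump k) (x - y)) y)"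
      by (intro pd_cmult trig_differentiable trig_reflect trig_pd_trig trig_bump)
    then show ?thesis unfolding 1
      by (simp add: pd_compose_diff trig_differentiable trig_pd_trig trig_bump)
  qed
  have "laplace (conv (bump k) \<sigma>) x = (\<Sum>i\<in>UNIV. LINT y|torus. \<sigma> y * pd i (pd i (bump k)) (x - y))"
    by (simp add: laplace_def pd_conv trig_bump trig_pd_trig i\<sigma> conv_def)
  also have "\<dots> = (LINT y|torus. (\<Sum>i\<in>UNIV. \<sigma> y * pd i (pd i (bump k)) (x - y)))"
    by (rule Bochner_Integration.integral_sum[symmetric]) (intro trig_mult_integrable i\<sigma> trig_reflect t)
  also have "\<dots> = (LINT y|torus. \<sigma> y * (\<Sum>i\<in>UNIV. pd i (pd i ?\<phi>) y))"
    by (simp add: p\<phi> sum_distrib_left)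
  finally show ?thesis
    using \<sigma> trig_test[OF trig_reflect[OF trig_bump], of k x]
    by (simp add: vortex_potential_def integral_bump)
qed

text \<open>Every translated kernel has integral 1, so the bound is the total mass of the right side
  and is independent of \<open>k\<close>.\<close>

lemma vortex_laplace_L1:
  assumes \<sigma>: "vortex_potential m n p q A \<sigma>"
  shows "(LINT x|torus. \<bar>laplace (conv (bump k) \<sigma>) x\<bar>) \<le> 4 * pi * (real m + real n) + \<bar>A\<bar>"
proof -
  let ?P = "\<lambda>x. \<Sum>j=1..m. bump k (x - p j)" and ?Q = "\<lambda>x. \<Sum>j=1..n. bump k (x - q j)"
  have ib: "integrable torus (\<lambda>x. bump k (x - a))" for a by (intro trig_integrable trig_translate trig_bump)
  have i\<sigma>: "integrable torus \<sigma>" using \<sigma> by (simp add: vortex_potential_def L1_def)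
  have PQ: "integrable torus ?P" "integrable torus ?Q" using ib by simp_all
  have "(LINT x|torus. \<bar>laplace (conv (bump k) \<sigma>) x\<bar>) \<le> (LINT x|torus. 4 * pi * ?P x + 4 * pi * ?Q x + \<bar>A\<bar>)"
  proof (rule integral_mono)
    show "integrable torus (\<lambda>x. \<bar>laplace (conv (bump k) \<sigma>) x\<bar>)"
      by (intro integrable_abs trig_integrable trig_laplace conv_trig trig_bump i\<sigma>)
    show "integrable torus (\<lambda>x. 4 * pi * ?P x + 4 * pi * ?Q x + \<bar>A\<bar>)"
      using PQ trig_integrable[OF trig_const] by simp
    fix x
    have "0 \<le> 4 * pi * ?P x" "0 \<le> 4 * pi * ?Q x"
      by (intro mult_nonneg_nonneg sum_nonneg bump_nonneg; simp)+
    then show "\<bar>laplace (conv (bump k) \<sigma>) x\<bar> \<le> 4 * pi * ?P x + 4 * pi * ?Q x + \<bar>A\<bar>"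
      using vortex_laplace[OF \<sigma>, of k x] by linarith
  qed
  also have "\<dots> = 4 * pi * (\<Sum>j=1..m. LINT x|torus. bump k (x - p j))
      + 4 * pi * (\<Sum>j=1..n. LINT x|torus. bump k (x - q j)) + \<bar>A\<bar>"
    using PQ ib trig_integrable[OF trig_const] by simp
  also have "\<dots> = 4 * pi * (real m + real n) + \<bar>A\<bar>" by (simp add: integral_bump distrib_left)
  finally show ?thesis .
qed

text \<open>The gradients of the mollifications form a Cauchy sequence in the mean; their limits are
  the weak derivatives. The weighted square bound passes to the limit by Fatou along a subsequence
  on which function and gradient both converge.\<close>

theorem vortex_regularity:
  assumes \<sigma>: "vortex_potential m n p q A \<sigma>"
  obtains w where "\<And>i. is_weak_pd i \<sigma> (w i)"
    "\<And>i. integrable torus (\<lambda>x. (w i x)\<^sup>2 / (1 + (\<sigma> x)\<^sup>2))"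
proof -
  have L1\<sigma>: "\<sigma> \<in> L1" and i\<sigma>: "integrable torus \<sigma>"
    using \<sigma> by (auto simp: vortex_potential_def L1_def)
  \<comment> \<open>The summand 1 makes \<open>L\<close> strictly positive whatever the numbers of
    points, as the gradient estimates require.\<close>
  define L where "L = 4 * pi * (real m + real n) + \<bar>A\<bar> + 1"
  define s where "s k = conv (bump k) \<sigma>" for k
  have ts: "trig (s k)" for k unfolding s_def by (rule conv_trig[OF trig_bump i\<sigma>])
  have L: "(LINT x|torus. \<bar>laplace (s k) x\<bar>) \<le> L" for k
    unfolding s_def L_def using vortex_laplace_L1[OF \<sigma>, of k] by simp
  have L0: "L > 0" unfolding L_def by (simp add: add_nonneg_pos)
  have lim: "(\<lambda>k. LINT x|torus. \<bar>s k x - \<sigma> x\<bar>) \<longlonglongrightarrow> 0"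
    unfolding s_def by (rule conv_bump_tendsto[OF i\<sigma>])
  have ex: "\<exists>g. g \<in> L1 \<and> (\<lambda>k. LINT x|torus. \<bar>pd i (s k) x - g x\<bar>) \<longlonglongrightarrow> 0" for i
  proof -
    have "integrable torus (pd i (s k))" "periodic (pd i (s k))" for k
      by (intro trig_integrable trig_periodic trig_pd_trig ts)+
    from L1_complete[of "\<lambda>k. pd i (s k)", OF this gradient_Cauchy[OF ts L L0 i\<sigma> lim]]
    show ?thesis by blast
  qed
  have "\<forall>i. \<exists>g. g \<in> L1 \<and> (\<lambda>k. LINT x|torus. \<bar>pd i (s k) x - g x\<bar>) \<longlonglongrightarrow> 0"
    by (rule allI) (rule ex)
  from choice[OF this] obtain w
    where w: "\<And>i. w i \<in> L1" "\<And>i. (\<lambda>k. LINT x|torus. \<bar>pd i (s k) x - w i x\<bar>) \<longlonglongrightarrow> 0"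
    by blast
  have iw: "integrable torus (w i)" for i by (rule L1_integrable[OF w(1)])
  show ?thesis
  proof (rule that[of w])
    fix i
    have "(LINT x|torus. \<sigma> x * pd i \<phi> x) = - (LINT x|torus. w i x * \<phi> x)" if \<phi>: "\<phi> \<in> test_functions" for \<phi>
    proof -
      have c\<phi>: "continuous_on UNIV \<phi>" "continuous_on UNIV (pd i \<phi>)"
        using \<phi> by (rule test_continuous test_pd_continuous)+
      obtain b0 where b0: "\<And>x. x \<in> cbox 0 1 \<Longrightarrow> \<bar>\<phi> x\<bar> \<le> b0" using continuous_bounded_torus[OF c\<phi>(1)] by blast
      obtain b1 where b1: "\<And>x. x \<in> cbox 0 1 \<Longrightarrow> \<bar>pd i \<phi> x\<bar> \<le> b1" using continuous_bounded_torus[OF c\<phi>(2)] by blast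
      have parts: "(LINT x|torus. s k x * pd i \<phi> x) = - (LINT x|torus. pd i (s k) x * \<phi> x)" for k
        by (intro integral_by_parts trig_differentiable trig_continuous trig_pd_trig trig_periodic ts
            test_differentiable test_periodic \<phi> c\<phi>)
      have "(\<lambda>k. LINT x|torus. s k x * pd i \<phi> x) \<longlonglongrightarrow> (LINT x|torus. \<sigma> x * pd i \<phi> x)"
        using continuous_measurable_torus[OF c\<phi>(2)]
        by (intro L1_tendsto_integral_mult[OF trig_integrable[OF ts] i\<sigma> lim _ _ b1]) auto
      moreover have "(\<lambda>k. LINT x|torus. pd i (s k) x * \<phi> x) \<longlonglongrightarrow> (LINT x|torus. w i x * \<phi> x)"
        using continuous_measurable_torus[OF c\<phi>(1)]
        by (intro L1_tendsto_integral_mult[OF trig_integrable[OF trig_pd_trig[OF ts]] iw w(2) _ _ b0]) auto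
      ultimately show ?thesis
        unfolding parts by (intro LIMSEQ_unique[OF _ tendsto_minus])
    qed
    then show "is_weak_pd i \<sigma> (w i)" by (simp add: is_weak_pd_def L1\<sigma> w(1))
    obtain r :: "nat \<Rightarrow> nat" where r: "AE x in torus. (\<lambda>n. s (r n) x) \<longlonglongrightarrow> \<sigma> x"
      "AE x in torus. (\<lambda>n. pd i (s (r n)) x) \<longlonglongrightarrow> w i x"
      using tendsto_L1_AE_subseq2[OF trig_integrable[OF ts] trig_integrable[OF trig_pd_trig[OF ts]] i\<sigma> iw lim w(2)]
      by blast
    have pos: "1 + t\<^sup>2 > 0" "1 + t\<^sup>2 \<noteq> 0" for t :: real
      using zero_le_power2[of t] by (linarith, simp add: add_nonneg_eq_0_iff)
    \<comment> \<open>The truncated energy at level \<open>\<delta> = 1\<close> is at most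
      \<open>2 * L\<close> for every mollification.\<close>
    show "integrable torus (\<lambda>x. (w i x)\<^sup>2 / (1 + (\<sigma> x)\<^sup>2))"
    proof (rule fatou_real(1)[where h = "\<lambda>n x. (pd i (s (r n)) x)\<^sup>2 / (1 + (s (r n) x)\<^sup>2)" and C = "2 * L"])
      show "integrable torus (\<lambda>x. (pd i (s (r n)) x)\<^sup>2 / (1 + (s (r n) x)\<^sup>2))" for n
        by (intro integrable_torus_continuous continuous_on_divide continuous_intros trig_continuous trig_pd_trig ts)
          (use pos in auto)
      show "0 \<le> (pd i (s (r n)) x)\<^sup>2 / (1 + (s (r n) x)\<^sup>2)" for n x
        by (intro divide_nonneg_pos pos) simp
      show "(\<lambda>x. (w i x)\<^sup>2 / (1 + (\<sigma> x)\<^sup>2)) \<in> borel_measurable torus"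
        using iw[of i] i\<sigma> by measurable
      show "AE x in torus. (\<lambda>n. (pd i (s (r n)) x)\<^sup>2 / (1 + (s (r n) x)\<^sup>2)) \<longlonglongrightarrow> (w i x)\<^sup>2 / (1 + (\<sigma> x)\<^sup>2)"
        using r by eventually_elim (intro tendsto_intros pos)
      show "\<forall>\<^sub>F n in sequentially. (LINT x|torus. (pd i (s (r n)) x)\<^sup>2 / (1 + (s (r n) x)\<^sup>2)) \<le> 2 * L"
        using truncated_energy[OF ts _ L, of 1 i] by simp
    qed
  qed
qed

section \<open>Decay of the nonlinearity\<close>

lemma deriv_ge_imp_linear_growth:
  fixes h :: "real \<Rightarrow> real"
  assumes h: "\<And>T. T \<ge> t \<Longrightarrow> (h has_real_derivative h' T) (at T)"
    and c: "\<And>T. T \<ge> t \<Longrightarrow> h' T \<ge> c" and T: "T \<ge> t"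
  shows "h T \<ge> h t + c * (T - t)"
proof -
  have "h t - c * t \<le> h T - c * T"
  proof (rule DERIV_nonneg_imp_nondecreasing[OF T])
    fix x assume "t \<le> x" "x \<le> T"
    then show "\<exists>y. ((\<lambda>x. h x - c * x) has_real_derivative y) (at x) \<and> 0 \<le> y"
      using h[of x] c[of x] by (intro exI[of _ "h' x - c"]) (auto intro!: derivative_eq_intros)
  qed
  then show ?thesis by (simp add: algebra_simps)
qed

text \<open>The bound on the third derivative is integrated twice from infinity. In place of limits
  there, two contradictions are used: a positive lower bound on \<open>F1\<close> would make
  \<open>f\<close> unbounded, and a persistently negative second derivative would make
  \<open>F1\<close> nonpositive.\<close>

lemma decay_of_derivatives:
  fixes f F1 F2 F3 :: "real \<Rightarrow> real"
  assumes F: "\<And>t. t > 0 \<Longrightarrow> (f has_real_derivative F1 t) (at t)"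
    "\<And>t. t > 0 \<Longrightarrow> (F1 has_real_derivative F2 t) (at t)"
    "\<And>t. t > 0 \<Longrightarrow> (F2 has_real_derivative F3 t) (at t)"
    and pos: "\<And>t. t > 0 \<Longrightarrow> F1 t > 0" and bd: "\<And>t. t > 0 \<Longrightarrow> f t \<le> B"
    and K: "\<And>t. t > 0 \<Longrightarrow> t^4 * \<bar>F3 t\<bar> \<le> K" and t: "t > 0"
  shows "\<bar>F2 t\<bar> \<le> K / (3 * t^3)" "F1 t \<le> K / (6 * t^2)"
proof -
  have no_growth: False if "t0 > 0" "c > 0" "\<And>T. T \<ge> t0 \<Longrightarrow> F1 T \<ge> c" for t0 c
  proof -
    define T where "T = t0 + (\<bar>B - f t0\<bar> + 1) / c"
    have "T \<ge> t0" using that by (simp add: T_def)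
    then have "f T \<ge> f t0 + c * (T - t0)"
      using F(1) that by (intro deriv_ge_imp_linear_growth[of t0 f F1]) auto
    moreover have "c * (T - t0) = \<bar>B - f t0\<bar> + 1" using that by (simp add: T_def)
    moreover have "f T \<le> B" using bd \<open>T \<ge> t0\<close> that by simp
    ultimately show False by linarith
  qed
  have F2: "\<bar>F2 t\<bar> \<le> K / (3 * t^3)" if t: "t > 0" for t
  proof -
    \<comment> \<open>For either sign \<open>e\<close>, the function
      \<open>e * F2 x - K / (3 * x^3)\<close> is nondecreasing, so \<open>e * F2\<close> never falls
      more than \<open>K / (3 * t^3)\<close> below its value at \<open>t\<close>.\<close>
    have far: "e * F2 T \<ge> e * F2 t - K / (3 * t^3)" if e: "\<bar>e\<bar> = 1" and T: "T \<ge> t" for e T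
    proof -
      have "e * F2 t - K / (3 * t^3) \<le> e * F2 T - K / (3 * T^3)"
      proof (rule DERIV_nonneg_imp_nondecreasing[OF T])
        fix x assume x: "t \<le> x" "x \<le> T"
        then have x0: "x > 0" using t by simp
        have "((\<lambda>x. e * F2 x - K / (3 * x^3)) has_real_derivative e * F3 x + K / x^4) (at x)"
          using x0 by (auto intro!: derivative_eq_intros F(3) simp: field_simps power2_eq_square power4_eq_xxxx power3_eq_cube)
        moreover have "\<bar>e * F3 x\<bar> \<le> K / x^4"
          using K[OF x0] x0 e by (simp add: abs_mult pos_le_divide_eq mult.commute)
        ultimately show "\<exists>y. ((\<lambda>x. e * F2 x - K / (3 * x^3)) has_real_derivative y) (at x) \<and> 0 \<le> y"
          by (intro exI[of _ "e * F3 x + K / x^4"]) auto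
      qed
      moreover have "K / (3 * T^3) \<ge> 0"
        using order_trans[OF _ K[OF t], of 0] T t by simp
      ultimately show ?thesis by linarith
    qed
    have "F2 t \<le> K / (3 * t^3)"
    proof (rule ccontr)
      assume "\<not> ?thesis"
      then obtain c where c: "c > 0" "c = F2 t - K / (3 * t^3)" by simp
      \<comment> \<open>\<open>F1\<close> grows at rate at least \<open>c\<close>, so after unit
        time it has reached \<open>c\<close>.\<close>
      have "F1 T \<ge> c" if T: "T \<ge> t + 1" for T
      proof -
        have "F1 T \<ge> F1 t + c * (T - t)"
          using t T far[of 1] c(2) by (intro deriv_ge_imp_linear_growth[of t F1 F2] F(2)) auto
        moreover have "c * (T - t) \<ge> c * 1" using c(1) T by (intro mult_left_mono) auto
        ultimately show ?thesis using pos[OF t] by linarith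
      qed
      then show False using no_growth[of "t + 1" c] c t by auto
    qed
    moreover have "- F2 t \<le> K / (3 * t^3)"
    proof (rule ccontr)
      assume "\<not> ?thesis"
      then obtain c where c: "c > 0" "c = - F2 t - K / (3 * t^3)" by simp
      \<comment> \<open>The time by which a decrease at rate \<open>c\<close> has used up the value
        \<open>F1 t\<close>.\<close>
      define T where "T = t + F1 t / c"
      have T: "T \<ge> t" using c pos[OF t] by (simp add: T_def)
      have "- F1 T \<ge> - F1 t + c * (T - t)"
        using t T far[of "-1"] c(2)
        by (intro deriv_ge_imp_linear_growth[of t "\<lambda>x. - F1 x" "\<lambda>x. - F2 x"] DERIV_minus F(2)) auto
      moreover have "c * (T - t) = F1 t" using c by (simp add: T_def)
      ultimately show False using pos[of T] T t by simp
    qed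
    ultimately show ?thesis by linarith
  qed
  show "\<bar>F2 t\<bar> \<le> K / (3 * t^3)" by (rule F2[OF t])
  show "F1 t \<le> K / (6 * t^2)"
  proof (rule ccontr)
    assume "\<not> ?thesis"
    then obtain c where c: "c > 0" "c = F1 t - K / (6 * t^2)" by simp
    have "F1 T \<ge> c" if T: "T \<ge> t" for T
    proof -
      have "F1 t - K / (6 * t^2) \<le> F1 T - K / (6 * T^2)"
      proof (rule DERIV_nonneg_imp_nondecreasing[OF T])
        fix x assume x: "t \<le> x" "x \<le> T"
        then have x0: "x > 0" using t by simp
        have "((\<lambda>x. F1 x - K / (6 * x^2)) has_real_derivative F2 x + K / (3 * x^3)) (at x)"
          using x0 by (auto intro!: derivative_eq_intros F(2) simp: field_simps power2_eq_square power4_eq_xxxx power3_eq_cube)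
        then show "\<exists>y. ((\<lambda>x. F1 x - K / (6 * x^2)) has_real_derivative y) (at x) \<and> 0 \<le> y"
          using F2[OF x0] by (intro exI[of _ "F2 x + K / (3 * x^3)"]) auto
      qed
      moreover have "K / (6 * T^2) \<ge> 0"
        using order_trans[OF _ K[OF t], of 0] T t by simp
      ultimately show ?thesis using c(2) by linarith
    qed
    then show False using no_growth[of t c] c t by auto
  qed
qed

text \<open>Continuity is recorded up to 0 because the behaviour of \<open>f\<close> at exponentials
  of very negative numbers is controlled by compactness of the unit interval.\<close>

lemma smooth_halfline_derivs:
  assumes "smooth_on_halfline f"
  obtains F where "F 0 = f" "\<And>k t. t > 0 \<Longrightarrow> (F k has_real_derivative F (Suc k) t) (at t)"
    "\<And>k. continuous_on {0..} (F k)" "\<And>k t. t > 0 \<Longrightarrow> (deriv ^^ k) f t = F k t"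
proof -
  obtain F :: "nat \<Rightarrow> real \<Rightarrow> real" where F: "F 0 = f"
    "\<And>k t. t \<ge> 0 \<Longrightarrow> (F k has_real_derivative F (Suc k) t) (at t within {0..})"
    using assms unfolding smooth_on_halfline_def by blast
  have at: "(F k has_real_derivative F (Suc k) t) (at t)" if "t > 0" for k t
  proof -
    have "(F k has_real_derivative F (Suc k) t) (at t within {0<..})"
      using F(2)[of t k] that by (intro has_field_derivative_subset[OF F(2)[of t k]]) auto
    then show ?thesis using that by (simp add: at_within_open[of t "{0<..}"])
  qed
  have "(deriv ^^ k) f t = F k t" if "t > 0" for k t
    using that
  proof (induction k arbitrary: t)
    case (Suc k)
    have "((deriv ^^ k) f has_real_derivative F (Suc k) t) (at t)"
    proof (rule has_field_derivative_transform_within_open[OF at[OF Suc.prems]])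
      show "open {0::real<..}" "t \<in> {0<..}" using Suc.prems by auto
    qed (use Suc.IH in auto)
    then show ?case by (simp add: DERIV_imp_deriv)
  qed (simp add: F(1))
  moreover have "continuous_on {0..} (F k)" for k
    by (rule DERIV_continuous_on) (use F(2) in auto)
  ultimately show ?thesis using that[of F] F(1) at by blast
qed

section \<open>The nonlinearity in the exponential variable\<close>

text \<open>The three functions \<open>nl0\<close>, \<open>nl1\<close> and \<open>nl2\<close> are
  \<open>f \<circ> exp\<close> and its first two derivatives, spelled as in
  \<open>gradient_density\<close> and \<open>weak_solution\<close>. The bracket in the equation,
  times the exponential, is thereby recognised as a second derivative.\<close>

definition nl0 :: "(real \<Rightarrow> real) \<Rightarrow> real \<Rightarrow> real" where
  "nl0 f s = f (exp s)"

definition nl1 :: "(real \<Rightarrow> real) \<Rightarrow> real \<Rightarrow> real" where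
  "nl1 f s = deriv f (exp s) * exp s"

definition nl2 :: "(real \<Rightarrow> real) \<Rightarrow> real \<Rightarrow> real" where
  "nl2 f s = ((deriv ^^ 2) f (exp s) * exp s + deriv f (exp s)) * exp s"

text \<open>The derivatives of \<open>f \<circ> exp\<close> are combinations of
  \<open>F k t * t ^ k\<close> at \<open>t = exp s\<close>. Each is at most a multiple of
  \<open>min t (inverse t)\<close>: for \<open>t\<close> up to 1 because \<open>F k\<close> is
  bounded on the unit interval, beyond because \<open>F k\<close> decays like the power
  \<open>k + 1\<close> of \<open>inverse t\<close>.\<close>

theorem nonlinearity_bounds:
  assumes f0: "hyp_f0 f" and f1: "hyp_f1 f s0" and f2: "hyp_f2 f"
  obtains nl3 C where
    "\<And>s. (nl0 f has_real_derivative nl1 f s) (at s)"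
    "\<And>s. (nl1 f has_real_derivative nl2 f s) (at s)"
    "\<And>s. (nl2 f has_real_derivative nl3 s) (at s)"
    "\<And>s. \<bar>nl0 f s\<bar> \<le> C" "\<And>s. \<bar>nl1 f s\<bar> \<le> C * exp (- \<bar>s\<bar>)"
    "\<And>s. \<bar>nl2 f s\<bar> \<le> C * exp (- \<bar>s\<bar>)" "\<And>s. \<bar>nl3 s\<bar> \<le> C * exp (- \<bar>s\<bar>)" "C \<ge> 0"
proof -
  have "smooth_on_halfline f" using f0 by (simp add: hyp_f0_def)
  then obtain F where F: "F 0 = f" "\<And>k t. t > 0 \<Longrightarrow> (F k has_real_derivative F (Suc k) t) (at t)"
    "\<And>k. continuous_on {0..} (F k)" "\<And>k t. t > 0 \<Longrightarrow> (deriv ^^ k) f t = F k t"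
    using smooth_halfline_derivs by blast
  have d: "(f has_real_derivative F 1 t) (at t)" "(F 1 has_real_derivative F 2 t) (at t)"
    "(F 2 has_real_derivative F 3 t) (at t)" if "t > 0" for t
    using F(2)[OF that, of 0] F(2)[OF that, of 1] F(2)[OF that, of 2]
    by (simp_all add: F(1) numeral_2_eq_2 numeral_3_eq_3)
  have pos: "F 1 t > 0" if "t > 0" for t
  proof -
    have "0 < deriv f t" using f0 that by (simp add: hyp_f0_def)
    then show ?thesis using F(4)[OF that, of 1] by simp
  qed
  have n1: "nl1 f s = F 1 (exp s) * exp s" for s
    using F(4)[of "exp s" 1] by (simp add: nl1_def)
  have n2: "nl2 f s = (F 2 (exp s) * exp s + F 1 (exp s)) * exp s" for s
    using F(4)[of "exp s" 1] F(4)[of "exp s" 2] by (simp add: nl2_def)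
  \<comment> \<open>The third derivative of \<open>f \<circ> exp\<close>; its coefficients are 1, 3
    and 1.\<close>
  define nl3 where "nl3 s = F 3 (exp s) * exp s ^ 3 + 3 * F 2 (exp s) * exp s ^ 2 + F 1 (exp s) * exp s" for s
  have chain: "((\<lambda>s. F k (exp s)) has_real_derivative F (Suc k) (exp s) * exp s) (at s)" for k s
    by (rule DERIV_chain2[OF F(2)]) auto
  have e0: "(nl0 f has_real_derivative nl1 f s) (at s)" for s
    using chain[of 0 s] by (simp add: F(1) nl0_def[abs_def] n1)
  have e1: "(nl1 f has_real_derivative nl2 f s) (at s)" for s
    unfolding n1[abs_def] n2
    by (rule derivative_eq_intros chain refl)+ (simp add: numeral_2_eq_2 algebra_simps)
  have e2: "(nl2 f has_real_derivative nl3 s) (at s)" for s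
    unfolding n2[abs_def] nl3_def
    by (rule derivative_eq_intros chain refl)+
      (simp add: numeral_2_eq_2 numeral_3_eq_3 algebra_simps)
  obtain K where "\<forall>y\<in>(\<lambda>t. t ^ 4 * \<bar>(deriv ^^ 3) f t\<bar>) ` {0<..}. y \<le> K"
    using f2 unfolding hyp_f2_def bdd_above_def by blast
  then have "t^4 * \<bar>(deriv ^^ 3) f t\<bar> \<le> K" if "t > 0" for t using that by auto
  then have K: "t^4 * \<bar>F 3 t\<bar> \<le> K" if "t > 0" for t using that F(4)[OF that, of 3] by metis
  obtain B where "\<forall>y\<in>f ` {0<..}. y \<le> B" using f1 unfolding hyp_f1_def bdd_above_def by blast
  then have B: "f t \<le> B" if "t > 0" for t using that by auto
  have decay: "\<bar>F 2 t\<bar> \<le> K / (3 * t^3)" "F 1 t \<le> K / (6 * t^2)" if "t > 0" for t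
    using decay_of_derivatives[of f "F 1" "F 2" "F 3" B K t] d pos B K that by simp_all
  have "\<exists>b. \<forall>t\<in>{0..1}. \<bar>F k t\<bar> \<le> b" for k
  proof -
    have "continuous_on {0..1} (F k)" by (rule continuous_on_subset[OF F(3)]) auto
    then have "bounded (F k ` {0..1})" by (intro compact_imp_bounded compact_continuous_image) auto
    then show ?thesis by (auto simp: bounded_iff)
  qed
  then obtain b where b: "\<And>k t. t \<in> {0..1} \<Longrightarrow> \<bar>F k t\<bar> \<le> b k" by metis
  have b0: "b k \<ge> 0" for k using b[of 0 k] by simp
  have K0: "K \<ge> 0" using order_trans[OF _ K[of 1], of 0] by simp
  define C1 where "C1 = max K (b 1 + b 2 + b 3)"
  have C1: "C1 \<ge> 0" using K0 by (simp add: C1_def)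
  have main: "\<bar>F k t\<bar> * t ^ k \<le> C1 * min t (inverse t)" if k: "k \<in> {1, 2, 3}" and t: "t > 0" for k t
  proof (cases "t \<le> 1")
    case True
    have "\<bar>F k t\<bar> * t ^ k \<le> C1 * t"
    proof (rule mult_mono)
      have "b k \<le> b 1 + b 2 + b 3" using k b0[of 1] b0[of 2] b0[of 3] by auto
      then show "\<bar>F k t\<bar> \<le> C1" using b[of t k] t True by (simp add: C1_def)
      show "t ^ k \<le> t" using power_decreasing[of 1 k t] k t True by auto
    qed (use t C1 in auto)
    moreover have "min t (inverse t) = t" using t True by (simp add: min_def field_simps) (metis mult_le_one less_imp_le)
    ultimately show ?thesis by simp
  next
    case False
    have "\<bar>F k t\<bar> \<le> K / t ^ Suc k"
    proof -
      have 1: "\<bar>F 1 t\<bar> \<le> K / t^2"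
      proof -
        have "K / (6 * t^2) \<le> K / t^2" using K0 t by (intro divide_left_mono) auto
        then show ?thesis using decay(2)[OF t] pos[OF t] by linarith
      qed
      have 2: "\<bar>F 2 t\<bar> \<le> K / t^3"
      proof -
        have "K / (3 * t^3) \<le> K / t^3" using K0 t by (intro divide_left_mono) auto
        then show ?thesis using decay(1)[OF t] by linarith
      qed
      have 3: "\<bar>F 3 t\<bar> \<le> K / t^4" using K[OF t] t by (simp add: pos_le_divide_eq mult.commute)
      show ?thesis using k 1 2 3 by (auto simp: numeral_eq_Suc)
    qed
    then have "\<bar>F k t\<bar> * t ^ k \<le> K / t ^ Suc k * t ^ k" using t by (intro mult_right_mono) auto
    also have "\<dots> = K * inverse t" using t by (simp add: field_simps)
    also have "\<dots> \<le> C1 * inverse t" using t by (intro mult_right_mono) (auto simp: C1_def)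
    also have "inverse t = min t (inverse t)"
    proof -
      have "inverse t \<le> 1" using False by (intro inverse_le_1_iff[THEN iffD2]) auto
      then show ?thesis using False by simp
    qed
    finally show ?thesis .
  qed
  have exp_min: "min (exp s) (inverse (exp s)) = exp (- \<bar>s\<bar>)" for s :: real
    by (simp add: exp_minus[symmetric] min_def abs_if)
  have Fk: "\<bar>F k (exp s) * exp s ^ k\<bar> \<le> C1 * exp (- \<bar>s\<bar>)" if "k \<in> {1, 2, 3}" for k s
    using main[OF that, of "exp s"] by (simp add: exp_min abs_mult)
  have F1: "\<bar>F 1 (exp s) * exp s\<bar> \<le> C1 * exp (- \<bar>s\<bar>)" for s using Fk[of 1 s] by simp
  note F2 = Fk[of 2, simplified] and F3 = Fk[of 3, simplified]
  have fb: "\<bar>f t\<bar> \<le> \<bar>B\<bar> + b 0" if t: "t > 0" for t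
  proof (cases "t \<le> 1")
    case True
    then show ?thesis using b[of t 0] t by (simp add: F(1))
  next
    case False
    \<comment> \<open>The hypotheses bound \<open>f\<close> from above only; monotonicity supplies
      the lower bound for large arguments.\<close>
    have "f 1 \<le> f t"
    proof (rule DERIV_nonneg_imp_nondecreasing[of 1 t f])
      fix x assume "1 \<le> x" "x \<le> t"
      then show "\<exists>y. (f has_real_derivative y) (at x) \<and> 0 \<le> y"
        using d(1)[of x] pos[of x] by (intro exI[of _ "F 1 x"]) auto
    qed (use False in auto)
    moreover have "\<bar>f 1\<bar> \<le> b 0" using b[of 1 0] by (simp add: F(1))
    ultimately show ?thesis using B[OF t] by linarith
  qed
  \<comment> \<open>The 5 is the sum of the coefficients 1, 3, 1 of \<open>nl3\<close>; the other
    two summands bound \<open>f\<close> itself.\<close>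
  define C where "C = 5 * C1 + \<bar>B\<bar> + b 0"
  have le: "5 * (C1 * exp (- \<bar>s\<bar>)) \<le> C * exp (- \<bar>s\<bar>)" for s :: real
    using b0[of 0] by (simp add: C_def)
  have C1e: "0 \<le> C1 * exp (- \<bar>s\<bar>)" for s :: real using C1 by simp
  show ?thesis
  proof (rule that[of nl3 C, OF e0 e1 e2])
    fix s
    show "\<bar>nl0 f s\<bar> \<le> C" using fb[of "exp s"] C1 by (simp add: nl0_def C_def)
    show "\<bar>nl1 f s\<bar> \<le> C * exp (- \<bar>s\<bar>)" using F1[of s] le[of s] C1e[of s] unfolding n1 by linarith
    have "nl2 f s = F 2 (exp s) * (exp s)\<^sup>2 + F 1 (exp s) * exp s"
      by (simp add: n2 algebra_simps power2_eq_square)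
    then show "\<bar>nl2 f s\<bar> \<le> C * exp (- \<bar>s\<bar>)" using F1[of s] F2[of s] le[of s] C1e[of s] by linarith
    have "nl3 s = F 3 (exp s) * exp s ^ 3 + 3 * (F 2 (exp s) * exp s ^ 2) + F 1 (exp s) * exp s"
      by (simp add: nl3_def)
    then show "\<bar>nl3 s\<bar> \<le> C * exp (- \<bar>s\<bar>)" using F1[of s] F2[of s] F3[of s] le[of s] by linarith
    show "C \<ge> 0" using C1 b0[of 0] by (simp add: C_def)
  qed
qed

section \<open>Second-order expansion of the functional\<close>

lemma integrable_dominated:
  fixes m B :: "'a \<Rightarrow> real"
  assumes "integrable M B" "m \<in> borel_measurable M" "AE x in M. \<bar>m x\<bar> \<le> B x"
  shows "integrable M m" "\<bar>LINT x|M. m x\<bar> \<le> (LINT x|M. B x)"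
proof -
  show i: "integrable M m"
    by (rule Bochner_Integration.integrable_bound[OF assms(1,2)])
      (use assms(3) in \<open>eventually_elim, simp\<close>)
  have "\<bar>LINT x|M. m x\<bar> \<le> (LINT x|M. \<bar>m x\<bar>)" by (rule integral_abs_bound)
  also have "\<dots> \<le> (LINT x|M. B x)" using i assms by (intro integral_mono_AE) auto
  finally show "\<bar>LINT x|M. m x\<bar> \<le> (LINT x|M. B x)" .
qed

lemma segment_mean_value_bound:
  fixes k k' :: "real \<Rightarrow> real"
  assumes k: "\<And>t. (k has_real_derivative k' t) (at t)"
    and B: "\<And>t. \<bar>t - a\<bar> \<le> \<bar>h\<bar> \<Longrightarrow> \<bar>k' t\<bar> \<le> B" and b: "\<bar>b - a\<bar> \<le> \<bar>h\<bar>"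
  shows "\<bar>k b - k a\<bar> \<le> B * \<bar>b - a\<bar>"
proof -
  have "norm (k b - k a) \<le> B * norm (b - a)"
  proof (rule field_differentiable_bound[of "closed_segment a b" k k'])
    fix t assume "t \<in> closed_segment a b"
    then have "\<bar>t - a\<bar> \<le> \<bar>h\<bar>" using b by (auto simp: closed_segment_eq_real_ivl split: if_splits)
    then show "norm (k' t) \<le> B" using B by simp
  qed (auto intro: has_field_derivative_at_within k)
  then show ?thesis by simp
qed

text \<open>A shift of the argument by at most \<open>\<beta> + \<eta>\<close> changes the
  exponential weight by a bounded factor. With the sup bound for Sobolev functions, every estimate
  is thus reduced to the weight at \<open>\<sigma>\<close> alone.\<close>

lemma exp_abs_shift:
  assumes k: "\<And>t. \<bar>k t\<bar> \<le> C * exp (- \<bar>t\<bar>)" and t: "\<bar>t - (a + u)\<bar> \<le> \<bar>h\<bar>" "\<bar>u\<bar> \<le> \<beta>" "\<bar>h\<bar> \<le> \<eta>"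
  shows "\<bar>k t\<bar> \<le> C * exp (\<beta> + \<eta>) * exp (- \<bar>a :: real\<bar>)"
proof -
  have "0 \<le> C" using order_trans[OF abs_ge_zero k[of 0]] by simp
  moreover have "- \<bar>t\<bar> \<le> (\<beta> + \<eta>) + - \<bar>a\<bar>" using t by linarith
  then have "exp (- \<bar>t\<bar>) \<le> exp (\<beta> + \<eta>) * exp (- \<bar>a\<bar>)" by (simp add: exp_add[symmetric])
  ultimately have "C * exp (- \<bar>t\<bar>) \<le> C * (exp (\<beta> + \<eta>) * exp (- \<bar>a\<bar>))" by (intro mult_left_mono)
  then show ?thesis using k[of t] by (simp add: mult.assoc)
qed

lemma taylor_bound1:
  fixes g g' :: "real \<Rightarrow> real"
  assumes g: "\<And>t. (g has_real_derivative g' t) (at t)"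
    and b: "\<And>t. \<bar>g' t\<bar> \<le> C * exp (- \<bar>t\<bar>)" and uh: "\<bar>u\<bar> \<le> \<beta>" "\<bar>h\<bar> \<le> \<eta>"
  shows "\<bar>g (a + u + h) - g (a + u)\<bar> \<le> C * exp (\<beta> + \<eta>) * exp (- \<bar>a\<bar>) * \<bar>h\<bar>"
proof -
  have "\<bar>g (a + u + h) - g (a + u)\<bar> \<le> C * exp (\<beta> + \<eta>) * exp (- \<bar>a\<bar>) * \<bar>a + u + h - (a + u)\<bar>"
  proof (rule segment_mean_value_bound[OF g, of _ h])
    show "\<bar>g' t\<bar> \<le> C * exp (\<beta> + \<eta>) * exp (- \<bar>a\<bar>)" if "\<bar>t - (a + u)\<bar> \<le> \<bar>h\<bar>" for t
      by (rule exp_abs_shift[OF b that uh])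
  qed simp
  then show ?thesis by simp
qed

text \<open>The mean value bound is used twice, for \<open>g'\<close> and then for \<open>g\<close>
  minus its linear part; the factor 1/2 of Taylor's formula is given away.\<close>

lemma taylor_bound2:
  fixes g g' g'' :: "real \<Rightarrow> real"
  assumes g: "\<And>t. (g has_real_derivative g' t) (at t)" "\<And>t. (g' has_real_derivative g'' t) (at t)"
    and b: "\<And>t. \<bar>t - a\<bar> \<le> \<bar>h\<bar> \<Longrightarrow> \<bar>g'' t\<bar> \<le> K"
  shows "\<bar>g (a + h) - g a - g' a * h\<bar> \<le> K * h\<^sup>2"
proof -
  have K0: "0 \<le> K" using order_trans[OF abs_ge_zero b[of a]] by simp
  have "\<bar>(g (a + h) - g' a * (a + h)) - (g a - g' a * a)\<bar> \<le> K * \<bar>h\<bar> * \<bar>a + h - a\<bar>"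
  proof (rule segment_mean_value_bound[where h = h and k' = "\<lambda>t. g' t - g' a"])
    show "((\<lambda>t. g t - g' a * t) has_real_derivative g' t - g' a) (at t)" for t
      by (auto intro!: derivative_eq_intros g)
    fix t assume t: "\<bar>t - a\<bar> \<le> \<bar>h\<bar>"
    have "\<bar>g' t - g' a\<bar> \<le> K * \<bar>t - a\<bar>"
      by (rule segment_mean_value_bound[OF g(2) b t])
    also have "\<dots> \<le> K * \<bar>h\<bar>" using t K0 by (rule mult_left_mono)
    finally show "\<bar>g' t - g' a\<bar> \<le> K * \<bar>h\<bar>" .
  qed simp
  then show ?thesis by (simp add: algebra_simps power2_eq_square)
qed

text \<open>By this the polynomial weight obtained from the truncation argument suffices for the
  exponential weight of the nonlinearity.\<close>

lemma exp_minus_le_weight: "exp (- \<bar>t\<bar>) \<le> 2 / (1 + t\<^sup>2)" for t :: real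
proof -
  have "1 + \<bar>t\<bar> + \<bar>t\<bar>\<^sup>2 / 2 \<le> exp \<bar>t\<bar>" by (rule exp_lower_Taylor_quadratic) simp
  then have "1 + t\<^sup>2 \<le> 2 * exp \<bar>t\<bar>" by simp
  moreover have "1 + t\<^sup>2 > 0" using zero_le_power2[of t] by linarith
  ultimately show ?thesis by (simp add: exp_minus field_simps)
qed

lemma norm_wgrad_square: "(norm (wgrad u x))\<^sup>2 = (\<Sum>i\<in>UNIV. (wpd i u x)\<^sup>2)"
  by (simp only: power2_norm_eq_inner) (simp add: inner_vec_def wgrad_def power2_eq_square)

lemma inner_wgrad: "wgrad u x \<bullet> wgrad v x = (\<Sum>i\<in>UNIV. wpd i u x * wpd i v x)"
  by (simp add: inner_vec_def wgrad_def)

lemma H2_funD: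
  assumes "u \<in> H2_fun"
  shows "is_weak_pd i u (wpd i u)" "integrable torus u" "u \<in> borel_measurable torus"
    "wpd i u \<in> borel_measurable torus" "integrable torus (\<lambda>x. (u x)\<^sup>2)"
    "integrable torus (\<lambda>x. (wpd i u x)\<^sup>2)" "u \<in> L2" "wpd i u \<in> L2" "wpd j (wpd i u) \<in> L2"
proof -
  show "is_weak_pd i u (wpd i u)" "u \<in> L2" "wpd i u \<in> L2" "wpd j (wpd i u) \<in> L2"
    using assms by (simp_all add: H2_fun_iff)
  then show "integrable torus u" "u \<in> borel_measurable torus" "wpd i u \<in> borel_measurable torus"
    "integrable torus (\<lambda>x. (u x)\<^sup>2)" "integrable torus (\<lambda>x. (wpd i u x)\<^sup>2)"
    by (simp_all add: L2_def L1_integrable[OF L2_L1[OF \<open>u \<in> L2\<close>]])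
qed

abbreviation shift :: "(real^2 \<Rightarrow> real) \<Rightarrow> (real^2 \<Rightarrow> real) \<Rightarrow> real^2 \<Rightarrow> real" where
  "shift v u \<equiv> \<lambda>x. v x + u x"

section \<open>Weighted bounds for the shifted gradients\<close>

context
  fixes \<sigma> :: "real^2 \<Rightarrow> real" and w :: "2 \<Rightarrow> real^2 \<Rightarrow> real"
  assumes w: "\<And>i. is_weak_pd i \<sigma> (w i)" "\<And>i. integrable torus (\<lambda>x. (w i x)\<^sup>2 / (1 + (\<sigma> x)\<^sup>2))"
begin

definition weight :: "real^2 \<Rightarrow> real" where
  "weight x = exp (- \<bar>\<sigma> x\<bar>)"

definition weighted_const :: real where
  "weighted_const = (\<Sum>i\<in>UNIV. LINT x|torus. weight x * (w i x)\<^sup>2)"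

lemma sigma_integrable: "integrable torus \<sigma>" "\<sigma> \<in> borel_measurable torus" "integrable torus (w i)"
    "w i \<in> borel_measurable torus"
  using w(1)[of i] by (auto simp: is_weak_pd_def L1_def)

lemma weight_measurable: "weight \<in> borel_measurable torus"
  using sigma_integrable(2) unfolding weight_def[abs_def] by measurable

lemma weight_bounds: "0 \<le> weight x" "weight x \<le> 1"
  by (auto simp: weight_def)

lemma weighted_integrable: "integrable torus (\<lambda>x. weight x * (w i x)\<^sup>2)"
proof (rule integrable_dominated(1))
  show "integrable torus (\<lambda>x. 2 * ((w i x)\<^sup>2 / (1 + (\<sigma> x)\<^sup>2)))"
    by (rule integrable_mult_right) (rule w(2))
  show "(\<lambda>x. weight x * (w i x)\<^sup>2) \<in> borel_measurable torus"
    using weight_measurable sigma_integrable(4) by measurable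
  show "AE x in torus. \<bar>weight x * (w i x)\<^sup>2\<bar> \<le> 2 * ((w i x)\<^sup>2 / (1 + (\<sigma> x)\<^sup>2))"
  proof (rule AE_I2)
    fix x
    have "weight x * (w i x)\<^sup>2 \<le> 2 / (1 + (\<sigma> x)\<^sup>2) * (w i x)\<^sup>2"
      unfolding weight_def by (intro mult_right_mono exp_minus_le_weight) simp
    then show "\<bar>weight x * (w i x)\<^sup>2\<bar> \<le> 2 * ((w i x)\<^sup>2 / (1 + (\<sigma> x)\<^sup>2))"
      using weight_bounds[of x] by (simp add: abs_mult)
  qed
qed

text \<open>The choice behind \<open>wpd\<close> is made for the sum, so its relation to
  \<open>w i\<close> and to \<open>wpd i u\<close> holds only almost everywhere.\<close>

lemma shifted_weak_pd:
  assumes u: "u \<in> H2_fun"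
  shows "is_weak_pd i (shift \<sigma> u) (wpd i (shift \<sigma> u))"
    and "aeq (wpd i (shift \<sigma> u)) (\<lambda>x. w i x + wpd i u x)"
proof -
  have "is_weak_pd i (shift \<sigma> u) (\<lambda>x. w i x + wpd i u x)"
    by (rule is_weak_pd_add[OF w(1) H2_funD(1)[OF u]])
  then show "is_weak_pd i (shift \<sigma> u) (wpd i (shift \<sigma> u))"
    "aeq (wpd i (shift \<sigma> u)) (\<lambda>x. w i x + wpd i u x)"
    by (rule wpd_works wpd_aeqI)+
qed

lemma shifted_measurable:
  assumes u: "u \<in> H2_fun"
  shows "(shift \<sigma> u) \<in> borel_measurable torus"
    "wpd i (shift \<sigma> u) \<in> borel_measurable torus"
  using shifted_weak_pd(1)[OF u, of i] by (auto simp: is_weak_pd_def L1_def)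

lemma shifted_wpd_add:
  assumes u: "u \<in> H2_fun" and h: "h \<in> H2_fun"
  shows "aeq (wpd i (\<lambda>x. \<sigma> x + (u x + h x))) (\<lambda>x. wpd i (shift \<sigma> u) x + wpd i h x)"
proof (rule wpd_aeqI)
  have "is_weak_pd i (\<lambda>x. (\<sigma> x + u x) + h x) (\<lambda>x. wpd i (shift \<sigma> u) x + wpd i h x)"
    by (rule is_weak_pd_add[OF shifted_weak_pd(1)[OF u] H2_funD(1)[OF h]])
  then show "is_weak_pd i (\<lambda>x. \<sigma> x + (u x + h x)) (\<lambda>x. wpd i (shift \<sigma> u) x + wpd i h x)"
    by (simp add: add.assoc)
qed

text \<open>The square of the sum is at most twice the sum of squares; the singular part keeps its
  weight, and for the Sobolev part the weight is bounded by 1.\<close>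

lemma shifted_weighted:
  assumes u: "u \<in> H2_fun"
  shows "integrable torus (\<lambda>x. weight x * (wpd i (shift \<sigma> u) x)\<^sup>2)"
    and "(LINT x|torus. weight x * (wpd i (shift \<sigma> u) x)\<^sup>2) \<le> 2 * weighted_const + 2 * (H2_norm u)\<^sup>2"
proof -
  let ?a = "wpd i (shift \<sigma> u)"
  let ?B = "\<lambda>x. 2 * (weight x * (w i x)\<^sup>2) + 2 * (wpd i u x)\<^sup>2"
  have B: "integrable torus ?B" using weighted_integrable H2_funD(6)[OF u] by simp
  have m: "(\<lambda>x. weight x * (?a x)\<^sup>2) \<in> borel_measurable torus"
    using weight_measurable shifted_measurable(2)[OF u, of i] by measurable
  have ae: "AE x in torus. \<bar>weight x * (?a x)\<^sup>2\<bar> \<le> ?B x"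
    using shifted_weak_pd(2)[OF u, of i] unfolding aeq_def
  proof eventually_elim
    fix x assume e: "?a x = w i x + wpd i u x"
    have "(?a x)\<^sup>2 \<le> 2 * (w i x)\<^sup>2 + 2 * (wpd i u x)\<^sup>2"
      unfolding e using zero_le_power2[of "w i x - wpd i u x"] by (simp add: power2_eq_square algebra_simps)
    then have "weight x * (?a x)\<^sup>2 \<le> weight x * (2 * (w i x)\<^sup>2 + 2 * (wpd i u x)\<^sup>2)"
      by (intro mult_left_mono weight_bounds)
    also have "\<dots> \<le> ?B x"
      using mult_right_mono[OF weight_bounds(2)[of x], of "2 * (wpd i u x)\<^sup>2"] by (simp add: distrib_left)
    finally show "\<bar>weight x * (?a x)\<^sup>2\<bar> \<le> ?B x" using weight_bounds[of x] by (simp add: abs_mult)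
  qed
  show "integrable torus (\<lambda>x. weight x * (?a x)\<^sup>2)" by (rule integrable_dominated(1)[OF B m ae])
  have "(LINT x|torus. weight x * (?a x)\<^sup>2) \<le> (LINT x|torus. ?B x)"
    using integrable_dominated(2)[OF B m ae] by simp
  also have "\<dots> = 2 * (LINT x|torus. weight x * (w i x)\<^sup>2) + 2 * (LINT x|torus. (wpd i u x)\<^sup>2)"
    using weighted_integrable H2_funD(6)[OF u] by simp
  also have "\<dots> \<le> 2 * weighted_const + 2 * (H2_norm u)\<^sup>2"
  proof -
    have "(LINT x|torus. weight x * (w i x)\<^sup>2) \<le> weighted_const"
      unfolding weighted_const_def
      by (rule member_le_sum[of i UNIV "\<lambda>i. LINT x|torus. weight x * (w i x)\<^sup>2"])
        (auto intro!: Bochner_Integration.integral_nonneg simp: weight_bounds)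
    then show ?thesis using H2_inner_bounds(2)[of i u] by simp
  qed
  finally show "(LINT x|torus. weight x * (?a x)\<^sup>2) \<le> 2 * weighted_const + 2 * (H2_norm u)\<^sup>2" .
qed

lemma weighted_const_nonneg: "0 \<le> weighted_const"
  unfolding weighted_const_def by (intro sum_nonneg Bochner_Integration.integral_nonneg) (simp add: weight_bounds)

section \<open>Expansion for a nonlinearity with exponentially decaying derivatives\<close>

context
  fixes g0 g1 g2 g3 :: "real \<Rightarrow> real" and C :: real
  assumes g: "\<And>t. (g0 has_real_derivative g1 t) (at t)" "\<And>t. (g1 has_real_derivative g2 t) (at t)"
      "\<And>t. (g2 has_real_derivative g3 t) (at t)"
    and gb: "\<And>t. \<bar>g0 t\<bar> \<le> C" "\<And>t. \<bar>g1 t\<bar> \<le> C * exp (- \<bar>t\<bar>)" "\<And>t. \<bar>g2 t\<bar> \<le> C * exp (- \<bar>t\<bar>)"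
      "\<And>t. \<bar>g3 t\<bar> \<le> C * exp (- \<bar>t\<bar>)"
    and C0: "C \<ge> 0"
begin

lemma comp_measurable:
  assumes "u \<in> H2_fun"
  shows "(\<lambda>x. g0 (\<sigma> x + u x)) \<in> borel_measurable torus" "(\<lambda>x. g1 (\<sigma> x + u x)) \<in> borel_measurable torus"
    "(\<lambda>x. g2 (\<sigma> x + u x)) \<in> borel_measurable torus"
  by (rule measurable_compose[OF shifted_measurable(1)[OF assms]
        borel_measurable_continuous_onI[OF deriv_continuous]], rule g)+

lemma comp_weight:
  assumes "\<bar>u\<bar> \<le> \<beta>"
  shows "\<bar>g1 (\<sigma> x + u)\<bar> \<le> C * exp \<beta> * weight x" "\<bar>g2 (\<sigma> x + u)\<bar> \<le> C * exp \<beta> * weight x"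
proof -
  have "- \<bar>\<sigma> x + u\<bar> \<le> \<beta> + - \<bar>\<sigma> x\<bar>" using assms by linarith
  then have "exp (- \<bar>\<sigma> x + u\<bar>) \<le> exp \<beta> * weight x" by (simp add: weight_def exp_add[symmetric])
  then have "C * exp (- \<bar>\<sigma> x + u\<bar>) \<le> C * (exp \<beta> * weight x)" using C0 by (intro mult_left_mono)
  then show "\<bar>g1 (\<sigma> x + u)\<bar> \<le> C * exp \<beta> * weight x" "\<bar>g2 (\<sigma> x + u)\<bar> \<le> C * exp \<beta> * weight x"
    using gb(2,3)[of "\<sigma> x + u"] by (simp_all add: mult.assoc)
qed

text \<open>The weight is kept on the square of \<open>a\<close>, later the derivative of the
  singular function, and dropped from that of \<open>b\<close>, later the derivative of a Sobolev
  function.\<close>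

lemma weighted_young: "weight x * \<bar>a * b\<bar> \<le> weight x * a\<^sup>2 + b\<^sup>2"
proof -
  have "2 * \<bar>a * b\<bar> \<le> a\<^sup>2 + b\<^sup>2"
    using sum_squares_bound[of "\<bar>a\<bar>" "\<bar>b\<bar>"] by (simp add: abs_mult mult.assoc)
  then have "\<bar>a * b\<bar> \<le> a\<^sup>2 + b\<^sup>2" using abs_ge_zero[of "a * b"] by linarith
  then have "weight x * \<bar>a * b\<bar> \<le> weight x * (a\<^sup>2 + b\<^sup>2)" by (intro mult_left_mono weight_bounds)
  also have "\<dots> \<le> weight x * a\<^sup>2 + b\<^sup>2"
    using mult_right_mono[OF weight_bounds(2)[of x], of "b\<^sup>2"] by (simp add: distrib_left)
  finally show ?thesis .
qed

text \<open>With \<open>a\<close> and \<open>b\<close> the derivatives of the shifted function and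
  of the increment, the density \<open>g1\<close> times the square of \<open>a\<close> has the
  linear part \<open>g2 * a\<^sup>2 * h + 2 * g1 * a * b\<close>. Here \<open>E\<close> controls the
  weighted square of \<open>a\<close>, while \<open>\<kappa>\<close> accounts for the displacement
  of the argument by \<open>u\<close> and \<open>h\<close>. The remainder is quadratic in the sup
  bound \<open>\<eta>\<close> and the norm of \<open>h\<close> together.\<close>

lemma gradient_terms:
  fixes i :: 2
  assumes u: "u \<in> H2_fun" and h: "h \<in> H2_fun"
    and \<beta>: "AE x in torus. \<bar>u x\<bar> \<le> \<beta>" and \<eta>: "AE x in torus. \<bar>h x\<bar> \<le> \<eta>" "\<eta> \<ge> 0"
  defines "a \<equiv> wpd i (shift \<sigma> u)" and "b \<equiv> wpd i h"
    and "E \<equiv> 2 * weighted_const + 2 * (H2_norm u)\<^sup>2" and "\<kappa> \<equiv> C * exp (\<beta> + \<eta>)"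
  shows "integrable torus (\<lambda>x. g1 (\<sigma> x + u x) * (a x)\<^sup>2)"
    and "integrable torus (\<lambda>x. g2 (\<sigma> x + u x) * (a x)\<^sup>2 * h x)"
    and "\<bar>LINT x|torus. g2 (\<sigma> x + u x) * (a x)\<^sup>2 * h x\<bar> \<le> \<kappa> * \<eta> * E"
    and "integrable torus (\<lambda>x. g1 (\<sigma> x + u x) * (a x * b x))"
    and "\<bar>LINT x|torus. g1 (\<sigma> x + u x) * (a x * b x)\<bar> \<le> \<kappa> * (E + (H2_norm h)\<^sup>2)"
    and "\<bar>(LINT x|torus. g1 (\<sigma> x + (u x + h x)) * (wpd i (\<lambda>x. \<sigma> x + (u x + h x)) x)\<^sup>2)
        - (LINT x|torus. g1 (\<sigma> x + u x) * (a x)\<^sup>2)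
        - (LINT x|torus. g2 (\<sigma> x + u x) * (a x)\<^sup>2 * h x)
        - 2 * (LINT x|torus. g1 (\<sigma> x + u x) * (a x * b x))\<bar> \<le> 2 * \<kappa> * (\<eta>\<^sup>2 * E + (H2_norm h)\<^sup>2)"
proof -
  let ?v = "\<lambda>x. \<sigma> x + u x"
  have \<kappa>0: "\<kappa> \<ge> 0" using C0 by (simp add: \<kappa>_def)
  have E: "integrable torus (\<lambda>x. weight x * (a x)\<^sup>2)" "(LINT x|torus. weight x * (a x)\<^sup>2) \<le> E"
    unfolding a_def E_def by (rule shifted_weighted[OF u])+
  have b: "integrable torus (\<lambda>x. (b x)\<^sup>2)" "(LINT x|torus. (b x)\<^sup>2) \<le> (H2_norm h)\<^sup>2"
    unfolding b_def by (rule H2_funD(6)[OF h] H2_inner_bounds)+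
  have meas: "a \<in> borel_measurable torus" "b \<in> borel_measurable torus" "h \<in> borel_measurable torus"
    unfolding a_def b_def by (rule shifted_measurable(2)[OF u] H2_funD(3,4)[OF h])+
  note mg = comp_measurable[OF u]
  \<comment> \<open>Enlarging the bound to \<open>\<beta> + \<eta>\<close> lets the single constant
    \<open>\<kappa>\<close> serve at the base point and at the displaced point.\<close>
  have \<beta>': "\<bar>u x\<bar> \<le> \<beta> \<Longrightarrow> \<bar>u x\<bar> \<le> \<beta> + \<eta>" for x using \<eta>(2) by simp
  have gk: "\<bar>g1 (?v x)\<bar> \<le> \<kappa> * weight x" "\<bar>g2 (?v x)\<bar> \<le> \<kappa> * weight x" if "\<bar>u x\<bar> \<le> \<beta>" for x
    unfolding \<kappa>_def by (rule comp_weight[OF \<beta>'[OF that]])+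
  have iB1: "integrable torus (\<lambda>x. \<kappa> * (weight x * (a x)\<^sup>2))" using E by simp
  show i1: "integrable torus (\<lambda>x. g1 (?v x) * (a x)\<^sup>2)"
  proof (rule integrable_dominated(1)[OF iB1])
    show "(\<lambda>x. g1 (?v x) * (a x)\<^sup>2) \<in> borel_measurable torus" using mg meas by measurable
    show "AE x in torus. \<bar>g1 (?v x) * (a x)\<^sup>2\<bar> \<le> \<kappa> * (weight x * (a x)\<^sup>2)"
      using \<beta>
    proof eventually_elim
      case (elim x)
      show ?case using mult_right_mono[OF gk(1)[OF elim], of "(a x)\<^sup>2"] by (simp add: abs_mult mult.assoc)
    qed
  qed
  have iB2: "integrable torus (\<lambda>x. \<kappa> * \<eta> * (weight x * (a x)\<^sup>2))" using E by simp
  have m2: "(\<lambda>x. g2 (?v x) * (a x)\<^sup>2 * h x) \<in> borel_measurable torus" using mg meas by measurable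
  have ae2: "AE x in torus. \<bar>g2 (?v x) * (a x)\<^sup>2 * h x\<bar> \<le> \<kappa> * \<eta> * (weight x * (a x)\<^sup>2)"
    using \<beta> \<eta>(1)
  proof eventually_elim
    case (elim x)
    have "\<bar>g2 (?v x)\<bar> * (a x)\<^sup>2 * \<bar>h x\<bar> \<le> \<kappa> * weight x * (a x)\<^sup>2 * \<eta>"
      using gk(2)[OF elim(1)] elim \<kappa>0 weight_bounds[of x] by (intro mult_mono) auto
    then show ?case by (simp add: abs_mult ac_simps)
  qed
  show i2: "integrable torus (\<lambda>x. g2 (?v x) * (a x)\<^sup>2 * h x)"
    by (rule integrable_dominated(1)[OF iB2 m2 ae2])
  have "\<bar>LINT x|torus. g2 (?v x) * (a x)\<^sup>2 * h x\<bar> \<le> (LINT x|torus. \<kappa> * \<eta> * (weight x * (a x)\<^sup>2))"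
    by (rule integrable_dominated(2)[OF iB2 m2 ae2])
  also have "\<dots> = \<kappa> * \<eta> * (LINT x|torus. weight x * (a x)\<^sup>2)" by simp
  also have "\<dots> \<le> \<kappa> * \<eta> * E" using E \<kappa>0 \<eta>(2) by (intro mult_left_mono) auto
  finally show "\<bar>LINT x|torus. g2 (?v x) * (a x)\<^sup>2 * h x\<bar> \<le> \<kappa> * \<eta> * E" .
  have iB3: "integrable torus (\<lambda>x. \<kappa> * (weight x * (a x)\<^sup>2 + (b x)\<^sup>2))" using E b by simp
  have m3: "(\<lambda>x. g1 (?v x) * (a x * b x)) \<in> borel_measurable torus" using mg meas by measurable
  have ae3: "AE x in torus. \<bar>g1 (?v x) * (a x * b x)\<bar> \<le> \<kappa> * (weight x * (a x)\<^sup>2 + (b x)\<^sup>2)"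
    using \<beta>
  proof eventually_elim
    case (elim x)
    have "\<bar>g1 (?v x)\<bar> * \<bar>a x * b x\<bar> \<le> \<kappa> * weight x * \<bar>a x * b x\<bar>"
      by (intro mult_right_mono gk elim) auto
    also have "\<dots> = \<kappa> * (weight x * \<bar>a x * b x\<bar>)" by simp
    also have "\<dots> \<le> \<kappa> * (weight x * (a x)\<^sup>2 + (b x)\<^sup>2)" by (intro mult_left_mono weighted_young \<kappa>0)
    finally show ?case by (simp only: abs_mult)
  qed
  show i3: "integrable torus (\<lambda>x. g1 (?v x) * (a x * b x))"
    by (rule integrable_dominated(1)[OF iB3 m3 ae3])
  have "\<bar>LINT x|torus. g1 (?v x) * (a x * b x)\<bar> \<le> (LINT x|torus. \<kappa> * (weight x * (a x)\<^sup>2 + (b x)\<^sup>2))"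
    by (rule integrable_dominated(2)[OF iB3 m3 ae3])
  also have "\<dots> = \<kappa> * ((LINT x|torus. weight x * (a x)\<^sup>2) + (LINT x|torus. (b x)\<^sup>2))"
    using E b by simp
  also have "\<dots> \<le> \<kappa> * (E + (H2_norm h)\<^sup>2)" by (intro mult_left_mono add_mono E b \<kappa>0)
  finally show "\<bar>LINT x|torus. g1 (?v x) * (a x * b x)\<bar> \<le> \<kappa> * (E + (H2_norm h)\<^sup>2)" .

  let ?c = "\<lambda>x. g1 (\<sigma> x + (u x + h x)) * (wpd i (\<lambda>x. \<sigma> x + (u x + h x)) x)\<^sup>2"
  let ?r = "\<lambda>x. ?c x - g1 (?v x) * (a x)\<^sup>2 - g2 (?v x) * (a x)\<^sup>2 * h x - 2 * (g1 (?v x) * (a x * b x))"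
  let ?B = "\<lambda>x. 2 * \<kappa> * (\<eta>\<^sup>2 * (weight x * (a x)\<^sup>2) + (b x)\<^sup>2)"
  note uh = H2_fun_add[OF u h]
  have mr: "?r \<in> borel_measurable torus"
    using m2 m3 i1 comp_measurable(2)[OF uh] shifted_measurable(2)[OF uh, of i] by measurable
  have iB: "integrable torus ?B" using E b by simp
  have ae: "AE x in torus. \<bar>?r x\<bar> \<le> ?B x"
    using \<beta> \<eta>(1) shifted_wpd_add[OF u h, of i, unfolded aeq_def]
  proof eventually_elim
    case (elim x)
    define W where "W = \<kappa> * weight x"
    have W0: "W \<ge> 0" using \<kappa>0 weight_bounds[of x] by (simp add: W_def)
    have "\<bar>u x + h x\<bar> \<le> \<beta> + \<eta>" using elim by linarith
    then have t0: "\<bar>g1 (\<sigma> x + u x + h x)\<bar> \<le> W"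
      using comp_weight(1)[of "u x + h x" "\<beta> + \<eta>" x] by (simp add: W_def \<kappa>_def add.assoc)
    have t1: "\<bar>g1 (\<sigma> x + u x + h x) - g1 (?v x)\<bar> \<le> W * \<bar>h x\<bar>"
      using taylor_bound1[OF g(2) gb(3) elim(1,2), of "\<sigma> x"] by (simp add: W_def \<kappa>_def weight_def)
    have t2: "\<bar>g1 (\<sigma> x + u x + h x) - g1 (?v x) - g2 (?v x) * h x\<bar> \<le> W * (h x)\<^sup>2"
      by (rule taylor_bound2[OF g(2,3)], unfold W_def \<kappa>_def weight_def)
        (rule exp_abs_shift[OF gb(4) _ elim(1,2)])
    have h2: "(h x)\<^sup>2 \<le> \<eta>\<^sup>2" using elim(2) \<eta>(2) by (simp add: abs_le_square_iff[symmetric])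
    \<comment> \<open>The remainder is split by the order in \<open>b\<close>: a second-order Taylor
      error times the square of \<open>a\<close>, a first-order difference times the mixed product,
      and the displaced value times the square of \<open>b\<close>.\<close>
    let ?X = "(g1 (\<sigma> x + u x + h x) - g1 (?v x) - g2 (?v x) * h x) * (a x)\<^sup>2"
    let ?Y = "2 * ((g1 (\<sigma> x + u x + h x) - g1 (?v x)) * (a x * b x))"
    let ?Z = "g1 (\<sigma> x + u x + h x) * (b x)\<^sup>2"
    have e: "?r x = ?X + ?Y + ?Z"
      using elim(3) by (simp add: a_def b_def power2_eq_square add.assoc algebra_simps)
    have X: "\<bar>?X\<bar> \<le> W * (\<eta>\<^sup>2 * (a x)\<^sup>2)"
    proof -
      have "\<bar>?X\<bar> \<le> W * (h x)\<^sup>2 * (a x)\<^sup>2" unfolding abs_mult by (simp add: mult_right_mono t2)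
      also have "\<dots> \<le> W * \<eta>\<^sup>2 * (a x)\<^sup>2" by (intro mult_right_mono mult_left_mono h2 W0) simp
      finally show ?thesis by (simp add: mult.assoc)
    qed
    have Y: "\<bar>?Y\<bar> \<le> W * (\<eta>\<^sup>2 * (a x)\<^sup>2 + (b x)\<^sup>2)"
    proof -
      have "\<bar>?Y\<bar> = 2 * (\<bar>g1 (\<sigma> x + u x + h x) - g1 (?v x)\<bar> * \<bar>a x * b x\<bar>)" by (simp add: abs_mult)
      also have "\<dots> \<le> 2 * (W * \<bar>h x\<bar> * \<bar>a x * b x\<bar>)"
        by (intro mult_left_mono mult_right_mono t1) auto
      also have "\<dots> = W * (2 * \<bar>h x * a x\<bar> * \<bar>b x\<bar>)" by (simp add: abs_mult)
      also have "\<dots> \<le> W * (\<bar>h x * a x\<bar>\<^sup>2 + \<bar>b x\<bar>\<^sup>2)"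
        by (intro mult_left_mono sum_squares_bound W0)
      also have "\<dots> \<le> W * (\<eta>\<^sup>2 * (a x)\<^sup>2 + (b x)\<^sup>2)"
        using mult_right_mono[OF h2, of "(a x)\<^sup>2"] by (intro mult_left_mono W0) (simp add: power_mult_distrib)
      finally show ?thesis .
    qed
    have Z: "\<bar>?Z\<bar> \<le> W * (b x)\<^sup>2" unfolding abs_mult by (simp add: mult_right_mono t0)
    have "\<bar>?r x\<bar> \<le> W * (\<eta>\<^sup>2 * (a x)\<^sup>2) + W * (\<eta>\<^sup>2 * (a x)\<^sup>2 + (b x)\<^sup>2) + W * (b x)\<^sup>2"
      unfolding e using X Y Z by linarith
    also have "\<dots> = 2 * \<kappa> * (\<eta>\<^sup>2 * (weight x * (a x)\<^sup>2) + weight x * (b x)\<^sup>2)"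
      by (simp add: W_def algebra_simps)
    also have "\<dots> \<le> ?B x"
      using mult_right_mono[OF weight_bounds(2)[of x], of "(b x)\<^sup>2"] \<kappa>0
      by (intro mult_left_mono) auto
    finally show ?case .
  qed
  have ir: "integrable torus ?r" by (rule integrable_dominated(1)[OF iB mr ae])
  \<comment> \<open>The displaced density is recovered as the remainder plus terms already known to
    be integrable.\<close>
  have ic: "integrable torus ?c"
  proof -
    have "integrable torus (\<lambda>x. ?r x + g1 (?v x) * (a x)\<^sup>2 + g2 (?v x) * (a x)\<^sup>2 * h x + 2 * (g1 (?v x) * (a x * b x)))"
      by (intro Bochner_Integration.integrable_add integrable_mult_right ir i1 i2 i3)
    then show ?thesis by simp
  qed
  have "(LINT x|torus. ?c x) - (LINT x|torus. g1 (?v x) * (a x)\<^sup>2)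
        - (LINT x|torus. g2 (?v x) * (a x)\<^sup>2 * h x)
        - 2 * (LINT x|torus. g1 (?v x) * (a x * b x)) = (LINT x|torus. ?r x)"
    using ic i1 i2 i3 by simp
  moreover have "\<bar>LINT x|torus. ?r x\<bar> \<le> (LINT x|torus. ?B x)"
    by (rule integrable_dominated(2)[OF iB mr ae])
  moreover have "(LINT x|torus. ?B x) = 2 * \<kappa> * (\<eta>\<^sup>2 * (LINT x|torus. weight x * (a x)\<^sup>2) + (LINT x|torus. (b x)\<^sup>2))"
    using E b by simp
  moreover have "\<dots> \<le> 2 * \<kappa> * (\<eta>\<^sup>2 * E + (H2_norm h)\<^sup>2)"
    using \<kappa>0 E(2) b(2) by (intro mult_left_mono add_mono) auto
  ultimately show "\<bar>(LINT x|torus. ?c x) - (LINT x|torus. g1 (?v x) * (a x)\<^sup>2)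
        - (LINT x|torus. g2 (?v x) * (a x)\<^sup>2 * h x)
        - 2 * (LINT x|torus. g1 (?v x) * (a x * b x))\<bar> \<le> 2 * \<kappa> * (\<eta>\<^sup>2 * E + (H2_norm h)\<^sup>2)"
    by linarith
qed

text \<open>No gradient occurs here, so it is enough that the squared deviation of \<open>g0\<close>
  from \<open>s\<close> has a globally bounded second derivative; \<open>K\<close> is that
  bound.\<close>

lemma potential_terms:
  fixes s :: real
  assumes u: "u \<in> H2_fun" and h: "h \<in> H2_fun"
  defines "K \<equiv> 2 * C\<^sup>2 + 2 * (C + \<bar>s\<bar>) * C"
  shows "integrable torus (\<lambda>x. (g0 (\<sigma> x + u x) - s)\<^sup>2)"
    and "integrable torus (\<lambda>x. g1 (\<sigma> x + u x) * (g0 (\<sigma> x + u x) - s) * h x)"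
    and "\<bar>LINT x|torus. g1 (\<sigma> x + u x) * (g0 (\<sigma> x + u x) - s) * h x\<bar> \<le> K * H2_norm h"
    and "\<bar>(LINT x|torus. (g0 (\<sigma> x + (u x + h x)) - s)\<^sup>2) - (LINT x|torus. (g0 (\<sigma> x + u x) - s)\<^sup>2)
        - 2 * (LINT x|torus. g1 (\<sigma> x + u x) * (g0 (\<sigma> x + u x) - s) * h x)\<bar> \<le> K * (H2_norm h)\<^sup>2"
proof -
  let ?v = "\<lambda>x. \<sigma> x + u x"
  have K0: "K \<ge> 0" using C0 by (simp add: K_def)
  have Ce: "C * exp (- \<bar>t\<bar>) \<le> C" for t using C0 by (simp add: mult_left_le)
  have b1: "\<bar>g1 t\<bar> \<le> C" for t using gb(2)[of t] Ce[of t] by linarith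
  have b2: "\<bar>g2 t\<bar> \<le> C" for t using gb(3)[of t] Ce[of t] by linarith
  have b0: "\<bar>g0 t - s\<bar> \<le> C + \<bar>s\<bar>" for t using gb(1)[of t] by linarith
  have P: "integrable torus (\<lambda>x. (g0 (\<sigma> x + u x) - s)\<^sup>2)" if u: "u \<in> H2_fun" for u
  proof (rule finite_measure.integrable_const_bound[OF finite_measure_torus, where B = "(C + \<bar>s\<bar>)\<^sup>2"])
    show "AE x in torus. norm ((g0 (\<sigma> x + u x) - s)\<^sup>2) \<le> (C + \<bar>s\<bar>)\<^sup>2"
    proof (rule AE_I2)
      fix x
      show "norm ((g0 (\<sigma> x + u x) - s)\<^sup>2) \<le> (C + \<bar>s\<bar>)\<^sup>2"
        using power_mono[OF b0[of "\<sigma> x + u x"] abs_ge_zero, of 2] by simp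
    qed
    show "(\<lambda>x. (g0 (\<sigma> x + u x) - s)\<^sup>2) \<in> borel_measurable torus"
      using comp_measurable(1)[OF u] by measurable
  qed
  show "integrable torus (\<lambda>x. (g0 (?v x) - s)\<^sup>2)" by (rule P[OF u])
  have mh: "h \<in> borel_measurable torus" by (rule H2_funD(3)[OF h])
  note mg = comp_measurable[OF u]
  have m: "(\<lambda>x. g1 (?v x) * (g0 (?v x) - s) * h x) \<in> borel_measurable torus" using mg mh by measurable
  have CK: "C * (C + \<bar>s\<bar>) \<le> K" using C0 by (simp add: K_def algebra_simps power2_eq_square)
  have le: "\<bar>g1 (?v x) * (g0 (?v x) - s) * h x\<bar> \<le> K * \<bar>h x\<bar>" for x
  proof -
    have "\<bar>g1 (?v x)\<bar> * \<bar>g0 (?v x) - s\<bar> \<le> C * (C + \<bar>s\<bar>)" using C0 by (intro mult_mono b1 b0) auto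
    then have "\<bar>g1 (?v x)\<bar> * \<bar>g0 (?v x) - s\<bar> * \<bar>h x\<bar> \<le> K * \<bar>h x\<bar>" using CK by (intro mult_right_mono) auto
    then show ?thesis by (simp add: abs_mult)
  qed
  have iB: "integrable torus (\<lambda>x. K * \<bar>h x\<bar>)" using H2_funD(2)[OF h] by simp
  show i: "integrable torus (\<lambda>x. g1 (?v x) * (g0 (?v x) - s) * h x)"
    by (rule integrable_dominated(1)[OF iB m]) (use le in simp)
  have "\<bar>LINT x|torus. g1 (?v x) * (g0 (?v x) - s) * h x\<bar> \<le> (LINT x|torus. K * \<bar>h x\<bar>)"
    by (rule integrable_dominated(2)[OF iB m]) (use le in simp)
  also have "\<dots> = K * (LINT x|torus. \<bar>h x\<bar>)" by simp
  also have "\<dots> \<le> K * H2_norm h" by (intro mult_left_mono H2_L1_bounds h K0)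
  finally show "\<bar>LINT x|torus. g1 (?v x) * (g0 (?v x) - s) * h x\<bar> \<le> K * H2_norm h" .
  let ?r = "\<lambda>x. (g0 (\<sigma> x + (u x + h x)) - s)\<^sup>2 - (g0 (?v x) - s)\<^sup>2 - 2 * (g1 (?v x) * (g0 (?v x) - s) * h x)"
  note Puh = P[OF H2_fun_add[OF u h]]
  have rle: "\<bar>?r x\<bar> \<le> K * (h x)\<^sup>2" for x
  proof -
    \<comment> \<open>The squared deviation from \<open>s\<close> and its first two
      derivatives.\<close>
    let ?p = "\<lambda>t. (g0 t - s)\<^sup>2" and ?p' = "\<lambda>t. 2 * (g1 t * (g0 t - s))" and ?p'' = "\<lambda>t. 2 * (g1 t)\<^sup>2 + 2 * (g0 t - s) * g2 t"
    have d: "(?p has_real_derivative ?p' t) (at t)" "(?p' has_real_derivative ?p'' t) (at t)" for t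
      by (auto intro!: derivative_eq_intros g simp: power2_eq_square algebra_simps)
    have p2: "\<bar>?p'' t\<bar> \<le> K" for t
    proof -
      have "(g1 t)\<^sup>2 \<le> C\<^sup>2" using power_mono[OF b1[of t], of 2] by simp
      moreover obtain Y D where Y: "Y = (g0 t - s) * g2 t" "D = (C + \<bar>s\<bar>) * C" by simp
      have "\<bar>Y\<bar> \<le> D"
        unfolding Y abs_mult using C0 by (intro mult_mono b0 b2) auto
      moreover have "0 \<le> (g1 t)\<^sup>2" by simp
      ultimately have "\<bar>2 * (g1 t)\<^sup>2 + 2 * Y\<bar> \<le> 2 * C\<^sup>2 + 2 * D" by linarith
      then show ?thesis unfolding K_def Y by (simp only: mult.assoc)
    qed
    show ?thesis using taylor_bound2[OF d p2, of "?v x" "h x"] by (simp add: add.assoc)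
  qed
  have ih: "integrable torus (\<lambda>x. K * (h x)\<^sup>2)" using H2_funD(5)[OF h] by simp
  have ir: "integrable torus ?r" using P[OF u] Puh i by simp
  have "(LINT x|torus. (g0 (\<sigma> x + (u x + h x)) - s)\<^sup>2) - (LINT x|torus. (g0 (?v x) - s)\<^sup>2)
        - 2 * (LINT x|torus. g1 (?v x) * (g0 (?v x) - s) * h x) = (LINT x|torus. ?r x)"
    using P[OF u] Puh i by simp
  moreover have "\<bar>LINT x|torus. ?r x\<bar> \<le> (LINT x|torus. K * (h x)\<^sup>2)"
    by (rule integrable_dominated(2)[OF ih]) (use ir rle in simp_all)
  moreover have "(LINT x|torus. K * (h x)\<^sup>2) \<le> K * (H2_norm h)\<^sup>2"
    using H2_inner_bounds(1)[of h] K0 by (simp add: mult_left_mono)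
  ultimately show "\<bar>(LINT x|torus. (g0 (\<sigma> x + (u x + h x)) - s)\<^sup>2) - (LINT x|torus. (g0 (?v x) - s)\<^sup>2)
        - 2 * (LINT x|torus. g1 (?v x) * (g0 (?v x) - s) * h x)\<bar> \<le> K * (H2_norm h)\<^sup>2"
    by linarith
qed

end
end

section \<open>The derivative of the functional\<close>

text \<open>A quadratic remainder that is locally uniform in the base point forces the derivative to be
  locally Lipschitz: compare the expansions of \<open>J (u + k + h)\<close> at \<open>u\<close> and at \<open>u + k\<close>
  for \<open>h\<close> of the size of \<open>k\<close>.\<close>

lemma C1_functional_criterion:
  fixes J :: "'a::real_normed_vector \<Rightarrow> real"
  assumes lin: "\<And>u. linear (L u)"
    and bd: "\<And>R. \<exists>K. \<forall>u h. norm u \<le> R \<longrightarrow> norm h \<le> 1 \<longrightarrow>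
      \<bar>L u h\<bar> \<le> K \<and> \<bar>J (u + h) - J u - L u h\<bar> \<le> K * (norm h)\<^sup>2"
  shows "(J has_derivative L u) (at u)" and "C1_functional J"
proof -
  have bl: "bounded_linear (L u)" for u
  proof -
    obtain K where K: "\<And>h. norm h \<le> 1 \<Longrightarrow> \<bar>L u h\<bar> \<le> K" using bd[of "norm u"] by auto
    have "norm (L u h) \<le> norm h * K" for h
    proof (cases "h = 0")
      case True
      then show ?thesis using linear_0[OF lin] by simp
    next
      case False
      have "\<bar>L u ((1 / norm h) *\<^sub>R h)\<bar> \<le> K" using False by (intro K) simp
      then show ?thesis using False by (simp add: linear_scale[OF lin] abs_mult field_simps)
    qed
    then show ?thesis using lin[of u] by (intro bounded_linear_intro) (auto simp: linear_add linear_scale)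
  qed
  show D: "(J has_derivative L u) (at u)" for u
    unfolding has_derivative_at
  proof (intro conjI bl)
    obtain K where K: "\<And>h. norm h \<le> 1 \<Longrightarrow> \<bar>J (u + h) - J u - L u h\<bar> \<le> K * (norm h)\<^sup>2"
      using bd[of "norm u"] by auto
    show "(\<lambda>h. norm (J (u + h) - J u - L u h) / norm h) \<midarrow>0\<rightarrow> 0"
    proof (rule Lim_null_comparison)
      show "((\<lambda>h. K * norm h) \<longlongrightarrow> 0) (at (0::'a))"
        by (auto intro!: tendsto_eq_intros)
      have "norm (norm (J (u + h) - J u - L u h) / norm h) \<le> K * norm h" if "norm h \<le> 1" for h
        using K[OF that] by (cases "h = 0") (simp_all add: pos_divide_le_eq power2_eq_square mult.assoc)
      then show "\<forall>\<^sub>F h in at 0. norm (norm (J (u + h) - J u - L u h) / norm h) \<le> K * norm h"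
        unfolding eventually_at by (intro exI[of _ 1]) auto
    qed
  qed
  define J' where "J' u = Blinfun (L u)" for u
  have app: "blinfun_apply (J' u) = L u" for u
    unfolding J'_def by (rule bounded_linear_Blinfun_apply[OF bl])
  have "continuous_on UNIV J'"
    unfolding continuous_on_iff
  proof (intro ballI allI impI)
    fix u :: 'a and e :: real assume e: "e > 0"
    obtain K where K: "\<And>v h. norm v \<le> norm u + 1 \<Longrightarrow> norm h \<le> 1 \<Longrightarrow> \<bar>J (v + h) - J v - L v h\<bar> \<le> K * (norm h)\<^sup>2"
      and K': "\<And>v h. norm v \<le> norm u + 1 \<Longrightarrow> norm h \<le> 1 \<Longrightarrow> \<bar>L v h\<bar> \<le> K"
      using bd[of "norm u + 1"] by blast
    have K0: "K \<ge> 0" using order_trans[OF abs_ge_zero K'[of u 0]] by simp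
    have lip: "norm (J' (u + k) - J' u) \<le> 6 * K * norm k" if k: "norm k \<le> 1 / 2" for k
    proof (rule norm_blinfun_bound)
      show "0 \<le> 6 * K * norm k" using K0 by simp
      fix h
      \<comment> \<open>The three expansions have increments \<open>k + h\<close>, \<open>h\<close>
        and \<open>k\<close>. The first has norm at most twice that of \<open>k\<close> and costs 4,
        the others 1 each; this is the constant 6.\<close>
      have main: "\<bar>L (u + k) h - L u h\<bar> \<le> 6 * K * (norm k)\<^sup>2" if h: "norm h = norm k" for h
      proof -
        have n: "norm (u + k) \<le> norm u + 1" using norm_triangle_ineq[of u k] k by linarith
        have kh: "norm (k + h) \<le> 2 * norm k" using norm_triangle_ineq[of k h] h by linarith
        have 1: "\<bar>J (u + (k + h)) - J u - L u (k + h)\<bar> \<le> K * (2 * norm k)\<^sup>2"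
        proof -
          have "\<bar>J (u + (k + h)) - J u - L u (k + h)\<bar> \<le> K * (norm (k + h))\<^sup>2"
            by (rule K) (use kh k in linarith)+
          also have "\<dots> \<le> K * (2 * norm k)\<^sup>2" using kh K0 by (intro mult_left_mono power_mono) auto
          finally show ?thesis .
        qed
        have 2: "\<bar>J (u + k + h) - J (u + k) - L (u + k) h\<bar> \<le> K * (norm k)\<^sup>2"
          using K[OF n, of h] h k by simp
        have 3: "\<bar>J (u + k) - J u - L u k\<bar> \<le> K * (norm k)\<^sup>2" using K[of u k] k by simp
        have "K * (2 * norm k)\<^sup>2 = 4 * (K * (norm k)\<^sup>2)" by (simp add: power_mult_distrib)
        then show ?thesis
          using 1 2 3 by (simp add: add.assoc linear_add[OF lin] mult.assoc)
      qed
      show "norm (blinfun_apply (J' (u + k) - J' u) h) \<le> 6 * K * norm k * norm h"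
      proof (cases "h = 0 \<or> k = 0")
        case True
        then show ?thesis by (auto simp: blinfun.zero_right)
      next
        case False
        \<comment> \<open>Scales \<open>h\<close> to the length of \<open>k\<close>, for which
          \<open>main\<close> applies; linearity undoes the scaling.\<close>
        define c where "c = norm k / norm h"
        have c: "c > 0" "c * norm h = norm k" using False by (auto simp: c_def)
        have "\<bar>L (u + k) (c *\<^sub>R h) - L u (c *\<^sub>R h)\<bar> \<le> 6 * K * (norm k)\<^sup>2"
          using c by (intro main) simp
        moreover have "L (u + k) (c *\<^sub>R h) - L u (c *\<^sub>R h) = c * (L (u + k) h - L u h)"
          by (simp add: linear_scale[OF lin] right_diff_distrib)
        ultimately have "c * \<bar>L (u + k) h - L u h\<bar> \<le> 6 * K * (norm k)\<^sup>2"
          using c(1) by (simp add: abs_mult)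
        also have "\<dots> = c * (6 * K * norm k * norm h)"
          by (simp add: power2_eq_square flip: c(2))
        finally have "\<bar>L (u + k) h - L u h\<bar> \<le> 6 * K * norm k * norm h"
          using c(1) by simp
        then show ?thesis by (simp add: app blinfun.diff_left)
      qed
    qed
    show "\<exists>d>0. \<forall>x'\<in>UNIV. dist x' u < d \<longrightarrow> dist (J' x') (J' u) < e"
    proof (intro exI[of _ "min (1 / 2) (e / (6 * K + 1))"] conjI ballI impI)
      show "min (1 / 2) (e / (6 * K + 1)) > 0" using e K0 by simp
      fix x' assume x': "dist x' u < min (1 / 2) (e / (6 * K + 1))"
      define k where "k = x' - u"
      have k: "norm k < 1 / 2" "norm k < e / (6 * K + 1)" using x' by (auto simp: k_def dist_norm)
      have "norm (J' (u + k) - J' u) \<le> 6 * K * norm k" using k by (intro lip) simp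
      also have "\<dots> \<le> (6 * K + 1) * norm k" by (intro mult_right_mono) auto
      also have "\<dots> < e" using k(2) K0 by (simp add: pos_less_divide_eq mult.commute)
      finally show "dist (J' x') (J' u) < e" by (simp add: k_def dist_norm)
    qed
  qed
  then show "C1_functional J" unfolding C1_functional_def using D app by metis
qed

section \<open>The candidate derivative\<close>

text \<open>The formal directional derivative, arranged as the weak formulation with all terms on
  one side. The term with factor \<open>2 * \<epsilon> * lam\<close> corresponds to the
  distributional Laplacian, since the gradient of \<open>f\<close> of the exponential is
  \<open>nl1 f\<close> times the gradient of the exponent.\<close>

definition energy_deriv ::
    "(real \<Rightarrow> real) \<Rightarrow> real \<Rightarrow> real \<Rightarrow> (real^2 \<Rightarrow> real) \<Rightarrow> real \<Rightarrow> real \<Rightarrow> (real^2 \<Rightarrow> real) \<Rightarrow> (real^2 \<Rightarrow> real) \<Rightarrow> real" where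
  "energy_deriv f s A \<sigma> \<epsilon> lam u h =
     \<epsilon>\<^sup>2 * (LINT x|torus. wlaplace u x * wlaplace h x)
     + (LINT x|torus. wgrad u x \<bullet> wgrad h x)
     + \<epsilon> * lam * (LINT x|torus. nl2 f (\<sigma> x + u x) * (norm (wgrad (\<lambda>x. \<sigma> x + u x) x))\<^sup>2 * h x)
     + 2 * \<epsilon> * lam * (LINT x|torus. nl1 f (\<sigma> x + u x) * (wgrad (\<lambda>x. \<sigma> x + u x) x \<bullet> wgrad h x))
     + lam\<^sup>2 * (LINT x|torus. nl1 f (\<sigma> x + u x) * (nl0 f (\<sigma> x + u x) - s) * h x)
     - A * (LINT x|torus. h x)"

lemma energy_deriv_cong:
  assumes u: "H2_rel u u'" and h: "H2_rel h h'"
  shows "energy_deriv f s A \<sigma> \<epsilon> lam u h = energy_deriv f s A \<sigma> \<epsilon> lam u' h'"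
proof -
  have L: "u \<in> L1" "u' \<in> L1" "h \<in> L1" "h' \<in> L1" and ae: "aeq u u'" "aeq h h'"
    using assms by (auto simp: H2_rel_def H2_fun_L1)
  let ?v = "\<lambda>x. \<sigma> x + u x" and ?v' = "\<lambda>x. \<sigma> x + u' x"
  have wpd: "wpd i u = wpd i u'" "wpd i h = wpd i h'" for i using L ae by (auto intro: wpd_cong)
  \<comment> \<open>Nothing is assumed about \<open>\<sigma>\<close> here, so integrability of the
    two sums is only shown to be equivalent: they differ by the integrable function
    \<open>u' - u\<close>. This makes the chosen weak derivatives equal as functions.\<close>
  have "?v \<in> L1 \<longleftrightarrow> ?v' \<in> L1"
    using L1_add[OF _ L1_add[OF L(2) L1_scale[OF L(1), of "-1"]], of ?v]
      L1_add[OF _ L1_add[OF L(1) L1_scale[OF L(2), of "-1"]], of ?v']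
    by (auto simp: algebra_simps)
  then have wpd': "wpd i ?v = wpd i ?v'" for i
    using ae by (intro wpd_cong) (auto intro: aeq_add)
  have g: "wgrad u = wgrad u'" "wgrad h = wgrad h'" "wgrad ?v = wgrad ?v'"
    "wlaplace u = wlaplace u'" "wlaplace h = wlaplace h'"
    by (simp_all add: wgrad_def[abs_def] wlaplace_def[abs_def] wpd wpd')
  have AE: "AE x in torus. u x = u' x \<and> h x = h' x"
    using ae unfolding aeq_def by eventually_elim simp
  have 1: "AE x in torus. nl2 f (\<sigma> x + u x) * (norm (wgrad ?v' x))\<^sup>2 * h x = nl2 f (\<sigma> x + u' x) * (norm (wgrad ?v' x))\<^sup>2 * h' x"
    and 2: "AE x in torus. nl1 f (\<sigma> x + u x) * (wgrad ?v' x \<bullet> wgrad h' x) = nl1 f (\<sigma> x + u' x) * (wgrad ?v' x \<bullet> wgrad h' x)"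
    and 3: "AE x in torus. nl1 f (\<sigma> x + u x) * (nl0 f (\<sigma> x + u x) - s) * h x = nl1 f (\<sigma> x + u' x) * (nl0 f (\<sigma> x + u' x) - s) * h' x"
    and 4: "AE x in torus. h x = h' x"
    using AE by (eventually_elim, simp)+
  show ?thesis unfolding energy_deriv_def g
    by (simp only: integral_cong_AE_torus[OF 1] integral_cong_AE_torus[OF 2]
        integral_cong_AE_torus[OF 3] integral_cong_AE_torus[OF 4])
qed

lemma wlaplace_eq: "wlaplace u = (\<lambda>x. wpd 1 (wpd 1 u) x + wpd 2 (wpd 2 u) x)"
  by (simp add: wlaplace_def[abs_def] UNIV_2)

lemma wlaplace_L2: "u \<in> H2_fun \<Longrightarrow> wlaplace u \<in> L2"
  unfolding wlaplace_eq by (intro L2_add H2_funD(9))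

lemma L2D:
  assumes "u \<in> L2"
  shows "u \<in> borel_measurable torus" "integrable torus (\<lambda>x. (u x)\<^sup>2)"
  using assms by (auto simp: L2_def)

lemma wlaplace_bound:
  assumes h: "h \<in> H2_fun"
  shows "(LINT x|torus. (wlaplace h x)\<^sup>2) \<le> 4 * (H2_norm h)\<^sup>2"
proof -
  let ?a = "wpd 1 (wpd 1 h)" and ?b = "wpd 2 (wpd 2 h)"
  have i: "integrable torus (\<lambda>x. (?a x)\<^sup>2)" "integrable torus (\<lambda>x. (?b x)\<^sup>2)"
    by (rule L2D(2)[OF H2_funD(9)[OF h]])+
  have "(LINT x|torus. (wlaplace h x)\<^sup>2) \<le> (LINT x|torus. 2 * (?a x)\<^sup>2 + 2 * (?b x)\<^sup>2)"
  proof (rule integral_mono)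
    show "integrable torus (\<lambda>x. (wlaplace h x)\<^sup>2)" by (rule L2D(2)[OF wlaplace_L2[OF h]])
    show "integrable torus (\<lambda>x. 2 * (?a x)\<^sup>2 + 2 * (?b x)\<^sup>2)" using i by simp
    show "(wlaplace h x)\<^sup>2 \<le> 2 * (?a x)\<^sup>2 + 2 * (?b x)\<^sup>2" for x
      unfolding wlaplace_eq using zero_le_power2[of "?a x - ?b x"] by (simp add: power2_eq_square algebra_simps)
  qed
  also have "\<dots> = 2 * (LINT x|torus. (?a x)\<^sup>2) + 2 * (LINT x|torus. (?b x)\<^sup>2)" using i by simp
  also have "\<dots> \<le> 4 * (H2_norm h)\<^sup>2"
    using H2_inner_bounds(3)[of 1 1 h] H2_inner_bounds(3)[of 2 2 h] by simp
  finally show ?thesis .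
qed

lemma L2_integral_square_add:
  assumes p: "p \<in> L2" and q: "q \<in> L2" and z: "aeq z (\<lambda>x. p x + q x)"
  shows "(LINT x|torus. (z x)\<^sup>2) = (LINT x|torus. (p x)\<^sup>2) + 2 * (LINT x|torus. p x * q x) + (LINT x|torus. (q x)\<^sup>2)"
proof -
  have "AE x in torus. (z x)\<^sup>2 = (p x)\<^sup>2 + 2 * (p x * q x) + (q x)\<^sup>2"
    using z unfolding aeq_def by eventually_elim (simp add: power2_sum)
  from integral_cong_AE_torus[OF this] show ?thesis
    using L2_mult_integrable[OF p q] L2D(2)[OF p] L2D(2)[OF q] by simp
qed

lemma wlaplace_add:
  assumes "u \<in> H2_fun" "v \<in> H2_fun"
  shows "aeq (wlaplace (\<lambda>x. u x + v x)) (\<lambda>x. wlaplace u x + wlaplace v x)"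
  using wpd_add(2)[OF assms, of 1 1] wpd_add(2)[OF assms, of 2 2]
  unfolding aeq_def wlaplace_eq by eventually_elim simp

lemma wlaplace_scale:
  assumes "u \<in> H2_fun"
  shows "aeq (wlaplace (\<lambda>x. c * u x)) (\<lambda>x. c * wlaplace u x)"
  using wpd_scale(2)[OF assms, of 1 1 c] wpd_scale(2)[OF assms, of 2 2 c]
  unfolding aeq_def wlaplace_eq by eventually_elim (simp add: distrib_left)

lemma wgrad_add:
  assumes "u \<in> H2_fun" "v \<in> H2_fun"
  shows "AE x in torus. wgrad (\<lambda>x. u x + v x) x = wgrad u x + wgrad v x"
proof -
  have "AE x in torus. wpd i (\<lambda>x. u x + v x) x = wpd i u x + wpd i v x" for i
    using wpd_add(1)[OF assms, of i] by (simp add: aeq_def)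
  from this[of 1] this[of 2] show ?thesis
    by eventually_elim (simp add: wgrad_def vec_eq_iff forall_2)
qed

lemma wgrad_scale:
  assumes "u \<in> H2_fun"
  shows "AE x in torus. wgrad (\<lambda>x. c * u x) x = c *\<^sub>R wgrad u x"
proof -
  have "AE x in torus. wpd i (\<lambda>x. c * u x) x = c * wpd i u x" for i
    using wpd_scale(1)[OF assms, of i c] by (simp add: aeq_def)
  from this[of 1] this[of 2] show ?thesis
    by eventually_elim (simp add: wgrad_def vec_eq_iff forall_2)
qed

lemma wgrad_inner_integral:
  assumes "u \<in> H2_fun" "h \<in> H2_fun"
  shows "integrable torus (\<lambda>x. wgrad u x \<bullet> wgrad h x)"
    "(LINT x|torus. wgrad u x \<bullet> wgrad h x) = (\<Sum>i\<in>UNIV. LINT x|torus. wpd i u x * wpd i h x)"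
  unfolding inner_wgrad using L2_mult_integrable[OF H2_funD(8)[OF assms(1)] H2_funD(8)[OF assms(2)]]
  by (simp_all add: Bochner_Integration.integral_sum)

lemma L2_inner_bound:
  assumes "p \<in> L2" "q \<in> L2" "(LINT x|torus. (p x)\<^sup>2) \<le> a\<^sup>2" "(LINT x|torus. (q x)\<^sup>2) \<le> b\<^sup>2" "0 \<le> a" "0 \<le> b"
  shows "\<bar>LINT x|torus. p x * q x\<bar> \<le> a * b"
proof -
  have "\<bar>LINT x|torus. p x * q x\<bar> \<le> (LINT x|torus. \<bar>p x * q x\<bar>)" by (rule integral_abs_bound)
  also have "\<dots> \<le> sqrt (LINT x|torus. (p x)\<^sup>2) * sqrt (LINT x|torus. (q x)\<^sup>2)"
    by (rule integral_Cauchy_Schwarz(2)) (use assms L2D in auto)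
  also have "\<dots> \<le> a * b"
    using assms by (intro mult_mono real_le_lsqrt) auto
  finally show ?thesis .
qed

section \<open>Classes and representatives\<close>

lemma rep_H2_fun: "rep_H2 U \<in> H2_fun"
  using Quotient3_rep_reflp[OF Quotient3_H2, of U] by (simp add: H2_rel_def)

lemma abs_rep_H2: "abs_H2 (rep_H2 U) = U"
  by (rule Quotient3_abs_rep[OF Quotient3_H2])

lemma H2_rel_refl: "u \<in> H2_fun \<Longrightarrow> H2_rel u u"
  by (simp add: H2_rel_def)

lemma H2_rel_trans: "H2_rel u v \<Longrightarrow> H2_rel v w \<Longrightarrow> H2_rel u w"
  unfolding H2_rel_def using aeq_trans by blast

lemma rep_abs_H2: "u \<in> H2_fun \<Longrightarrow> H2_rel (rep_H2 (abs_H2 u)) u"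
  by (rule rep_abs_rsp_left[OF Quotient3_H2 H2_rel_refl])

lemma norm_H2_rep: "norm U = H2_norm (rep_H2 U)"
  using inner_H2.abs_eq[OF H2_rel_refl[OF rep_H2_fun] H2_rel_refl[OF rep_H2_fun], of U U]
  by (simp add: norm_eq_sqrt_inner H2_norm_def abs_rep_H2)

lemma rep_H2_add: "H2_rel (rep_H2 (U + V)) (\<lambda>x. rep_H2 U x + rep_H2 V x)"
  using plus_H2.abs_eq[OF H2_rel_refl[OF rep_H2_fun] H2_rel_refl[OF rep_H2_fun], of U V]
    rep_abs_H2[OF H2_fun_add[OF rep_H2_fun rep_H2_fun], of U V]
  by (simp add: abs_rep_H2)

lemma rep_H2_scale: "H2_rel (rep_H2 (c *\<^sub>R U)) (\<lambda>x. c * rep_H2 U x)"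
  using scaleR_H2.abs_eq[OF H2_rel_refl[OF rep_H2_fun], of c U]
    rep_abs_H2[OF H2_fun_scale[OF rep_H2_fun], of c U]
  by (simp add: abs_rep_H2)

lemma energy_H2_rep: "energy_H2 f s A \<sigma> \<epsilon> lam U = energy f s A \<sigma> \<epsilon> lam (rep_H2 U)"
  using energy_H2.abs_eq[OF H2_rel_refl[OF rep_H2_fun], of f s A \<sigma> \<epsilon> lam U] by (simp add: abs_rep_H2)

section \<open>Expansion of the energy on the Sobolev space\<close>

context
  fixes \<sigma> :: "real^2 \<Rightarrow> real" and w :: "2 \<Rightarrow> real^2 \<Rightarrow> real" and f nl3 :: "real \<Rightarrow> real" and C s A \<epsilon> lam :: real
  assumes w: "\<And>i. is_weak_pd i \<sigma> (w i)" "\<And>i. integrable torus (\<lambda>x. (w i x)\<^sup>2 / (1 + (\<sigma> x)\<^sup>2))"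
    and g: "\<And>t. (nl0 f has_real_derivative nl1 f t) (at t)" "\<And>t. (nl1 f has_real_derivative nl2 f t) (at t)"
      "\<And>t. (nl2 f has_real_derivative nl3 t) (at t)"
    and gb: "\<And>t. \<bar>nl0 f t\<bar> \<le> C" "\<And>t. \<bar>nl1 f t\<bar> \<le> C * exp (- \<bar>t\<bar>)" "\<And>t. \<bar>nl2 f t\<bar> \<le> C * exp (- \<bar>t\<bar>)"
      "\<And>t. \<bar>nl3 t\<bar> \<le> C * exp (- \<bar>t\<bar>)"
    and C0: "C \<ge> 0"
begin

abbreviation "EN \<equiv> energy f s A \<sigma> \<epsilon> lam"
abbreviation "DE \<equiv> energy_deriv f s A \<sigma> \<epsilon> lam"
abbreviation "EH \<equiv> energy_H2 f s A \<sigma> \<epsilon> lam"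

lemma sup_bounds: "h \<in> H2_fun \<Longrightarrow> AE x in torus. \<bar>h x\<bar> \<le> 4 * H2_norm h" "0 \<le> 4 * H2_norm h"
  by (rule H2_sup_bound) (simp add: H2_norm_nonneg)+

lemma gradient_density_integral:
  assumes u: "u \<in> H2_fun"
  shows "integrable torus (gradient_density f (shift \<sigma> u))"
    and "(LINT x|torus. gradient_density f (shift \<sigma> u) x) =
      (\<Sum>i\<in>UNIV. LINT x|torus. nl1 f (\<sigma> x + u x) * (wpd i (shift \<sigma> u) x)\<^sup>2)"
proof -
  have e: "gradient_density f (shift \<sigma> u) =
      (\<lambda>x. \<Sum>i\<in>UNIV. nl1 f (\<sigma> x + u x) * (wpd i (shift \<sigma> u) x)\<^sup>2)"
    by (simp add: gradient_density_def[abs_def] norm_wgrad_square nl1_def sum_distrib_left)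
  \<comment> \<open>In \<open>gradient_terms\<close> the function \<open>u\<close> also takes the
    place of the increment.\<close>
  have i: "integrable torus (\<lambda>x. nl1 f (\<sigma> x + u x) * (wpd i (shift \<sigma> u) x)\<^sup>2)" for i
    by (rule gradient_terms(1)[OF w g gb C0 u u sup_bounds(1)[OF u] sup_bounds(1)[OF u] sup_bounds(2)])
  show "integrable torus (gradient_density f (shift \<sigma> u))"
    "(LINT x|torus. gradient_density f (shift \<sigma> u) x) =
      (\<Sum>i\<in>UNIV. LINT x|torus. nl1 f (\<sigma> x + u x) * (wpd i (shift \<sigma> u) x)\<^sup>2)"
    unfolding e using i by (simp_all add: Bochner_Integration.integral_sum)
qed

lemma reaction_integral:
  assumes u: "u \<in> H2_fun" and h: "h \<in> H2_fun"
  shows "integrable torus (\<lambda>x. nl2 f (\<sigma> x + u x) * (norm (wgrad (shift \<sigma> u) x))\<^sup>2 * h x)"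
    and "(LINT x|torus. nl2 f (\<sigma> x + u x) * (norm (wgrad (shift \<sigma> u) x))\<^sup>2 * h x) =
      (\<Sum>i\<in>UNIV. LINT x|torus. nl2 f (\<sigma> x + u x) * (wpd i (shift \<sigma> u) x)\<^sup>2 * h x)"
proof -
  have e: "nl2 f (\<sigma> x + u x) * (norm (wgrad (shift \<sigma> u) x))\<^sup>2 * h x =
      (\<Sum>i\<in>UNIV. nl2 f (\<sigma> x + u x) * (wpd i (shift \<sigma> u) x)\<^sup>2 * h x)" for x
    by (simp add: norm_wgrad_square sum_distrib_left sum_distrib_right)
  have i: "integrable torus (\<lambda>x. nl2 f (\<sigma> x + u x) * (wpd i (shift \<sigma> u) x)\<^sup>2 * h x)" for i
    by (rule gradient_terms(2)[OF w g gb C0 u h sup_bounds(1)[OF u] sup_bounds(1)[OF h] sup_bounds(2)])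
  show "integrable torus (\<lambda>x. nl2 f (\<sigma> x + u x) * (norm (wgrad (shift \<sigma> u) x))\<^sup>2 * h x)"
    "(LINT x|torus. nl2 f (\<sigma> x + u x) * (norm (wgrad (shift \<sigma> u) x))\<^sup>2 * h x) =
      (\<Sum>i\<in>UNIV. LINT x|torus. nl2 f (\<sigma> x + u x) * (wpd i (shift \<sigma> u) x)\<^sup>2 * h x)"
    unfolding e using i by (simp_all add: Bochner_Integration.integral_sum)
qed

lemma flux_integral:
  assumes u: "u \<in> H2_fun" and h: "h \<in> H2_fun"
  shows "integrable torus (\<lambda>x. nl1 f (\<sigma> x + u x) * (wgrad (shift \<sigma> u) x \<bullet> wgrad h x))"
    and "(LINT x|torus. nl1 f (\<sigma> x + u x) * (wgrad (shift \<sigma> u) x \<bullet> wgrad h x)) =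
      (\<Sum>i\<in>UNIV. LINT x|torus. nl1 f (\<sigma> x + u x) * (wpd i (shift \<sigma> u) x * wpd i h x))"
proof -
  have e: "nl1 f (\<sigma> x + u x) * (wgrad (shift \<sigma> u) x \<bullet> wgrad h x) =
      (\<Sum>i\<in>UNIV. nl1 f (\<sigma> x + u x) * (wpd i (shift \<sigma> u) x * wpd i h x))" for x
    by (simp add: inner_wgrad sum_distrib_left)
  have i: "integrable torus (\<lambda>x. nl1 f (\<sigma> x + u x) * (wpd i (shift \<sigma> u) x * wpd i h x))" for i
    by (rule gradient_terms(4)[OF w g gb C0 u h sup_bounds(1)[OF u] sup_bounds(1)[OF h] sup_bounds(2)])
  show "integrable torus (\<lambda>x. nl1 f (\<sigma> x + u x) * (wgrad (shift \<sigma> u) x \<bullet> wgrad h x))"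
    "(LINT x|torus. nl1 f (\<sigma> x + u x) * (wgrad (shift \<sigma> u) x \<bullet> wgrad h x)) =
      (\<Sum>i\<in>UNIV. LINT x|torus. nl1 f (\<sigma> x + u x) * (wpd i (shift \<sigma> u) x * wpd i h x))"
    unfolding e using i by (simp_all add: Bochner_Integration.integral_sum)
qed

text \<open>Weak derivatives of a combination are determined only almost everywhere, so linearity is
  verified integral by integral; the integrability lemmas make each splitting legitimate.\<close>

lemma energy_deriv_linear:
  assumes u: "u \<in> H2_fun" and h: "h \<in> H2_fun" and k: "k \<in> H2_fun"
  shows "DE u (\<lambda>x. c * h x + k x) =
    c * DE u h + DE u k"
proof -
  let ?z = "\<lambda>x. c * h x + k x"
  have ch: "(\<lambda>x. c * h x) \<in> H2_fun" by (rule H2_fun_scale[OF h])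
  have lz: "AE x in torus. wlaplace ?z x = c * wlaplace h x + wlaplace k x"
    using wlaplace_add[OF ch k] wlaplace_scale[OF h, of c] unfolding aeq_def by eventually_elim simp
  have gz: "AE x in torus. wgrad ?z x = c *\<^sub>R wgrad h x + wgrad k x"
    using wgrad_add[OF ch k] wgrad_scale[OF h, of c] by eventually_elim simp
  have 1: "(LINT x|torus. wlaplace u x * wlaplace ?z x) =
      c * (LINT x|torus. wlaplace u x * wlaplace h x) + (LINT x|torus. wlaplace u x * wlaplace k x)"
  proof -
    have "AE x in torus. wlaplace u x * wlaplace ?z x = c * (wlaplace u x * wlaplace h x) + wlaplace u x * wlaplace k x"
      using lz by eventually_elim (simp add: algebra_simps)
    from integral_cong_AE_torus[OF this] show ?thesis
      using L2_mult_integrable[OF wlaplace_L2[OF u] wlaplace_L2[OF h]]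
        L2_mult_integrable[OF wlaplace_L2[OF u] wlaplace_L2[OF k]] by simp
  qed
  have 2: "(LINT x|torus. wgrad u x \<bullet> wgrad ?z x) =
      c * (LINT x|torus. wgrad u x \<bullet> wgrad h x) + (LINT x|torus. wgrad u x \<bullet> wgrad k x)"
  proof -
    have "AE x in torus. wgrad u x \<bullet> wgrad ?z x = c * (wgrad u x \<bullet> wgrad h x) + wgrad u x \<bullet> wgrad k x"
      using gz by eventually_elim (simp add: inner_add_right)
    from integral_cong_AE_torus[OF this] show ?thesis
      using wgrad_inner_integral(1)[OF u h] wgrad_inner_integral(1)[OF u k] by simp
  qed
  let ?r = "\<lambda>x. nl2 f (\<sigma> x + u x) * (norm (wgrad (shift \<sigma> u) x))\<^sup>2"
  have 3: "(LINT x|torus. ?r x * ?z x) = c * (LINT x|torus. ?r x * h x) + (LINT x|torus. ?r x * k x)"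
  proof -
    have "(LINT x|torus. ?r x * ?z x) = (LINT x|torus. c * (?r x * h x) + ?r x * k x)"
      by (intro Bochner_Integration.integral_cong refl) (simp add: algebra_simps)
    then show ?thesis using reaction_integral(1)[OF u h] reaction_integral(1)[OF u k] by simp
  qed
  let ?v = "\<lambda>x. \<sigma> x + u x"
  have 4: "(LINT x|torus. nl1 f (?v x) * (wgrad ?v x \<bullet> wgrad ?z x)) =
      c * (LINT x|torus. nl1 f (?v x) * (wgrad ?v x \<bullet> wgrad h x)) + (LINT x|torus. nl1 f (?v x) * (wgrad ?v x \<bullet> wgrad k x))"
  proof -
    have "AE x in torus. nl1 f (?v x) * (wgrad ?v x \<bullet> wgrad ?z x) =
        c * (nl1 f (?v x) * (wgrad ?v x \<bullet> wgrad h x)) + nl1 f (?v x) * (wgrad ?v x \<bullet> wgrad k x)"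
      using gz by eventually_elim (simp add: inner_add_right algebra_simps)
    from integral_cong_AE_torus[OF this] show ?thesis
      using flux_integral(1)[OF u h] flux_integral(1)[OF u k] by simp
  qed
  let ?p = "\<lambda>x. nl1 f (\<sigma> x + u x) * (nl0 f (\<sigma> x + u x) - s)"
  have 5: "(LINT x|torus. ?p x * ?z x) = c * (LINT x|torus. ?p x * h x) + (LINT x|torus. ?p x * k x)"
  proof -
    have "(LINT x|torus. ?p x * ?z x) = (LINT x|torus. c * (?p x * h x) + ?p x * k x)"
      by (intro Bochner_Integration.integral_cong refl) (simp add: algebra_simps)
    then show ?thesis using potential_terms(2)[OF w g gb C0 u h, of s] potential_terms(2)[OF w g gb C0 u k, of s] by simp
  qed
  have 6: "(LINT x|torus. ?z x) = c * (LINT x|torus. h x) + (LINT x|torus. k x)"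
    using H2_funD(2)[OF h] H2_funD(2)[OF k] by simp
  show ?thesis unfolding energy_deriv_def 1 2 3 4 5 6 by (simp add: algebra_simps)
qed

text \<open>On a ball of radius \<open>R\<close> the sup norms of \<open>u\<close> and of the
  increment are at most \<open>4 * R\<close> and 4, so the constants of the nonlinear terms depend
  on \<open>R\<close> only. The quadratic terms of the energy expand exactly.\<close>

lemma energy_expansion:
  "\<exists>K. \<forall>u\<in>H2_fun. \<forall>h\<in>H2_fun. H2_norm u \<le> R \<longrightarrow> H2_norm h \<le> 1 \<longrightarrow>
     \<bar>DE u h\<bar> \<le> K \<and>
     \<bar>EN (\<lambda>x. u x + h x) - EN u - DE u h\<bar>
       \<le> K * (H2_norm h)\<^sup>2"
proof -
  define E where "E = 2 * weighted_const \<sigma> w + 2 * R\<^sup>2"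
  \<comment> \<open>The exponent adds the sup bounds \<open>4 * R\<close> for the base point and 4
    for an increment of norm at most 1.\<close>
  define \<kappa> where "\<kappa> = C * exp (4 * R + 4)"
  define P where "P = 2 * C\<^sup>2 + 2 * (C + \<bar>s\<bar>) * C"
  define K1 where "K1 = \<epsilon>\<^sup>2 * (4 * R) + 2 * R + \<bar>\<epsilon> * lam\<bar> * (2 * (\<kappa> * 4 * E)) +
      2 * \<bar>\<epsilon> * lam\<bar> * (2 * (\<kappa> * (E + 1))) + lam\<^sup>2 * P + \<bar>A\<bar>"
  define K2 where "K2 = \<epsilon>\<^sup>2 / 2 * 4 + 1 + \<bar>\<epsilon> * lam\<bar> * (2 * (2 * \<kappa> * (16 * E + 1))) + lam\<^sup>2 / 2 * P"
  have \<kappa>0: "\<kappa> \<ge> 0" and P0: "P \<ge> 0" using C0 by (simp_all add: \<kappa>_def P_def)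
  have E0: "E \<ge> 0" using weighted_const_nonneg[OF w] by (simp add: E_def)
  have "\<bar>DE u h\<bar> \<le> K1 \<and>
     \<bar>EN (\<lambda>x. u x + h x) - EN u - DE u h\<bar>
       \<le> K2 * (H2_norm h)\<^sup>2"
    if u: "u \<in> H2_fun" and h: "h \<in> H2_fun" and uR: "H2_norm u \<le> R" and h1: "H2_norm h \<le> 1" for u h
  proof -
    let ?v = "\<lambda>x. \<sigma> x + u x"
    define N where "N = H2_norm h"
    have N: "0 \<le> N" "N \<le> 1" "N\<^sup>2 \<le> 1" using h1 H2_norm_nonneg[of h] by (auto simp: N_def abs_square_le_1)
    have R0: "0 \<le> R" using uR H2_norm_nonneg[of u] by linarith
    note uh = H2_fun_add[OF u h]
    \<comment> \<open>The primed constants belong to the actual norms of \<open>u\<close> and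
      \<open>h\<close>; they are then compared with the uniform ones. Keeping the norm
      \<open>N\<close> of the increment visible preserves the quadratic order.\<close>
    define E' where "E' = 2 * weighted_const \<sigma> w + 2 * (H2_norm u)\<^sup>2"
    define \<kappa>' where "\<kappa>' = C * exp (4 * H2_norm u + 4 * N)"
    have E': "0 \<le> E'" "E' \<le> E"
      using weighted_const_nonneg[OF w] power_mono[OF uR H2_norm_nonneg, of 2] by (simp_all add: E'_def E_def)
    have \<kappa>': "0 \<le> \<kappa>'" "\<kappa>' \<le> \<kappa>"
      using C0 uR N by (auto simp: \<kappa>'_def \<kappa>_def intro!: mult_left_mono)
    define T1 where "T1 = (LINT x|torus. wlaplace u x * wlaplace h x)"
    define T2 where "T2 i = (LINT x|torus. wpd i u x * wpd i h x)" for i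
    define T3 where "T3 i = (LINT x|torus. nl2 f (?v x) * (wpd i ?v x)\<^sup>2 * h x)" for i
    define T4 where "T4 i = (LINT x|torus. nl1 f (?v x) * (wpd i ?v x * wpd i h x))" for i
    define T5 where "T5 = (LINT x|torus. nl1 f (?v x) * (nl0 f (?v x) - s) * h x)"
    define T6 where "T6 = (LINT x|torus. h x)"
    have D: "DE u h = \<epsilon>\<^sup>2 * T1 + (T2 1 + T2 2) + \<epsilon> * lam * (T3 1 + T3 2)
        + 2 * (\<epsilon> * lam) * (T4 1 + T4 2) + lam\<^sup>2 * T5 - A * T6"
      unfolding energy_deriv_def wgrad_inner_integral(2)[OF u h] reaction_integral(2)[OF u h]
        flux_integral(2)[OF u h] UNIV_2
      by (simp add: T1_def T2_def T3_def T4_def T5_def T6_def)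
    note gt = gradient_terms[OF w g gb C0 u h sup_bounds(1)[OF u] sup_bounds(1)[OF h] sup_bounds(2)]
    have T1: "\<bar>T1\<bar> \<le> 4 * R"
    proof -
      have "\<bar>T1\<bar> \<le> (2 * H2_norm u) * (2 * N)"
        unfolding T1_def using wlaplace_bound[OF u] wlaplace_bound[OF h] N
        by (intro L2_inner_bound wlaplace_L2 u h) (auto simp: power_mult_distrib N_def H2_norm_nonneg)
      also have "\<dots> \<le> (2 * R) * (2 * 1)" using uR N R0 H2_norm_nonneg[of u] by (intro mult_mono) auto
      finally show ?thesis by simp
    qed
    have T2: "\<bar>T2 i\<bar> \<le> R" for i
    proof -
      have "\<bar>T2 i\<bar> \<le> H2_norm u * N"
        unfolding T2_def N_def by (intro L2_inner_bound H2_funD u h H2_inner_bounds H2_norm_nonneg)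
      also have "\<dots> \<le> R * 1" using uR N R0 H2_norm_nonneg[of u] by (intro mult_mono) auto
      finally show ?thesis by simp
    qed
    have T3: "\<bar>T3 i\<bar> \<le> \<kappa> * 4 * E" for i
    proof -
      have "\<bar>T3 i\<bar> \<le> \<kappa>' * (4 * N) * E'" using gt(3)[of i] by (simp add: T3_def \<kappa>'_def E'_def N_def)
      also have "\<dots> \<le> \<kappa> * (4 * 1) * E" using \<kappa>' E' N \<kappa>0 by (intro mult_mono) auto
      finally show ?thesis by simp
    qed
    have T4: "\<bar>T4 i\<bar> \<le> \<kappa> * (E + 1)" for i
    proof -
      have "\<bar>T4 i\<bar> \<le> \<kappa>' * (E' + N\<^sup>2)" using gt(5)[of i] by (simp add: T4_def \<kappa>'_def E'_def N_def)
      also have "\<dots> \<le> \<kappa> * (E + 1)" using \<kappa>' E' N \<kappa>0 by (intro mult_mono add_mono) auto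
      finally show ?thesis .
    qed
    have T5: "\<bar>T5\<bar> \<le> P"
    proof -
      have "\<bar>T5\<bar> \<le> P * N" using potential_terms(3)[OF w g gb C0 u h, of s] by (simp add: T5_def P_def N_def)
      also have "\<dots> \<le> P * 1" using N P0 by (intro mult_left_mono) auto
      finally show ?thesis by simp
    qed
    have T6: "\<bar>T6\<bar> \<le> 1"
      using integral_abs_bound[of torus h] H2_L1_bounds(1)[OF h] h1 unfolding T6_def by linarith
    have m: "\<bar>a * t\<bar> \<le> \<bar>a\<bar> * b" if "\<bar>t\<bar> \<le> b" for a t b :: real
      using that by (simp add: abs_mult mult_left_mono)
    have 1: "\<bar>DE u h\<bar> \<le> K1"
    proof -
      have tri: "\<bar>a + (b + c) + d + e + x - y\<bar> \<le> \<bar>a\<bar> + (\<bar>b\<bar> + \<bar>c\<bar>) + \<bar>d\<bar> + \<bar>e\<bar> + \<bar>x\<bar> + \<bar>y\<bar>"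
        for a b c d e x y :: real
        by (intro order.trans[OF abs_triangle_ineq4] order.trans[OF abs_triangle_ineq] add_mono order.refl)
      have b1: "\<bar>\<epsilon>\<^sup>2 * T1\<bar> \<le> \<epsilon>\<^sup>2 * (4 * R)" using m[OF T1, of "\<epsilon>\<^sup>2"] by simp
      have b3: "\<bar>\<epsilon> * lam * (T3 1 + T3 2)\<bar> \<le> \<bar>\<epsilon> * lam\<bar> * (2 * (\<kappa> * 4 * E))"
        by (rule m) (use T3[of 1] T3[of 2] in linarith)
      have b4: "\<bar>2 * (\<epsilon> * lam) * (T4 1 + T4 2)\<bar> \<le> \<bar>2 * (\<epsilon> * lam)\<bar> * (2 * (\<kappa> * (E + 1)))"
        by (rule m) (use T4[of 1] T4[of 2] in linarith)
      have b5: "\<bar>lam\<^sup>2 * T5\<bar> \<le> lam\<^sup>2 * P" using m[OF T5, of "lam\<^sup>2"] by simp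
      have b6: "\<bar>A * T6\<bar> \<le> \<bar>A\<bar>" using m[OF T6, of A] by simp
      have "\<bar>DE u h\<bar> \<le> \<epsilon>\<^sup>2 * (4 * R) + (R + R) + \<bar>\<epsilon> * lam\<bar> * (2 * (\<kappa> * 4 * E))
          + \<bar>2 * (\<epsilon> * lam)\<bar> * (2 * (\<kappa> * (E + 1))) + lam\<^sup>2 * P + \<bar>A\<bar>"
        unfolding D by (rule order.trans[OF tri]) (intro add_mono b1 T2 b3 b4 b5 b6)
      also have "\<dots> = K1" by (simp add: K1_def abs_mult)
      finally show ?thesis .
    qed
    define Q1 where "Q1 = (LINT x|torus. (wlaplace h x)\<^sup>2)"
    define Q2 where "Q2 i = (LINT x|torus. (wpd i h x)\<^sup>2)" for i
    have q1: "(LINT x|torus. (wlaplace (\<lambda>x. u x + h x) x)\<^sup>2) = (LINT x|torus. (wlaplace u x)\<^sup>2) + 2 * T1 + Q1"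
      unfolding T1_def Q1_def by (intro L2_integral_square_add wlaplace_L2 wlaplace_add u h)
    have gsum: "(LINT x|torus. (norm (wgrad k x))\<^sup>2) = (LINT x|torus. (wpd 1 k x)\<^sup>2) + (LINT x|torus. (wpd 2 k x)\<^sup>2)"
      if "k \<in> H2_fun" for k
      using H2_funD(6)[OF that] by (simp add: norm_wgrad_square UNIV_2)
    have q2: "(LINT x|torus. (wpd i (\<lambda>x. u x + h x) x)\<^sup>2) = (LINT x|torus. (wpd i u x)\<^sup>2) + 2 * T2 i + Q2 i" for i
      unfolding T2_def Q2_def by (intro L2_integral_square_add H2_funD wpd_add u h)
    define r where "r i = (LINT x|torus. nl1 f (\<sigma> x + (u x + h x)) * (wpd i (\<lambda>x. \<sigma> x + (u x + h x)) x)\<^sup>2)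
        - (LINT x|torus. nl1 f (?v x) * (wpd i ?v x)\<^sup>2) - T3 i - 2 * T4 i" for i
    define r0 where "r0 = (LINT x|torus. (nl0 f (\<sigma> x + (u x + h x)) - s)\<^sup>2) - (LINT x|torus. (nl0 f (?v x) - s)\<^sup>2) - 2 * T5"
    have r: "\<bar>r i\<bar> \<le> 2 * \<kappa> * (16 * E + 1) * N\<^sup>2" for i
    proof -
      have "\<bar>r i\<bar> \<le> 2 * \<kappa>' * ((4 * N)\<^sup>2 * E' + N\<^sup>2)"
        using gt(6)[of i] by (simp add: r_def T3_def T4_def \<kappa>'_def E'_def N_def)
      also have "\<dots> \<le> 2 * \<kappa> * ((4 * N)\<^sup>2 * E + N\<^sup>2)"
        using \<kappa>' E' \<kappa>0 by (intro mult_mono add_mono mult_left_mono) auto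
      also have "\<dots> = 2 * \<kappa> * (16 * E + 1) * N\<^sup>2" by (simp add: power_mult_distrib algebra_simps)
      finally show ?thesis .
    qed
    have r0: "\<bar>r0\<bar> \<le> P * N\<^sup>2"
      using potential_terms(4)[OF w g gb C0 u h, of s] by (simp add: r0_def T5_def P_def N_def)
    have pd: "potential_density f s (\<lambda>y. \<sigma> y + k y) x = (nl0 f (\<sigma> x + k x) - s)\<^sup>2" for k x
      by (simp add: potential_density_def nl0_def)
    have ih: "integrable torus u" "integrable torus h" by (rule H2_funD(2)[OF u] H2_funD(2)[OF h])+
    \<comment> \<open>All linear parts cancel. There remain the squares of the increment from the
      quadratic terms and the remainders of the two nonlinear ones.\<close>
    have rem: "EN (\<lambda>x. u x + h x) - EN u - DE u h
        = \<epsilon>\<^sup>2 / 2 * Q1 + (Q2 1 + Q2 2) / 2 + \<epsilon> * lam * (r 1 + r 2) + lam\<^sup>2 / 2 * r0"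
      unfolding D energy_def q1 gsum[OF uh] gsum[OF u] q2 pd r_def r0_def
        gradient_density_integral(2)[OF u] gradient_density_integral(2)[OF uh] UNIV_2
      using ih by (simp add: T6_def algebra_simps) 
    have c1: "\<bar>\<epsilon>\<^sup>2 / 2 * Q1\<bar> \<le> \<epsilon>\<^sup>2 / 2 * 4 * N\<^sup>2"
    proof -
      have "0 \<le> Q1" "Q1 \<le> 4 * N\<^sup>2" using wlaplace_bound[OF h] by (simp_all add: Q1_def N_def)
      then show ?thesis using m[of Q1 "4 * N\<^sup>2" "\<epsilon>\<^sup>2 / 2"] by (simp add: ac_simps)
    qed
    have c2: "\<bar>(Q2 1 + Q2 2) / 2\<bar> \<le> 1 * N\<^sup>2"
    proof -
      have "0 \<le> Q2 i" "Q2 i \<le> N\<^sup>2" for i using H2_inner_bounds(2)[of i h] by (simp_all add: Q2_def N_def)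
      from this[of 1] this[of 2] show ?thesis by simp
    qed
    have c3: "\<bar>\<epsilon> * lam * (r 1 + r 2)\<bar> \<le> \<bar>\<epsilon> * lam\<bar> * (2 * (2 * \<kappa> * (16 * E + 1))) * N\<^sup>2"
    proof -
      have "\<bar>r 1 + r 2\<bar> \<le> 2 * (2 * \<kappa> * (16 * E + 1) * N\<^sup>2)" using r[of 1] r[of 2] by linarith
      from m[OF this, of "\<epsilon> * lam"] show ?thesis by (simp add: mult.assoc)
    qed
    have c4: "\<bar>lam\<^sup>2 / 2 * r0\<bar> \<le> lam\<^sup>2 / 2 * P * N\<^sup>2" using m[OF r0, of "lam\<^sup>2 / 2"] by (simp add: mult.assoc)
    have tri: "\<bar>a + b + c + d\<bar> \<le> \<bar>a\<bar> + \<bar>b\<bar> + \<bar>c\<bar> + \<bar>d\<bar>" for a b c d :: real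
      by (intro order.trans[OF abs_triangle_ineq] add_mono order.refl)
    have "\<bar>EN (\<lambda>x. u x + h x) - EN u - DE u h\<bar>
       \<le> K2 * N\<^sup>2"
      unfolding rem K2_def distrib_right by (rule order.trans[OF tri]) (intro add_mono c1 c2 c3 c4)
    with 1 show ?thesis by (simp add: N_def)
  qed
  note bounds = this
  have "\<forall>u\<in>H2_fun. \<forall>h\<in>H2_fun. H2_norm u \<le> R \<longrightarrow> H2_norm h \<le> 1 \<longrightarrow>
     \<bar>DE u h\<bar> \<le> max K1 K2 \<and>
     \<bar>EN (\<lambda>x. u x + h x) - EN u - DE u h\<bar>
       \<le> max K1 K2 * (H2_norm h)\<^sup>2"
  proof (intro ballI impI)
    fix u h assume "u \<in> H2_fun" "h \<in> H2_fun" "H2_norm u \<le> R" "H2_norm h \<le> 1"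
    note b = bounds[OF this]
    have "K2 * (H2_norm h)\<^sup>2 \<le> max K1 K2 * (H2_norm h)\<^sup>2" by (intro mult_right_mono) auto
    from order.trans[OF conjunct1[OF b] max.cobounded1] order.trans[OF conjunct2[OF b] this]
    show "\<bar>DE u h\<bar> \<le> max K1 K2 \<and>
     \<bar>EN (\<lambda>x. u x + h x) - EN u - DE u h\<bar>
       \<le> max K1 K2 * (H2_norm h)\<^sup>2"
      by (rule conjI)
  qed
  then show ?thesis by (rule exI[where x = "max K1 K2"])
qed

section \<open>Weak solutions and critical points\<close>

text \<open>The weak chain rule identifies the gradient of \<open>f\<close> of the exponential, so
  the distributional term becomes the flux integral. Differentiability and integrability, which
  \<open>weak_solution\<close> demands, hold for every Sobolev function; the rest is
  rearrangement.\<close>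

lemma weak_solution_iff_energy_deriv:
  assumes u: "u \<in> H2_fun"
  shows "weak_solution f s A \<sigma> \<epsilon> lam u \<longleftrightarrow> (\<forall>\<phi>\<in>H2_fun. DE u \<phi> = 0)"
proof -
  define v where "v = (shift \<sigma> u)"
  define F where "F = (\<lambda>x. f (exp (v x)))"
  define R where "R = (\<lambda>x. ((deriv ^^ 2) f (exp (v x)) * exp (v x) + deriv f (exp (v x)))
                     * exp (v x) * (norm (wgrad v x))\<^sup>2)"
  define N where "N = (\<lambda>x. deriv f (exp (v x)) * exp (v x) * (s - f (exp (v x))))"
  have R: "R x = nl2 f (\<sigma> x + u x) * (norm (wgrad (shift \<sigma> u) x))\<^sup>2" for x
    by (simp add: R_def v_def nl2_def)
  \<comment> \<open>The sign appears because the equation contains \<open>s - f\<close> and the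
    derivative of the potential \<open>f - s\<close>.\<close>
  have N: "N x * \<phi> x = - (nl1 f (\<sigma> x + u x) * (nl0 f (\<sigma> x + u x) - s) * \<phi> x)" for x \<phi>
    by (simp add: N_def v_def nl1_def nl0_def algebra_simps)
  have C1: "\<bar>nl1 f t\<bar> \<le> C" for t
    using gb(2)[of t] C0 mult_left_le[of "exp (- \<bar>t\<bar>)" C] by simp
  have Fpd: "is_weak_pd i F (\<lambda>x. nl1 f (\<sigma> x + u x) * wpd i v x)" for i
    using weak_pd_chain[OF shifted_weak_pd(1)[OF w u] g(1) deriv_continuous[OF g(2)] C1]
    by (simp add: F_def v_def nl0_def)
  have wdv: "weakly_differentiable v" "weakly_differentiable F"
    using shifted_weak_pd(1)[OF w u] Fpd unfolding weakly_differentiable_def v_def by blast+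
  have Fae: "AE x in torus. wgrad F x \<bullet> wgrad \<phi> x = nl1 f (\<sigma> x + u x) * (wgrad (shift \<sigma> u) x \<bullet> wgrad \<phi> x)" for \<phi>
    using wpd_aeqI[OF Fpd[of 1]] wpd_aeqI[OF Fpd[of 2]] unfolding aeq_def
    by eventually_elim (simp add: inner_wgrad UNIV_2 v_def algebra_simps)
  have Fint: "integrable torus (\<lambda>x. wgrad F x \<bullet> wgrad \<phi> x)" if \<phi>: "\<phi> \<in> H2_fun" for \<phi>
  proof -
    have "wpd i F \<in> borel_measurable torus" for i
      using wpd_works[OF Fpd] by (auto simp: is_weak_pd_def L1_def)
    then have "(\<lambda>x. wgrad F x \<bullet> wgrad \<phi> x) \<in> borel_measurable torus"
      unfolding inner_wgrad using H2_funD(4)[OF \<phi>] by (intro borel_measurable_sum borel_measurable_times)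
    then show ?thesis
      using integrable_cong_AE[OF _ borel_measurable_integrable[OF flux_integral(1)[OF u \<phi>]] Fae]
        flux_integral(1)[OF u \<phi>] by blast
  qed
  have ints: "integrable torus (\<lambda>x. R x * \<phi> x)" "integrable torus (\<lambda>x. N x * \<phi> x)" if \<phi>: "\<phi> \<in> H2_fun" for \<phi>
    unfolding R N using reaction_integral(1)[OF u \<phi>] potential_terms(2)[OF w g gb C0 u \<phi>, of s] by simp_all
  define identity where "identity \<phi> \<longleftrightarrow> \<epsilon>\<^sup>2 * (LINT x|torus. wlaplace u x * wlaplace \<phi> x) + (LINT x|torus. wgrad u x \<bullet> wgrad \<phi> x)
      = - \<epsilon> * lam * (LINT x|torus. R x * \<phi> x) - 2 * \<epsilon> * lam * (LINT x|torus. wgrad F x \<bullet> wgrad \<phi> x)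
        + lam\<^sup>2 * (LINT x|torus. N x * \<phi> x) + A * (LINT x|torus. \<phi> x)" for \<phi>
  have eq: "identity \<phi> \<longleftrightarrow> DE u \<phi> = 0" for \<phi>
  proof -
    have alg: "e * a + b = - \<epsilon> * lam * r - 2 * \<epsilon> * lam * x + l * - t + A * y \<longleftrightarrow>
        e * a + b + \<epsilon> * lam * r + 2 * \<epsilon> * lam * x + l * t - A * y = 0" for e a b r x l t y :: real
      by (auto simp: algebra_simps)
    show ?thesis
      unfolding identity_def energy_deriv_def integral_cong_AE_torus[OF Fae] R N Bochner_Integration.integral_minus by (rule alg)
  qed
  have "weak_solution f s A \<sigma> \<epsilon> lam u \<longleftrightarrow> u \<in> H2_fun \<and> weakly_differentiable v \<and> weakly_differentiable F \<and>
      (\<forall>\<phi>\<in>H2_fun. integrable torus (\<lambda>x. R x * \<phi> x) \<and> integrable torus (\<lambda>x. wgrad F x \<bullet> wgrad \<phi> x) \<and>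
        integrable torus (\<lambda>x. N x * \<phi> x) \<and> identity \<phi>)"
    by (simp only: weak_solution_def Let_def identity_def v_def F_def R_def N_def)
  then show ?thesis by (simp add: u wdv Fint ints eq)
qed

text \<open>Representatives respect sums and multiples only almost everywhere;
  \<open>energy_cong\<close> and \<open>energy_deriv_cong\<close> remove the ambiguity, so linearity
  and expansion descend to classes and the criterion applies.\<close>

lemma energy_H2_C1:
  defines "L \<equiv> \<lambda>U H. DE (rep_H2 U) (rep_H2 H)"
  shows "(EH has_derivative L U) (at U)" "C1_functional (EH)"
proof -
  have "linear (L U)" for U
  proof -
    have comb: "L U (c *\<^sub>R H + K) = c * L U H + L U K" for c H K
    proof -
      have "H2_rel (\<lambda>x. rep_H2 (c *\<^sub>R H) x + rep_H2 K x) (\<lambda>x. c * rep_H2 H x + rep_H2 K x)"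
        using rep_H2_scale[of c H] unfolding H2_rel_def
        by (intro conjI H2_fun_add H2_fun_scale rep_H2_fun aeq_add aeq_refl) simp
      with rep_H2_add[of "c *\<^sub>R H" K] have "H2_rel (rep_H2 (c *\<^sub>R H + K)) (\<lambda>x. c * rep_H2 H x + rep_H2 K x)"
        by (rule H2_rel_trans)
      from energy_deriv_cong[OF H2_rel_refl[OF rep_H2_fun] this]
      show ?thesis by (simp add: L_def energy_deriv_linear rep_H2_fun)
    qed
    have L0: "L U 0 = 0" using comb[of 1 0 0] by simp
    show ?thesis
    proof (rule linearI)
      show "L U (H + K) = L U H + L U K" for H K using comb[of 1 H K] by simp
      show "L U (c *\<^sub>R H) = c *\<^sub>R L U H" for c H using comb[of c H 0] L0 by simp
    qed
  qed
  moreover have "\<exists>K. \<forall>U H. norm U \<le> R \<longrightarrow> norm H \<le> 1 \<longrightarrow> \<bar>L U H\<bar> \<le> K \<and>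
      \<bar>EH (U + H) - EH U - L U H\<bar> \<le> K * (norm H)\<^sup>2" for R
  proof -
    have "EH (U + H) = EN (\<lambda>x. rep_H2 U x + rep_H2 H x)" for U H
      unfolding energy_H2_rep by (rule energy_cong[OF rep_H2_add])
    moreover obtain K where "\<forall>u\<in>H2_fun. \<forall>h\<in>H2_fun. H2_norm u \<le> R \<longrightarrow> H2_norm h \<le> 1 \<longrightarrow>
       \<bar>DE u h\<bar> \<le> K \<and>
       \<bar>EN (\<lambda>x. u x + h x) - EN u - DE u h\<bar>
         \<le> K * (H2_norm h)\<^sup>2"
      using energy_expansion[of R] by blast
    ultimately show ?thesis
      by (intro exI[of _ K]) (simp add: L_def norm_H2_rep energy_H2_rep rep_H2_fun)
  qed
  ultimately show "(EH has_derivative L U) (at U)" "C1_functional (EH)"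
    by (rule C1_functional_criterion)+
qed

text \<open>By uniqueness of the derivative the class is critical exactly when the candidate
  derivative vanishes on all classes, and every Sobolev function represents a class.\<close>

lemma critical_point_iff_energy_deriv:
  assumes u: "u \<in> H2_fun"
  shows "critical_point (EH) (abs_H2 u) \<longleftrightarrow>
    (\<forall>\<phi>\<in>H2_fun. DE u \<phi> = 0)"
proof -
  let ?L = "\<lambda>H. DE (rep_H2 (abs_H2 u)) (rep_H2 H)"
  note D = energy_H2_C1(1)[of "abs_H2 u"]
  have eq: "DE u \<phi> = ?L (abs_H2 \<phi>)" if "\<phi> \<in> H2_fun" for \<phi>
    by (rule energy_deriv_cong[symmetric, OF rep_abs_H2[OF u] rep_abs_H2[OF that]])
  have "critical_point (EH) (abs_H2 u) \<longleftrightarrow> ?L = (\<lambda>H. 0)"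
  proof
    assume "critical_point (EH) (abs_H2 u)"
    then show "?L = (\<lambda>H. 0)" unfolding critical_point_def by (rule has_derivative_unique[OF D])
  next
    assume "?L = (\<lambda>H. 0)"
    then show "critical_point (EH) (abs_H2 u)" using D by (simp add: critical_point_def)
  qed
  also have "\<dots> \<longleftrightarrow> (\<forall>\<phi>\<in>H2_fun. DE u \<phi> = 0)"
  proof
    assume "?L = (\<lambda>H. 0)"
    from fun_cong[OF this] show "\<forall>\<phi>\<in>H2_fun. DE u \<phi> = 0" using eq by simp
  next
    assume *: "\<forall>\<phi>\<in>H2_fun. DE u \<phi> = 0"
    show "?L = (\<lambda>H. 0)"
    proof
      fix H show "?L H = 0" using * eq[OF rep_H2_fun, of H] rep_H2_fun[of H] by (simp add: abs_rep_H2)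
    qed
  qed
  finally show ?thesis .
qed

lemma energy_well_definedI:
  assumes u: "u \<in> H2_fun"
  shows "energy_well_defined f s \<sigma> u"
proof -
  have "weakly_differentiable (shift \<sigma> u)"
    using shifted_weak_pd(1)[OF w u] unfolding weakly_differentiable_def by blast
  moreover have "integrable torus (potential_density f s (shift \<sigma> u))"
    using potential_terms(1)[OF w g gb C0 u u, of s] by (simp add: potential_density_def[abs_def] nl0_def)
  ultimately show ?thesis
    using gradient_density_integral(1)[OF u] by (simp add: energy_well_defined_def)
qed

end

theorem lemma1p3:
  fixes m n :: nat and p q :: "nat \<Rightarrow> real^2" and A s \<epsilon> lam :: real
    and f :: "real \<Rightarrow> real" and \<sigma> :: "real^2 \<Rightarrow> real"
  assumes "m > n"
    and "A = 4 * pi * (real m - real n)"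
    and "vortex_potential m n p q A \<sigma>"
    and "hyp_f0 f" and "hyp_f1 f s" and "hyp_f2 f"
    and "\<epsilon> > 0" and "lam > 0"
  shows "(\<forall>u\<in>H2_fun. energy_well_defined f s \<sigma> u)
     \<and> C1_functional (energy_H2 f s A \<sigma> \<epsilon> lam)
     \<and> (\<forall>u\<in>H2_fun. weak_solution f s A \<sigma> \<epsilon> lam u \<longleftrightarrow>
            critical_point (energy_H2 f s A \<sigma> \<epsilon> lam) (abs_H2 u))"
proof -
  obtain w where w: "\<And>i. is_weak_pd i \<sigma> (w i)" "\<And>i. integrable torus (\<lambda>x. (w i x)\<^sup>2 / (1 + (\<sigma> x)\<^sup>2))"
    using vortex_regularity[OF assms(3)] by blast
  obtain nl3 C where g: "\<And>t. (nl0 f has_real_derivative nl1 f t) (at t)"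
    "\<And>t. (nl1 f has_real_derivative nl2 f t) (at t)" "\<And>t. (nl2 f has_real_derivative nl3 t) (at t)"
    and gb: "\<And>t. \<bar>nl0 f t\<bar> \<le> C" "\<And>t. \<bar>nl1 f t\<bar> \<le> C * exp (- \<bar>t\<bar>)"
    "\<And>t. \<bar>nl2 f t\<bar> \<le> C * exp (- \<bar>t\<bar>)" "\<And>t. \<bar>nl3 t\<bar> \<le> C * exp (- \<bar>t\<bar>)" and C0: "C \<ge> 0"
    using nonlinearity_bounds[OF assms(4-6)] by blast
  note ctx = w g gb C0
  \<comment> \<open>Both sides of the equivalence meet in the vanishing of
    \<open>energy_deriv\<close> on all Sobolev functions.\<close>
  show ?thesis
    using energy_well_definedI[OF ctx] energy_H2_C1(2)[OF ctx]
      weak_solution_iff_energy_deriv[OF ctx] critical_point_iff_energy_deriv[OF ctx] by simp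
qed

end
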